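(* For splittable 3-CVRP and for unit-demand 3-CVRP there is a polynomial-time $\frac{3}{2}$-approximation algorithm.
   Context: An instance of CVRP consists of a complete graph $G$ on vertex set $V\cup\{v_0\}$, where $V=\{v_1,\dots,v_n\}$ are customers and $v_0$ is the depot; a nonnegative edge weight $w$ that is symmetric and satisfies the triangle inequality; a demand $d_i\in\mathbb{Z}_{\geq1}$ for each customer $v_i$; and a vehicle capacity $k\in\mathbb{Z}_{\geq1}$. A tour is a closed walk starting and ending at $v_0$ that delivers a total amount of at most $k$ to the customers on it; a feasible solution (itinerary) is a collection of tours whose deliveries meet every customer's demand; its cost is the total weight of all edges traversed. In the unit-demand version all $d_i=1$; in the splittable version a customer's demand may be split among several tours; in the unsplittable version each customer's whole demand must be delivered by a single tour. $k$-CVRP denotes the problem with a fixed constant capacity $k$. A $\rho$-approximation algorithm runs in polynomial time and outputs a feasible solution of cost at most $\rho$ times the optimum. *)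

theory Defs
  imports Complex_Main "HOL-Library.Log_Nat" "HOL-Computational_Algebra.Polynomial"
begin

text \<open>
  Model of computation: while programs over S-expressions with integer atoms, charged by
  bit size. The output of a run is never larger than its cost, the basic operations are
  computable in time polynomial in the bit sizes involved, and the number of values alive at
  any time is bounded by the program text. Hence polynomial cost in this model coincides with
  polynomial time on Turing machines (for the converse, a tape is a pair of lists).
\<close>

datatype val = Num int | Pair val val

fun bit_size :: "val \<Rightarrow> nat" where
  "bit_size (Num z) = Suc (nat (bitlen \<bar>z\<bar>))"
| "bit_size (Pair a b) = Suc (bit_size a + bit_size b)"

datatype basic = Id | Const val | Fst | Snd | IsPair | Add | Sub | Mul | Div | Mod | Less

text \<open>Operations applied to arguments of the wrong shape act as the identity.\<close>

fun apply_basic :: "basic \<Rightarrow> val \<Rightarrow> val" where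
  "apply_basic (Const c) x = c"
| "apply_basic Fst (Pair a b) = a"
| "apply_basic Snd (Pair a b) = b"
| "apply_basic IsPair (Pair a b) = Num 1"
| "apply_basic IsPair (Num z) = Num 0"
| "apply_basic Add (Pair (Num a) (Num b)) = Num (a + b)"
| "apply_basic Sub (Pair (Num a) (Num b)) = Num (a - b)"
| "apply_basic Mul (Pair (Num a) (Num b)) = Num (a * b)"
| "apply_basic Div (Pair (Num a) (Num b)) = Num (a div b)"
| "apply_basic Mod (Pair (Num a) (Num b)) = Num (a mod b)"
| "apply_basic Less (Pair (Num a) (Num b)) = Num (if a < b then 1 else 0)"
| "apply_basic _ x = x"

datatype prog =
    Basic basic
  | Seq prog prog
  | Fork prog prog
  | Cond prog prog prog
  | While prog prog

text \<open>
  \<open>run p x y t\<close>: on input \<open>x\<close>, program \<open>p\<close> halts with output \<open>y\<close> at cost \<open>t\<close>.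
  Tests read \<open>Num 0\<close> as false and every other value as true.
\<close>

inductive run :: "prog \<Rightarrow> val \<Rightarrow> val \<Rightarrow> nat \<Rightarrow> bool" where
  basic: "run (Basic f) x (apply_basic f x) (bit_size x + bit_size (apply_basic f x))"
| seq: "run p x y s \<Longrightarrow> run q y z t \<Longrightarrow> run (Seq p q) x z (Suc (s + t))"
| fork: "run p x y s \<Longrightarrow> run q x z t \<Longrightarrow> run (Fork p q) x (Pair y z) (bit_size x + s + t)"
| cond_true: "run b x c s \<Longrightarrow> c \<noteq> Num 0 \<Longrightarrow> run p x y t \<Longrightarrow>
    run (Cond b p q) x y (bit_size x + s + t)"
| cond_false: "run b x (Num 0) s \<Longrightarrow> run q x y t \<Longrightarrow>
    run (Cond b p q) x y (bit_size x + s + t)"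
| while_true: "run b x c s \<Longrightarrow> c \<noteq> Num 0 \<Longrightarrow> run p x y t \<Longrightarrow> run (While b p) y z u \<Longrightarrow>
    run (While b p) x z (bit_size x + s + t + u)"
| while_false: "run b x (Num 0) s \<Longrightarrow> run (While b p) x x (bit_size x + s)"

text \<open>
  CVRP instances. Vertex \<open>0\<close> is the depot and \<open>1, \<dots>, n\<close> are the customers. Weights are
  rational so that instances are finite objects. A complete graph has no loops; the diagonal
  of the weight matrix is fixed to \<open>0\<close>, which makes the triangle inequality
  for all triples equivalent to the one for distinct vertices.
\<close>

record cvrp =
  customers :: nat
  weight :: "nat \<Rightarrow> nat \<Rightarrow> rat"
  demand :: "nat \<Rightarrow> nat"
  capacity :: nat

definition cvrp_instance :: "cvrp \<Rightarrow> bool" where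
  "cvrp_instance I \<longleftrightarrow>
     (\<forall>u\<le>customers I. weight I u u = 0) \<and>
     (\<forall>u\<le>customers I. \<forall>v\<le>customers I. weight I u v \<ge> 0 \<and> weight I u v = weight I v u) \<and>
     (\<forall>u\<le>customers I. \<forall>v\<le>customers I. \<forall>x\<le>customers I.
        weight I u x \<le> weight I u v + weight I v x) \<and>
     (\<forall>v\<in>{1..customers I}. demand I v \<ge> 1) \<and>
     capacity I \<ge> 1"

definition splittable_cvrp :: "nat \<Rightarrow> cvrp set" where
  "splittable_cvrp k = {I. cvrp_instance I \<and> capacity I = k}"

definition unit_demand_cvrp :: "nat \<Rightarrow> cvrp set" where
  "unit_demand_cvrp k =
     {I. cvrp_instance I \<and> capacity I = k \<and> (\<forall>v\<in>{1..customers I}. demand I v = 1)}"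

text \<open>
  A tour consists of the vertex sequence of its closed walk, depot included at both ends, and
  of the integral amounts it delivers. Amounts being integral, the splittable feasibility
  notion below forces each customer of a unit-demand instance to be served by a single tour.
\<close>

type_synonym tour = "nat list \<times> (nat \<Rightarrow> nat)"

fun is_tour :: "cvrp \<Rightarrow> tour \<Rightarrow> bool" where
  "is_tour I (r, a) \<longleftrightarrow>
     r \<noteq> [] \<and> hd r = 0 \<and> last r = 0 \<and> set r \<subseteq> {0..customers I} \<and> successively (\<noteq>) r \<and>
     (\<forall>v. a v > 0 \<longrightarrow> v \<in> set r - {0}) \<and>
     (\<Sum>v\<in>{1..customers I}. a v) \<le> capacity I"

definition feasible :: "cvrp \<Rightarrow> tour list \<Rightarrow> bool" where
  "feasible I Ts \<longleftrightarrow>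
     (\<forall>T\<in>set Ts. is_tour I T) \<and>
     (\<forall>v\<in>{1..customers I}. (\<Sum>T\<leftarrow>Ts. snd T v) = demand I v)"

definition cost :: "cvrp \<Rightarrow> tour list \<Rightarrow> rat" where
  "cost I Ts = (\<Sum>(r, a)\<leftarrow>Ts. \<Sum>(u, v)\<leftarrow>zip r (tl r). weight I u v)"

definition opt :: "cvrp \<Rightarrow> real" where
  "opt I = (INF Ts\<in>{Ts. feasible I Ts}. of_rat (cost I Ts))"

text \<open>Encodings. All numbers are atoms and hence measured in binary.\<close>

fun enc_list :: "val list \<Rightarrow> val" where
  "enc_list [] = Num 0"
| "enc_list (x # xs) = Pair x (enc_list xs)"

definition enc_nat :: "nat \<Rightarrow> val" where
  "enc_nat m = Num (int m)"

definition enc_rat :: "rat \<Rightarrow> val" where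
  "enc_rat q = (case quotient_of q of (a, b) \<Rightarrow> Pair (Num a) (Num b))"

definition enc_cvrp :: "cvrp \<Rightarrow> val" where
  "enc_cvrp I = enc_list
     [enc_nat (customers I),
      enc_nat (capacity I),
      enc_list (map (\<lambda>v. enc_nat (demand I v)) [1..<Suc (customers I)]),
      enc_list (map (\<lambda>u. enc_list (map (\<lambda>v. enc_rat (weight I u v)) [0..<Suc (customers I)]))
        [0..<Suc (customers I)])]"

text \<open>
  With demands in binary, an itinerary can contain exponentially many tours, so identical
  tours are output once together with their multiplicity.
\<close>

definition expand :: "(nat \<times> tour) list \<Rightarrow> tour list" where
  "expand ms = concat (map (\<lambda>(m, T). replicate m T) ms)"

definition enc_tour :: "cvrp \<Rightarrow> tour \<Rightarrow> val" where
  "enc_tour I T = Pair (enc_list (map enc_nat (fst T)))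
     (enc_list (map (\<lambda>v. enc_nat (snd T v)) [1..<Suc (customers I)]))"

definition enc_itinerary :: "cvrp \<Rightarrow> (nat \<times> tour) list \<Rightarrow> val" where
  "enc_itinerary I ms = enc_list (map (\<lambda>(m, T). Pair (enc_nat m) (enc_tour I T)) ms)"

definition poly_time_approx :: "real \<Rightarrow> cvrp set \<Rightarrow> prog \<Rightarrow> bool" where
  "poly_time_approx \<rho> C p \<longleftrightarrow>
     (\<exists>q :: nat poly. \<forall>I\<in>C. \<exists>ms t.
        run p (enc_cvrp I) (enc_itinerary I ms) t \<and>
        t \<le> poly q (bit_size (enc_cvrp I)) \<and>
        feasible I (expand ms) \<and>
        of_rat (cost I (expand ms)) \<le> \<rho> * opt I)"

end

theory Submission
  imports Defs
begin

text \<open>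
  Consider the assignment problem on the vertices in which \<open>u \<noteq> v\<close> costs \<open>w u v\<close>, and \<open>v = v\<close>
  costs \<open>2 * w 0 v\<close> for customers of demand 1 and nothing for all other vertices. Let \<open>C\<close> be its
  optimum and \<open>R\<close> the sum of \<open>w 0 v\<close> over all demanded units.

  The cycles of an optimal permutation are cut into tours. Cutting the unit demands of a cycle
  into pairs (and one triple, if their number is odd) can be done in two ways that together cost at
  most \<open>2 * R + C\<close>, each edge of the cycle being used in one of them; larger demands can be
  served alone at cost at most \<open>w 0 v\<close> per unit. The better way costs at most \<open>R + C / 2\<close>.

  Conversely, \<open>2 * R + C \<le> 3 * OPT\<close>. For units \<open>x\<close>, \<open>y\<close>, \<open>z\<close> on a tour of cost \<open>t\<close>, the triangle
  inequality gives \<open>w 0 x + w x y + w y 0 \<le> t\<close>; adding the three cyclic versions, \<open>3 * t\<close> is at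
  least twice the radial weight of the three units plus the perimeter of their triangle, and the
  perimeters pay for \<open>C\<close> by linear programming duality.

  The assignment is found by the Hungarian method. Its potentials at most quadruple in each of
  the quadratically many steps, so they keep polynomially many bits. Large demands need no special
  care because equal tours are output with multiplicities.
\<close>

section \<open>Polynomial-time computable functions on encoded data\<close>

text \<open>An assignment replaces a matching of unit demands: 2-cycles are matched pairs, longer
  cycles put weight one half on each edge, and only bipartite duality is needed. Averaging the two
  ways of cutting undoes the fractionality. The diagonal is the price of having no partner: a unit
  customer served alone costs \<open>w 0 v\<close> beyond its radial share in each of the two
  solutions. A demand \<open>e \<ge> 2\<close> needs no partner, since
  \<open>2 * ceil (e / 3) \<le> e\<close>, so such vertices stay fixed for free.

  The assignment lives on vertices, not on demanded units, of which there may be exponentially many.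
  This shapes the lower bound: an itinerary may let one large customer share tours with many unit
  customers, yet it is a single vertex of the assignment. Two unit customers with a common host
  could be paired with each other instead; in dual terms at most one tour per host violates its
  inequality, and the nonpositive potential of the host absorbs the excess.\<close>

lemma bit_size_pos: "1 \<le> bit_size v"
  by (cases v) auto

lemma run_output_le_cost: "run p x y t \<Longrightarrow> bit_size y \<le> t"
proof (induction rule: run.induct)
  case (fork p x y s q z t)
  then show ?case using bit_size_pos[of x] by simp
qed auto

text \<open>Costs are bounded by polynomials with natural coefficients because these are monotone: a
  bound on an intermediate size may be substituted for the size itself.\<close>

lemma poly_nat_mono:
  fixes q :: "nat poly"
  assumes "a \<le> b"
  shows "poly q a \<le> poly q b"
  using assms by (induction q) (auto intro!: add_mono mult_mono)

lemma le_poly_trans: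
  fixes q :: "nat poly"
  shows "t \<le> poly q a \<Longrightarrow> a \<le> b \<Longrightarrow> t \<le> poly q b"
  using poly_nat_mono order_trans by blast

section \<open>Encodings, and closure of polynomial time under composition and pairing\<close>

class enc =
  fixes enc :: "'a \<Rightarrow> val"

instantiation nat :: enc
begin
definition "enc (n :: nat) = Num (int n)"
instance ..
end

instantiation int :: enc
begin
definition "enc (i :: int) = Num i"
instance ..
end

instantiation bool :: enc
begin
definition "enc (b :: bool) = Num (if b then 1 else 0)"
instance ..
end

text \<open>\<open>None\<close>, \<open>[]\<close>, \<open>False\<close> and \<open>0\<close> are
  all encoded as \<open>Num 0\<close>, and \<open>Some a\<close> like \<open>[a]\<close>.
  Conversions between these types are therefore free, and options reuse the programs for
  lists.\<close>

instantiation option :: (enc) enc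
begin
definition "enc (x :: 'a option) = (case x of None \<Rightarrow> Num 0 | Some a \<Rightarrow> Pair (enc a) (Num 0))"
instance ..
end

instantiation prod :: (enc, enc) enc
begin
definition "enc (p :: 'a \<times> 'b) = Pair (enc (fst p)) (enc (snd p))"
instance ..
end

instantiation list :: (enc) enc
begin
definition "enc (xs :: 'a list) = enc_list (map enc xs)"
instance ..
end

lemma enc_simps [simp]:
  "enc (n :: nat) = Num (int n)" "enc (i :: int) = Num i"
  "enc (b :: bool) = Num (if b then 1 else 0)"
  "enc (u, v) = Pair (enc u) (enc v)"
  "enc ([] :: 'c :: enc list) = Num 0" "enc (x # xs) = Pair (enc x) (enc xs)"
  "enc (None :: 'd :: enc option) = Num 0" "enc (Some y) = Pair (enc y) (Num 0)"
  by (auto simp: enc_nat_def enc_int_def enc_bool_def enc_prod_def enc_list_def enc_option_def)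

abbreviation size_of :: "'a :: enc \<Rightarrow> nat" where
  "size_of x \<equiv> bit_size (enc x)"

text \<open>The bound is required on the whole type, including inputs that encode nothing meaningful
  such as ragged matrices. This is why the algorithm is written with total operations like
  \<open>nth_default\<close>.\<close>

definition ptime :: "('a :: enc \<Rightarrow> 'b :: enc) \<Rightarrow> bool" where
  "ptime f \<longleftrightarrow> (\<exists>p q. \<forall>x. \<exists>t. run p (enc x) (enc (f x)) t \<and> t \<le> poly q (size_of x))"

lemma ptimeE:
  assumes "ptime f"
  obtains p q where "\<And>x. \<exists>t. run p (enc x) (enc (f x)) t \<and> t \<le> poly q (size_of x)"
  using assms unfolding ptime_def by blast

lemma ptimeI:
  assumes "\<And>x. \<exists>t. run p (enc x) (enc (f x)) t \<and> t \<le> poly q (size_of x)"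
  shows "ptime f"
  using assms unfolding ptime_def by blast

lemma ptime_size:
  assumes "ptime f"
  shows "\<exists>q. \<forall>x. size_of (f x) \<le> poly q (size_of x)"
  using assms run_output_le_cost order_trans unfolding ptime_def by meson

lemma ptime_basic:
  assumes "\<And>x. apply_basic b (enc x) = enc (f x)" "\<And>x. size_of (f x) \<le> poly q (size_of x)"
  shows "ptime f"
proof (rule ptimeI)
  fix x
  show "\<exists>t. run (Basic b) (enc x) (enc (f x)) t \<and> t \<le> poly ([:0, 1:] + q) (size_of x)"
    using run.basic[of b "enc x"] assms by (intro exI[of _ "size_of x + size_of (f x)"]) auto
qed

lemma ptime_comp:
  assumes "ptime f" "ptime g"
  shows "ptime (\<lambda>x. g (f x))"
proof -
  obtain p q where p: "\<And>x. \<exists>t. run p (enc x) (enc (f x)) t \<and> t \<le> poly q (size_of x)"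
    using ptimeE[OF assms(1)] by blast
  obtain p' q' where p': "\<And>x. \<exists>t. run p' (enc x) (enc (g x)) t \<and> t \<le> poly q' (size_of x)"
    using ptimeE[OF assms(2)] by blast
  show ?thesis
  proof (rule ptimeI)
    fix x
    obtain t where t: "run p (enc x) (enc (f x)) t" "t \<le> poly q (size_of x)" using p by blast
    obtain s where s: "run p' (enc (f x)) (enc (g (f x))) s" "s \<le> poly q' (size_of (f x))"
      using p' by blast
    \<comment> \<open>The second program starts on an output that is no larger than the cost of the
      first.\<close>
    have "s \<le> poly q' (poly q (size_of x))"
      using s(2) run_output_le_cost[OF t(1)] t(2) by (meson le_poly_trans order_trans)
    then show "\<exists>t. run (Seq p p') (enc x) (enc (g (f x))) t \<and>
        t \<le> poly (1 + q + pcompose q' q) (size_of x)"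
      using run.seq[OF t(1) s(1)] t(2)
      by (intro exI[of _ "Suc (t + s)"]) (auto simp: poly_pcompose)
  qed
qed

named_theorems ptime

lemma ptime_id [ptime]: "ptime (\<lambda>x. x)"
  by (rule ptime_basic[of Id _ "[:0, 1:]"]) auto

lemma ptime_const [ptime]: "ptime (\<lambda>_. c)"
  by (rule ptime_basic[of "Const (enc c)" _ "[:size_of c:]"]) auto

lemma ptime_Pair [ptime]:
  assumes "ptime f" "ptime g"
  shows "ptime (\<lambda>x. (f x, g x))"
proof -
  obtain p q where p: "\<And>x. \<exists>t. run p (enc x) (enc (f x)) t \<and> t \<le> poly q (size_of x)"
    using ptimeE[OF assms(1)] by blast
  obtain p' q' where p': "\<And>x. \<exists>t. run p' (enc x) (enc (g x)) t \<and> t \<le> poly q' (size_of x)"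
    using ptimeE[OF assms(2)] by blast
  show ?thesis
  proof (rule ptimeI)
    fix x
    obtain t where t: "run p (enc x) (enc (f x)) t" "t \<le> poly q (size_of x)" using p by blast
    obtain s where s: "run p' (enc x) (enc (g x)) s" "s \<le> poly q' (size_of x)" using p' by blast
    show "\<exists>t. run (Fork p p') (enc x) (enc (f x, g x)) t \<and>
        t \<le> poly ([:0, 1:] + q + q') (size_of x)"
      using run.fork[OF t(1) s(1)] t(2) s(2)
      by (intro exI[of _ "size_of x + t + s"]) auto
  qed
qed

lemma ptime_fst' : "ptime (fst :: 'a :: enc \<times> 'b :: enc \<Rightarrow> 'a)"
  by (rule ptime_basic[of Fst _ "[:0, 1:]"]) (auto simp: enc_prod_def)

lemma ptime_snd' : "ptime (snd :: 'a :: enc \<times> 'b :: enc \<Rightarrow> 'b)"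
  by (rule ptime_basic[of Snd _ "[:0, 1:]"]) (auto simp: enc_prod_def)

lemmas ptime_fst [ptime] = ptime_comp[OF _ ptime_fst']
lemmas ptime_snd [ptime] = ptime_comp[OF _ ptime_snd']

lemma ptime_comp2:
  assumes "ptime (\<lambda>p. h (fst p) (snd p))" "ptime f" "ptime g"
  shows "ptime (\<lambda>x. h (f x) (g x))"
  using ptime_comp[OF ptime_Pair[OF assms(2,3)] assms(1)] by simp

lemma ptime_Let [ptime]:
  assumes "ptime f" "ptime (\<lambda>p. h (fst p) (snd p))"
  shows "ptime (\<lambda>x. let y = f x in h x y)"
  using ptime_comp2[OF assms(2) ptime_id assms(1)] by (simp add: Let_def)

section \<open>Bit lengths of integer arithmetic\<close>

lemma bitlen_0_1 [simp]: "bitlen 0 = 0" "bitlen 1 = 1"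
  by (auto simp: bitlen_def floorlog_def)

lemma bitlen_le_iff: "nat (bitlen \<bar>i\<bar>) \<le> k \<longleftrightarrow> nat \<bar>i\<bar> < 2 ^ k"
proof -
  have "nat (bitlen \<bar>i\<bar>) \<le> k \<longleftrightarrow> bitlen \<bar>i\<bar> \<le> int k"
    by linarith
  also have "\<dots> \<longleftrightarrow> \<bar>i\<bar> < 2 ^ k"
    by (simp add: bitlen_le_iff_power)
  also have "\<dots> \<longleftrightarrow> int (nat \<bar>i\<bar>) < int (2 ^ k)"
    by simp
  finally show ?thesis
    by (simp only: of_nat_less_iff)
qed

lemma abs_lt_bitlen: "nat \<bar>i\<bar> < 2 ^ nat (bitlen \<bar>i\<bar>)"
  using bitlen_le_iff by blast

lemma size_of_Num_le:
  assumes "nat \<bar>i\<bar> < 2 ^ k"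
  shows "bit_size (Num i) \<le> Suc k"
  using assms bitlen_le_iff by simp

lemma abs_div_le_abs: "\<bar>a div b\<bar> \<le> \<bar>a\<bar>" for a b :: int
proof -
  have pos: "\<bar>a div b\<bar> \<le> \<bar>a\<bar>" if "b > 0" for a b :: int
  proof (cases "a \<ge> 0")
    case True
    then show ?thesis using that by (cases "a = 0") (auto simp: pos_imp_zdiv_nonneg_iff int_div_le_self)
  next
    case False
    then have "a div b < 0" using that by (simp add: div_neg_pos_less0)
    \<comment> \<open>For \<open>q = a div b < 0\<close> the factor \<open>q + 1\<close> is at most
      0, so multiplying it by \<open>b \<ge> 1\<close> cannot increase it:
      \<open>a < b * (q + 1) \<le> q + 1\<close>.\<close>
    have "b * (a div b + 1) \<le> 1 * (a div b + 1)"
      using that \<open>a div b < 0\<close> by (intro mult_right_mono_neg) auto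
    moreover have "a < b * (a div b + 1)"
      using that mult_div_mod_eq[of b a] pos_mod_bound[of b a] unfolding distrib_left by linarith
    ultimately show ?thesis using False \<open>a div b < 0\<close> by simp
  qed
  show ?thesis
    using pos[of b a] pos[of "- b" "- a"] by (cases b "0 :: int" rule: linorder_cases) auto
qed

text \<open>An atom is charged one more than its bit length, so the two sizes add up to
  \<open>k + l + 2\<close>. Of these, one unit is charged for the resulting atom and the other pays
  for the carry bit of a sum.\<close>

lemma size_Num_arith:
  "bit_size (Num (a + b)) \<le> bit_size (Num a) + bit_size (Num b)"
  "bit_size (Num (a - b)) \<le> bit_size (Num a) + bit_size (Num b)"
  "bit_size (Num (a * b)) \<le> bit_size (Num a) + bit_size (Num b)"
  "bit_size (Num (a div b)) \<le> bit_size (Num a) + bit_size (Num b)"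
  "bit_size (Num (a mod b)) \<le> bit_size (Num a) + bit_size (Num b)"
proof -
  define k l where "k = nat (bitlen \<bar>a\<bar>)" and "l = nat (bitlen \<bar>b\<bar>)"
  have a: "nat \<bar>a\<bar> < 2 ^ k" and b: "nat \<bar>b\<bar> < 2 ^ l"
    unfolding k_def l_def by (rule abs_lt_bitlen)+
  have k1: "(2::nat) ^ k \<le> 2 ^ (k + l)" "(2::nat) ^ l \<le> 2 ^ (k + l)"
    by (rule power_increasing; simp)+
  then have sum: "nat \<bar>a\<bar> + nat \<bar>b\<bar> < 2 ^ Suc (k + l)"
    using a b unfolding power_Suc by linarith
  have bound: "bit_size (Num i) \<le> bit_size (Num a) + bit_size (Num b)"
    if "nat \<bar>i\<bar> < 2 ^ Suc (k + l)" for i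
    using size_of_Num_le[OF that] by (simp add: k_def l_def)
  show "bit_size (Num (a + b)) \<le> bit_size (Num a) + bit_size (Num b)"
    using sum by (intro bound) linarith
  show "bit_size (Num (a - b)) \<le> bit_size (Num a) + bit_size (Num b)"
    using sum by (intro bound) linarith
  show "bit_size (Num (a div b)) \<le> bit_size (Num a) + bit_size (Num b)"
  proof (rule bound)
    have "\<bar>a div b\<bar> \<le> \<bar>a\<bar>"
      by (rule abs_div_le_abs)
    then show "nat \<bar>a div b\<bar> < 2 ^ Suc (k + l)" using sum by linarith
  qed
  show "bit_size (Num (a mod b)) \<le> bit_size (Num a) + bit_size (Num b)"
  proof (rule bound)
    have "\<bar>a mod b\<bar> \<le> \<bar>a\<bar> + \<bar>b\<bar>"
      using abs_mod_less[of b a] by (cases "b = 0") auto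
    then show "nat \<bar>a mod b\<bar> < 2 ^ Suc (k + l)" using sum by linarith
  qed
  show "bit_size (Num (a * b)) \<le> bit_size (Num a) + bit_size (Num b)"
  proof (rule bound)
    have "nat \<bar>a * b\<bar> = nat \<bar>a\<bar> * nat \<bar>b\<bar>"
      by (simp add: abs_mult nat_mult_distrib)
    also have "\<dots> \<le> 2 ^ k * 2 ^ l"
      using a b by (intro mult_mono) auto
    also have "\<dots> < 2 ^ Suc (k + l)"
      by (simp add: power_add)
    finally show "nat \<bar>a * b\<bar> < 2 ^ Suc (k + l)" .
  qed
qed

lemma ptime_arith:
  assumes "ptime f" "ptime g"
    and "\<And>a b. apply_basic p (Pair (Num a) (Num b)) = Num (h a b)"
    and "\<And>a b. bit_size (Num (h a b)) \<le> bit_size (Num a) + bit_size (Num b)"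
  shows "ptime (\<lambda>x. h (f x) (g x) :: int)"
proof (rule ptime_comp2[OF _ assms(1,2)], rule ptime_basic[of p _ "[:0, 1:]"])
  fix x :: "int \<times> int"
  show "apply_basic p (enc x) = enc (h (fst x) (snd x))"
    by (cases x) (simp add: assms(3))
  show "size_of (h (fst x) (snd x)) \<le> poly [:0, 1:] (size_of x)"
    using assms(4)[of "fst x" "snd x"] by (cases x) simp
qed

lemma ptime_add_int [ptime]: "ptime f \<Longrightarrow> ptime g \<Longrightarrow> ptime (\<lambda>x. f x + g x :: int)"
  by (rule ptime_arith[of _ _ Add]) (use size_Num_arith in \<open>auto simp del: bit_size.simps\<close>)

lemma ptime_diff_int [ptime]: "ptime f \<Longrightarrow> ptime g \<Longrightarrow> ptime (\<lambda>x. f x - g x :: int)"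
  by (rule ptime_arith[of _ _ Sub]) (use size_Num_arith in \<open>auto simp del: bit_size.simps\<close>)

lemma ptime_mult_int [ptime]: "ptime f \<Longrightarrow> ptime g \<Longrightarrow> ptime (\<lambda>x. f x * g x :: int)"
  by (rule ptime_arith[of _ _ Mul]) (use size_Num_arith in \<open>auto simp del: bit_size.simps\<close>)

lemma ptime_div_int [ptime]: "ptime f \<Longrightarrow> ptime g \<Longrightarrow> ptime (\<lambda>x. f x div g x :: int)"
  by (rule ptime_arith[of _ _ Div]) (use size_Num_arith in \<open>auto simp del: bit_size.simps\<close>)

lemma ptime_mod_int [ptime]: "ptime f \<Longrightarrow> ptime g \<Longrightarrow> ptime (\<lambda>x. f x mod g x :: int)"
  by (rule ptime_arith[of _ _ Mod]) (use size_Num_arith in \<open>auto simp del: bit_size.simps\<close>)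

text \<open>A program sees encodings only, so functions with equal encoded results share their
  program. This gives coercions such as \<open>int\<close> at no cost.\<close>

lemma ptime_recode:
  assumes "\<And>x. enc (f x) = enc (g x)" "ptime f"
  shows "ptime g"
  using assms(2) unfolding ptime_def assms(1) .

lemma ptime_int [ptime]: "ptime f \<Longrightarrow> ptime (\<lambda>x. int (f x))"
  by (rule ptime_recode[of f]) auto

lemma ptime_of_int:
  assumes "ptime (\<lambda>x. int (f x))" shows "ptime f"
  by (rule ptime_recode[OF _ assms]) auto

lemma ptime_add_nat [ptime]: "ptime f \<Longrightarrow> ptime g \<Longrightarrow> ptime (\<lambda>x. f x + g x :: nat)"
  by (rule ptime_of_int) (auto intro!: ptime)

lemma ptime_div_nat [ptime]: "ptime f \<Longrightarrow> ptime g \<Longrightarrow> ptime (\<lambda>x. f x div g x :: nat)"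
  by (rule ptime_of_int) (auto intro!: ptime simp: zdiv_int)

lemma ptime_mod_nat [ptime]: "ptime f \<Longrightarrow> ptime g \<Longrightarrow> ptime (\<lambda>x. f x mod g x :: nat)"
  by (rule ptime_of_int) (auto intro!: ptime simp: zmod_int)

lemma ptime_Suc [ptime]: "ptime f \<Longrightarrow> ptime (\<lambda>x. Suc (f x))"
  using ptime_add_nat[OF _ ptime_const, of f 1] by simp

section \<open>Case distinctions\<close>

lemma ptime_if [ptime]:
  assumes "ptime b" "ptime f" "ptime g"
  shows "ptime (\<lambda>x. if b x then f x else g x)"
proof -
  obtain pb qb where b: "\<And>x. \<exists>t. run pb (enc x) (enc (b x)) t \<and> t \<le> poly qb (size_of x)"
    using ptimeE[OF assms(1)] by blast
  obtain p q where p: "\<And>x. \<exists>t. run p (enc x) (enc (f x)) t \<and> t \<le> poly q (size_of x)"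
    using ptimeE[OF assms(2)] by blast
  obtain p' q' where p': "\<And>x. \<exists>t. run p' (enc x) (enc (g x)) t \<and> t \<le> poly q' (size_of x)"
    using ptimeE[OF assms(3)] by blast
  show ?thesis
  proof (rule ptimeI)
    fix x
    obtain r where r: "run pb (enc x) (enc (b x)) r" "r \<le> poly qb (size_of x)" using b by blast
    obtain t where t: "run p (enc x) (enc (f x)) t" "t \<le> poly q (size_of x)" using p by blast
    obtain s where s: "run p' (enc x) (enc (g x)) s" "s \<le> poly q' (size_of x)" using p' by blast
    show "\<exists>t. run (Cond pb p p') (enc x) (enc (if b x then f x else g x)) t \<and>
        t \<le> poly ([:0, 1:] + qb + q + q') (size_of x)"
    proof (cases "b x")
      case True
      then show ?thesis
        using run.cond_true[OF r(1) _ t(1)] r(2) t(2)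
        by (intro exI[of _ "size_of x + r + t"]) auto
    next
      case False
      then have "run pb (enc x) (Num 0) r" using r(1) by simp
      then show ?thesis
        using run.cond_false[OF _ s(1)] r(2) s(2) False
        by (intro exI[of _ "size_of x + r + s"]) auto
    qed
  qed
qed

lemma ptime_not [ptime]:
  assumes "ptime f" shows "ptime (\<lambda>x. \<not> f x)"
  by (rule ptime_recode[OF _ ptime_if[OF assms ptime_const[of False] ptime_const[of True]]]) auto

lemma ptime_conj [ptime]: "ptime f \<Longrightarrow> ptime g \<Longrightarrow> ptime (\<lambda>x. f x \<and> g x)"
  using ptime_if[OF _ _ ptime_const, of f g False] by (rule back_subst[of ptime]) auto

lemma ptime_less_int [ptime]:
  assumes "ptime f" "ptime g"
  shows "ptime (\<lambda>x. f x < (g x :: int))"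
proof (rule ptime_comp2[OF _ assms], rule ptime_basic[of Less _ "[:4:]"])
  fix x :: "int \<times> int"
  show "apply_basic Less (enc x) = enc (fst x < snd x)"
    by (cases x) simp
  show "size_of (fst x < snd x) \<le> poly [:4:] (size_of x)"
    by simp
qed

lemma ptime_less_nat [ptime]: "ptime f \<Longrightarrow> ptime g \<Longrightarrow> ptime (\<lambda>x. f x < (g x :: nat))"
  using ptime_less_int[OF ptime_int ptime_int, of f g] by simp

lemma ptime_eq_int [ptime]:
  assumes "ptime f" "ptime g"
  shows "ptime (\<lambda>x. f x = (g x :: int))"
proof -
  have "ptime (\<lambda>x. \<not> f x < g x \<and> \<not> g x < f x)"
    using assms by (intro ptime)
  then show ?thesis
    by (rule back_subst[of ptime]) auto
qed

lemma ptime_eq_nat [ptime]: "ptime f \<Longrightarrow> ptime g \<Longrightarrow> ptime (\<lambda>x. f x = (g x :: nat))"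
  using ptime_eq_int[OF ptime_int ptime_int, of f g] by simp

lemma ptime_Some [ptime]:
  assumes "ptime f" shows "ptime (\<lambda>x. Some (f x))"
  by (rule ptime_recode[OF _ ptime_Pair[OF assms ptime_const[of False]]]) auto

lemma ptime_Cons [ptime]:
  assumes "ptime f" "ptime g" shows "ptime (\<lambda>x. f x # g x)"
  by (rule ptime_recode[OF _ ptime_Pair[OF assms]]) auto

lemma ptime_case_list [ptime]:
  assumes f: "ptime f" and g: "ptime g" and h: "ptime (\<lambda>p. h (fst p) (fst (snd p)) (snd (snd p)))"
  shows "ptime (\<lambda>x. case f x of [] \<Rightarrow> g x | a # l \<Rightarrow> h x a l)"
proof -
  obtain pf qf where pf: "\<And>x. \<exists>t. run pf (enc x) (enc (f x)) t \<and> t \<le> poly qf (size_of x)"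
    using ptimeE[OF f] by blast
  obtain pg qg where pg: "\<And>x. \<exists>t. run pg (enc x) (enc (g x)) t \<and> t \<le> poly qg (size_of x)"
    using ptimeE[OF g] by blast
  obtain ph qh where ph: "\<And>x. \<exists>t. run ph (enc x) (enc (h (fst x) (fst (snd x)) (snd (snd x)))) t
      \<and> t \<le> poly qh (size_of x)"
    using ptimeE[OF h] by blast
  let ?p = "Cond (Seq pf (Basic IsPair)) (Seq (Fork (Basic Id) pf) ph) pg"
  let ?q = "[:0, 10:] + [:10:] * qf + qg + pcompose qh ([:1, 1:] + qf) + [:10:]"
  show ?thesis
  proof (rule ptimeI[of ?p _ ?q])
    fix x
    obtain t where t: "run pf (enc x) (enc (f x)) t" "t \<le> poly qf (size_of x)" using pf by blast
    obtain s where s: "run pg (enc x) (enc (g x)) s" "s \<le> poly qg (size_of x)" using pg by blast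
    have st: "size_of (f x) \<le> t" using t(1) by (rule run_output_le_cost)
    show "\<exists>t. run ?p (enc x) (enc (case f x of [] \<Rightarrow> g x | a # l \<Rightarrow> h x a l)) t \<and>
        t \<le> poly ?q (size_of x)"
    proof (cases "f x")
      case Nil
      have "run (Basic IsPair) (enc (f x)) (Num 0) (size_of (f x) + 1)"
        using run.basic[of IsPair "enc (f x)"] Nil by simp
      from run.cond_false[OF run.seq[OF t(1) this] s(1), of "Seq (Fork (Basic Id) pf) ph"]
      show ?thesis
        using t(2) s(2) st unfolding Nil list.case by (intro exI conjI) (simp_all only: poly_add poly_mult poly_pcompose, simp_all)
    next
      case (Cons a l)
      have 1: "run (Basic IsPair) (enc (f x)) (Num 1) (size_of (f x) + 2)"
        using run.basic[of IsPair "enc (f x)"] Cons by simp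
      have 2: "run (Fork (Basic Id) pf) (enc x) (enc (x, f x)) (size_of x + (size_of x + size_of x) + t)"
        using run.fork[OF run.basic[of Id] t(1)] by simp
      \<comment> \<open>\<open>(x, a # l)\<close> and \<open>(x, a, l)\<close> have the same
        encoding, so the forked value is already the argument that the program for \<open>h\<close>
        expects.\<close>
      obtain u where u: "run ph (enc (x, f x)) (enc (h x a l)) u" "u \<le> poly qh (size_of (x, f x))"
        using ph[of "(x, a, l)"] Cons by auto
      have "u \<le> poly qh (poly ([:1, 1:] + qf) (size_of x))"
        using u(2) by (rule le_poly_trans) (use st t(2) in simp)
      then show ?thesis
        using run.cond_true[OF run.seq[OF t(1) 1] _ run.seq[OF 2 u(1)], of pg] t(2) st
        unfolding Cons list.case
        by (intro exI conjI) (simp_all only: poly_add poly_mult poly_pcompose, simp_all, linarith)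
    qed
  qed
qed

lemma ptime_case_option [ptime]:
  assumes f: "ptime f" and g: "ptime g" and h: "ptime (\<lambda>p. h (fst p) (snd p))"
  shows "ptime (\<lambda>x. case f x of None \<Rightarrow> g x | Some a \<Rightarrow> h x a)"
proof -
  let ?f = "\<lambda>x. case f x of None \<Rightarrow> [] | Some a \<Rightarrow> [a]"
  have "ptime ?f"
    by (rule ptime_recode[OF _ f]) (simp split: option.split)
  then have "ptime (\<lambda>x. case ?f x of [] \<Rightarrow> g x | a # l \<Rightarrow> h x a)"
    using g ptime_comp2[OF h ptime_fst[OF ptime_id] ptime_fst[OF ptime_snd[OF ptime_id]]]
    by (intro ptime)
  then show ?thesis
    by (rule back_subst[of ptime]) (auto split: option.split)
qed

text \<open>The loop state consists of the remaining list, the accumulator and the fixed parameter.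
  The size hypothesis ranges over all prefixes because every intermediate accumulator enters the
  cost, not only the final one. The constants 60 and 100 generously cover the rearrangement of the
  state around \<open>p\<close>.\<close>

lemma run_fold:
  assumes p: "\<And>e s. \<exists>t. run p (enc ((x, e), s)) (enc (h x e s)) t \<and> t \<le> poly q (size_of ((x, e), s))"
    and "\<And>ys zs. xs = ys @ zs \<Longrightarrow> size_of (fold (h x) ys s) \<le> B"
    and "size_of xs \<le> B" "size_of x \<le> B"
  shows "\<exists>t. run (While (Seq (Basic Fst) (Basic IsPair))
        (Fork (Seq (Basic Fst) (Basic Snd))
          (Fork (Seq (Fork (Fork (Seq (Basic Snd) (Basic Snd)) (Seq (Basic Fst) (Basic Fst)))
            (Seq (Basic Snd) (Basic Fst))) p) (Seq (Basic Snd) (Basic Snd)))))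
     (enc (xs, s, x)) (enc ([] :: 'e :: enc list, fold (h x) xs s, x)) t \<and>
     t \<le> (length xs + 1) * (60 * B + 100 + poly q (3 * B + 2))"
  (is "\<exists>t. run (While ?c ?b) _ _ t \<and> _")
  using assms(2,3)
proof (induction xs arbitrary: s)
  case Nil
  have "size_of s \<le> B" using Nil(1)[of "[]" "[]"] by simp
  moreover have "run ?c (enc ([] :: 'e list, s, x)) (Num 0) (Suc ((size_of ([] :: 'e list, s, x) + 1) + 2))"
    using run.seq[OF run.basic[of Fst] run.basic[of IsPair], of "enc ([] :: 'e list, s, x)"] by simp
  ultimately show ?case
    using run.while_false assms(4) by (intro exI conjI, fastforce) (simp)
next
  case (Cons e xs)
  have sB: "size_of s \<le> B" using Cons.prems(1)[of "[]"] by simp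
  let ?s = "h x e s" and ?X = "enc (e # xs, s, x)"
  have s'B: "size_of ?s \<le> B" using Cons.prems(1)[of "[e]" xs] by simp
  have eB: "size_of e + size_of xs + 1 \<le> B" using Cons.prems(2) by simp
  obtain t where t: "run (While ?c ?b) (enc (xs, ?s, x)) (enc ([] :: 'e list, fold (h x) (e # xs) s, x)) t"
     "t \<le> (length xs + 1) * (60 * B + 100 + poly q (3 * B + 2))"
    using Cons.IH[of ?s] Cons.prems(1)[of "e # _"] eB by auto
  obtain u where u: "run p (enc ((x, e), s)) (enc ?s) u" "u \<le> poly q (size_of ((x, e), s))"
    using p by blast
  have uB: "u \<le> poly q (3 * B + 2)"
    using u(2) by (rule le_poly_trans) (use sB eB assms(4) in simp)
  have c: "run ?c ?X (Num 1) (Suc ((bit_size ?X + size_of (e # xs)) + (size_of (e # xs) + 2)))"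
    using run.seq[OF run.basic[of Fst] run.basic[of IsPair], of ?X] by simp
  have s1: "run (Seq (Basic f) (Basic g)) ?X (apply_basic g (apply_basic f ?X))
     (Suc (bit_size ?X + bit_size (apply_basic f ?X) +
       (bit_size (apply_basic f ?X) + bit_size (apply_basic g (apply_basic f ?X)))))" for f g
    by (rule run.seq[OF run.basic run.basic])
  have X': "Pair (Pair (apply_basic Snd (apply_basic Snd ?X)) (apply_basic Fst (apply_basic Fst ?X)))
     (apply_basic Fst (apply_basic Snd ?X)) = enc ((x, e), s)"
    by simp
  note b = run.fork[OF s1[of Fst Snd] run.fork[OF run.seq[OF
      run.fork[OF run.fork[OF s1[of Snd Snd] s1[of Fst Fst]] s1[of Snd Fst]] u(1)[folded X']] s1[of Snd Snd]]]
  have X'': "Pair (apply_basic Snd (apply_basic Fst ?X))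
     (Pair (enc ?s) (apply_basic Snd (apply_basic Snd ?X))) = enc (xs, ?s, x)"
    by simp
  note w = run.while_true[OF c _ b[unfolded X''] t(1)]
  show ?case
    using w sB s'B eB assms(4) t(2) uB by (intro exI conjI, simp) (simp add: algebra_simps)
qed

lemma length_le_size: "length xs \<le> size_of xs"
  by (induction xs) auto

text \<open>All iteration is expressed by folds. The number of rounds is then bounded by the input
  size, and what remains to be shown is that the accumulator stays polynomial.\<close>

lemma ptime_fold:
  fixes h :: "'a :: enc \<Rightarrow> 'b :: enc \<Rightarrow> 'c :: enc \<Rightarrow> 'c"
  assumes h: "ptime (\<lambda>p. h (fst (fst p)) (snd (fst p)) (snd p))" and l: "ptime l" and s: "ptime s"
    and bound: "\<And>x ys zs. l x = ys @ zs \<Longrightarrow> size_of (fold (h x) ys (s x)) \<le> poly r (size_of x)"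
  shows "ptime (\<lambda>x. fold (h x) (l x) (s x))"
proof -
  obtain p q where p: "\<And>y. \<exists>t. run p (enc y) (enc (h (fst (fst y)) (snd (fst y)) (snd y))) t \<and>
      t \<le> poly q (size_of y)"
    using ptimeE[OF h] by blast
  have p: "\<exists>t. run p (enc ((x, e), s)) (enc (h x e s)) t \<and> t \<le> poly q (size_of ((x, e), s))"
    for x :: 'a and e :: 'b and s :: 'c
    using p[of "((x, e), s)"] by simp
  have "ptime (\<lambda>x. (l x, s x, x))"
    using l s by (intro ptime)
  then obtain p1 q1 where p1: "\<And>x. \<exists>t. run p1 (enc x) (enc (l x, s x, x)) t \<and> t \<le> poly q1 (size_of x)"
    using ptimeE by blast
  obtain q2 where q2: "\<And>x. size_of (l x) \<le> poly q2 (size_of x)"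
    using ptime_size[OF l] by blast
  define W where "W = While (Seq (Basic Fst) (Basic IsPair))
        (Fork (Seq (Basic Fst) (Basic Snd))
          (Fork (Seq (Fork (Fork (Seq (Basic Snd) (Basic Snd)) (Seq (Basic Fst) (Basic Fst)))
            (Seq (Basic Snd) (Basic Fst))) p) (Seq (Basic Snd) (Basic Snd))))"
  define b where "b = r + q2 + [:0, 1:]"
  show ?thesis
  proof (rule ptimeI)
    fix x :: 'a
    define B where "B = poly b (size_of x)"
    have B: "size_of x \<le> B" "size_of (l x) \<le> B"
      using q2[of x] by (simp_all add: B_def b_def)
    have B': "size_of (fold (h x) ys (s x)) \<le> B" if "l x = ys @ zs" for ys zs
      using bound[OF that] by (simp add: B_def b_def)
    obtain t where t: "run p1 (enc x) (enc (l x, s x, x)) t" "t \<le> poly q1 (size_of x)"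
      using p1 by blast
    obtain u where u: "run W (enc (l x, s x, x)) (enc ([] :: 'b list, fold (h x) (l x) (s x), x)) u"
       "u \<le> (length (l x) + 1) * (60 * B + 100 + poly q (3 * B + 2))"
      using run_fold[where p = p and q = q and h = h, OF p _ B(2,1), of "s x"] B' unfolding W_def by blast
    have "\<exists>t. run (Seq (Basic Snd) (Basic Fst)) (enc ([] :: 'b list, fold (h x) (l x) (s x), x))
        (enc (fold (h x) (l x) (s x))) t \<and> t \<le> 4 * size_of (fold (h x) (l x) (s x)) + 3 * size_of x + 6"
      using run.seq[OF run.basic[of Snd] run.basic[of Fst], of "enc ([] :: 'b list, fold (h x) (l x) (s x), x)"]
      by (intro exI conjI, simp) simp
    then obtain v where v: "run (Seq (Basic Snd) (Basic Fst)) (enc ([] :: 'b list, fold (h x) (l x) (s x), x))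
        (enc (fold (h x) (l x) (s x))) v" "v \<le> 4 * size_of (fold (h x) (l x) (s x)) + 3 * size_of x + 6"
      by blast
    have "u \<le> (B + 1) * (60 * B + 100 + poly q (3 * B + 2))"
      using u(2) by (rule order_trans) (use length_le_size[of "l x"] B(2) in \<open>intro mult_right_mono; simp\<close>)
    moreover have "size_of (fold (h x) (l x) (s x)) \<le> B"
      using B'[of "l x" "[]"] by simp
    ultimately have "Suc (t + Suc (u + v)) \<le>
       poly q1 (size_of x) + ((1 + B) * (100 + 60 * B + poly q (2 + 3 * B)) + (20 + 20 * B))"
      using t(2) v(2) B by (simp add: algebra_simps)
    then have "Suc (t + Suc (u + v)) \<le>
       poly (q1 + pcompose ([:1, 1:] * ([:100, 60:] + pcompose q [:2, 3:]) + [:20, 20:]) b) (size_of x)"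
      by (simp add: poly_pcompose mult.commute flip: B_def)
    then show "\<exists>t. run (Seq p1 (Seq W (Seq (Basic Snd) (Basic Fst)))) (enc x) (enc (fold (h x) (l x) (s x))) t
       \<and> t \<le> poly (q1 + pcompose ([:1, 1:] * ([:100, 60:] + pcompose q [:2, 3:]) + [:20, 20:]) b) (size_of x)"
      using run.seq[OF t(1) run.seq[OF u(1) v(1)]] by blast
  qed
qed

lemma size_mem_le: "e \<in> set xs \<Longrightarrow> size_of e \<le> size_of xs"
  by (induction xs) auto

text \<open>If each round adds an amount independent of the accumulator, the final size is at most
  the initial one plus the number of rounds times this amount. A merely polynomial bound per round
  would not do, since squaring or doubling sizes compounds.\<close>

lemma ptime_fold_add:
  assumes h: "ptime (\<lambda>p. h (fst (fst p)) (snd (fst p)) (snd p))" and l: "ptime l" and s: "ptime s"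
    and grow: "\<And>x e s. size_of (h x e s) \<le> size_of s + poly r (size_of x + size_of e)"
  shows "ptime (\<lambda>x. fold (h x) (l x) (s x))"
proof -
  obtain ql where ql: "\<And>x. size_of (l x) \<le> poly ql (size_of x)"
    using ptime_size[OF l] by blast
  obtain qs where qs: "\<And>x. size_of (s x) \<le> poly qs (size_of x)"
    using ptime_size[OF s] by blast
  have *: "size_of (fold (h x) ys s) \<le> size_of s + length ys * poly r (size_of x + B)"
    if "\<forall>e\<in>set ys. size_of e \<le> B" for x ys s B
    using that
  proof (induction ys arbitrary: s)
    case (Cons e ys)
    have "size_of (h x e s) \<le> size_of s + poly r (size_of x + B)"
      using grow[of x e s] poly_nat_mono[of "size_of x + size_of e" "size_of x + B" r] Cons.prems
      by fastforce
    moreover have "size_of (fold (h x) ys (h x e s)) \<le> size_of (h x e s) + length ys * poly r (size_of x + B)"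
      using Cons by simp
    ultimately show ?case by simp
  qed simp
  show ?thesis
  proof (rule ptime_fold[OF h l s, of "qs + ql * pcompose r ([:0, 1:] + ql)"])
    fix x ys zs
    assume l: "l x = ys @ zs"
    let ?B = "poly ql (size_of x)"
    have len: "length ys \<le> ?B"
      using length_le_size[of "l x"] ql[of x] l by simp
    have "\<forall>e\<in>set ys. size_of e \<le> ?B"
      using size_mem_le[of _ "l x"] ql[of x] l by fastforce
    from *[OF this, of x "s x"] have
      "size_of (fold (h x) ys (s x)) \<le> size_of (s x) + length ys * poly r (size_of x + ?B)" .
    also have "\<dots> \<le> poly qs (size_of x) + ?B * poly r (size_of x + ?B)"
      using qs[of x] len by (intro add_mono mult_mono) auto
    finally show "size_of (fold (h x) ys (s x)) \<le> poly (qs + ql * pcompose r ([:0, 1:] + ql)) (size_of x)"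
      by (simp add: poly_pcompose)
  qed
qed

section \<open>List operations as folds\<close>

lemma size_of_append: "size_of (xs @ ys) + 1 = size_of xs + size_of ys"
  by (induction xs) auto

lemma fold_Cons_rev: "fold (\<lambda>e s. h e # s) xs ys = rev (map h xs) @ ys"
  by (induction xs arbitrary: ys) auto

lemma ptime_rev_map:
  assumes "ptime (\<lambda>p. h (fst p) (snd p))" "ptime l"
  shows "ptime (\<lambda>x. rev (map (h x) (l x)))"
proof -
  obtain q where q: "\<And>x. size_of (h (fst x) (snd x)) \<le> poly q (size_of x)"
    using ptime_size[OF assms(1)] by blast
  have "ptime (\<lambda>p. h (fst (fst p)) (snd (fst p)))"
    by (rule ptime_comp2[OF assms(1)]; intro ptime)
  then have "ptime (\<lambda>x. fold (\<lambda>e s. h x e # s) (l x) [])"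
  proof (intro ptime_fold_add[where r = "[:1:] + pcompose q [:1, 1:]"] ptime assms(2))
    fix x e and s :: "'c list"
    show "size_of (h x e # s) \<le> size_of s + poly ([:1:] + pcompose q [:1, 1:]) (size_of x + size_of e)"
      using q[of "(x, e)"] by (simp add: poly_pcompose)
  qed
  then show ?thesis
    by (simp add: fold_Cons_rev)
qed

lemma ptime_rev [ptime]:
  assumes "ptime l" shows "ptime (\<lambda>x. rev (l x))"
  using ptime_rev_map[of "\<lambda>x e. e", OF _ assms] by (simp add: ptime)

lemma ptime_map [ptime]:
  assumes "ptime (\<lambda>p. h (fst p) (snd p))" "ptime l"
  shows "ptime (\<lambda>x. map (h x) (l x))"
  using ptime_rev[OF ptime_rev_map[OF assms]] by simp

lemma ptime_append [ptime]:
  assumes f: "ptime f" and g: "ptime g"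
  shows "ptime (\<lambda>x. f x @ g x)"
proof -
  have "ptime (\<lambda>x. fold (\<lambda>e s. e # s) (rev (f x)) (g x))"
  proof (rule ptime_fold_add[where r = "[:1, 1:]"])
    show "ptime (\<lambda>p. snd (fst p) # snd p)" "ptime (\<lambda>x. rev (f x))"
      by (intro ptime f)+
  qed (auto simp: g)
  then show ?thesis
    by (simp add: fold_Cons_rev[of "\<lambda>x. x", simplified])
qed

lemma ptime_concat [ptime]:
  assumes "ptime f" shows "ptime (\<lambda>x. concat (f x))"
proof -
  have *: "fold (\<lambda>e s. s @ e) xs s = s @ concat xs" for xs and s :: "'b list"
    by (induction xs arbitrary: s) auto
  have "ptime (\<lambda>x. fold (\<lambda>e s. s @ e) (f x) [])"
  proof (rule ptime_fold_add[where r = "[:0, 1:]"])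
    fix x :: 'a and e s :: "'b list"
    show "size_of (s @ e) \<le> size_of s + poly [:0, 1:] (size_of x + size_of e)"
      using size_of_append[of s e] by simp
  qed (intro ptime assms)+
  then show ?thesis
    by (simp add: *)
qed

lemma ptime_filter [ptime]:
  assumes "ptime (\<lambda>p. P (fst p) (snd p))" "ptime l"
  shows "ptime (\<lambda>x. filter (P x) (l x))"
proof -
  have "ptime (\<lambda>x. concat (map (\<lambda>e. if P x e then [e] else []) (l x)))"
    by (intro ptime assms)
  moreover have "concat (map (\<lambda>e. if Q e then [e] else []) xs) = filter Q xs" for Q and xs :: "'b list"
    by (induction xs) auto
  ultimately show ?thesis by simp
qed

lemma size_of_Suc_le: "size_of (Suc n) \<le> size_of n + 2"
  using size_Num_arith(1)[of "int n" 1] by (simp add: add.commute)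

lemma ptime_length [ptime]:
  assumes "ptime f" shows "ptime (\<lambda>x. length (f x))"
proof -
  have *: "fold (\<lambda>e. Suc) xs s = s + length xs" for xs :: "'b list" and s
    by (induction xs arbitrary: s) auto
  have "ptime (\<lambda>x. fold (\<lambda>e s. Suc s) (f x) 0)"
  proof (rule ptime_fold_add[where r = "[:2:]"])
    fix x :: 'a and e :: 'b and s
    show "size_of (Suc s) \<le> size_of s + poly [:2:] (size_of x + size_of e)"
      using size_of_Suc_le[of s] by simp
  qed (intro ptime assms)+
  then show ?thesis
    by (simp add: *)
qed

lemma ptime_nth_default [ptime]:
  assumes "ptime d" "ptime l" "ptime i"
  shows "ptime (\<lambda>x. nth_default (d x) (l x) (i x))"
proof -
  \<comment> \<open>The counter is an integer and continues below 0, so it vanishes only once and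
    later elements cannot overwrite the one that was picked.\<close>
  let ?h = "\<lambda>e s. (fst s - 1, if fst s = (0 :: int) then e else snd s)"
  have *: "snd (fold ?h xs (k, r)) = (if 0 \<le> k \<and> nat k < length xs then xs ! nat k else r)"
    for xs :: "'b list" and k r
  proof (induction xs arbitrary: k r)
    case (Cons a xs)
    show ?case
    proof (cases "k \<le> 0")
      case True
      then show ?thesis using Cons by (auto simp del: fold.simps simp: fold_Cons)
    next
      case False
      then have "nat k = Suc (nat (k - 1))" by simp
      then show ?thesis using Cons False by (auto simp: nat_less_iff)
    qed
  qed simp
  have "ptime (\<lambda>x. snd (fold ?h (l x) (int (i x), d x)))"
  proof (rule ptime_snd, rule ptime_fold_add[where r = "[:2, 1:]"])
    fix x :: 'a and e :: 'b and s :: "int \<times> 'b"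
    show "size_of (?h e s) \<le> size_of s + poly [:2, 1:] (size_of x + size_of e)"
      using size_Num_arith(2)[of "fst s" 1] bit_size_pos[of "enc e"]
      by (cases s) (auto simp del: bit_size.simps(1) simp: bit_size.simps(1)[of 1])
  qed (intro ptime assms)+
  then show ?thesis
    unfolding * nth_default_def by (simp cong: if_cong)
qed

lemma size_of_nat_le: "size_of (n :: nat) \<le> 2 * n + 2"
  by (induction n) (use size_of_Suc_le le_trans in \<open>fastforce+\<close>)

lemma size_of_upt_le: "size_of [0..<n] \<le> (n + 1) * (2 * n + 3)"
proof (induction n)
  case (Suc n)
  have "size_of [0..<Suc n] = size_of [0..<n] + size_of n + 1"
    using size_of_append[of "[0..<n]" "[n]"] by simp
  with Suc size_of_nat_le[of n] show ?case by (simp add: algebra_simps)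
qed simp

text \<open>The upper end is the length of a list and not an arbitrary number: a number is stored in
  binary, and the list up to it could be exponentially long.\<close>

lemma ptime_upt [ptime]:
  assumes "ptime f" shows "ptime (\<lambda>x. [0..<length (f x)])"
proof -
  let ?h = "\<lambda>e s. (case s of [] \<Rightarrow> 0 | a # l \<Rightarrow> Suc a) # s"
  have *: "fold ?h xs (rev [0..<k]) = rev [0..<k + length xs]" for k and xs :: "'b list"
  proof (induction xs arbitrary: k)
    case (Cons a xs)
    have "?h a (rev [0..<k]) = rev [0..<Suc k]" by (cases k) auto
    then show ?case using Cons[of "Suc k"] by simp
  qed simp
  have *: "fold ?h xs [] = rev [0..<length xs]" for xs :: "'b list"
    using *[of xs 0] by simp
  have **: "size_of (rev [0..<n]) = size_of [0..<n]" for n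
  proof -
    have "size_of (rev xs) = size_of xs" for xs :: "nat list"
    proof (induction xs)
      case (Cons a xs)
      then show ?case using size_of_append[of "rev xs" "[a]"] by simp
    qed simp
    then show ?thesis .
  qed
  obtain q where q: "\<And>x. size_of (f x) \<le> poly q (size_of x)"
    using ptime_size[OF assms] by blast
  have "ptime (\<lambda>x. fold ?h (f x) [])"
  proof (rule ptime_fold[where r = "pcompose ([:1, 1:] * [:3, 2:]) q"])
    fix x ys zs
    assume "f x = ys @ zs"
    then have "length ys \<le> poly q (size_of x)"
      using length_le_size[of "f x"] q[of x] by simp
    then have "size_of (fold ?h ys []) \<le> (poly q (size_of x) + 1) * (2 * poly q (size_of x) + 3)"
      unfolding * ** using size_of_upt_le[of "length ys"]
      by (elim order_trans) (intro mult_mono; simp)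
    then show "size_of (fold ?h ys []) \<le> poly (pcompose ([:1, 1:] * [:3, 2:]) q) (size_of x)"
      by (simp add: poly_pcompose algebra_simps)
  qed (intro ptime assms)+
  then show ?thesis
    unfolding * by (auto dest: ptime_rev)
qed

lemma ptime_list_ex:
  assumes "ptime (\<lambda>p. P (fst p) (snd p))" "ptime l"
  shows "ptime (\<lambda>x. \<exists>e\<in>set (l x). P x e)"
proof -
  have "ptime (\<lambda>x. case filter (P x) (l x) of [] \<Rightarrow> False | a # l \<Rightarrow> True)"
    by (intro ptime assms)
  then show ?thesis
    by (rule back_subst[of ptime]) (auto split: list.split simp: filter_empty_conv Cons_eq_filter_iff)
qed

lemma ptime_mem [ptime]:
  assumes "ptime f" "ptime l"
  shows "ptime (\<lambda>x. (f x :: nat) \<in> set (l x))"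
proof -
  have "ptime (\<lambda>x. \<exists>e\<in>set (l x). e = f x)"
    by (intro ptime_list_ex ptime assms ptime_comp[OF _ assms(1)])
  then show ?thesis by simp
qed

section \<open>Minimum cost assignment\<close>

text \<open>
  The Hungarian method: rows are inserted one by one. For a new row \<open>r\<close> an alternating tree is
  grown, one column per step; an entry \<open>(v, u, w)\<close> of the tree means that column \<open>v\<close> was
  reached from row \<open>u\<close>, and that \<open>u\<close> was reached through its matching edge with
  column \<open>w\<close> (\<open>None\<close> for the root \<open>r\<close>). Choosing the edge of least slack and
  shifting the potentials by this slack merges tree growth with the dual update.
\<close>

definition entry :: "int list list \<Rightarrow> nat \<Rightarrow> nat \<Rightarrow> int" where
  "entry c u v = nth_default 0 (nth_default [] c u) v"

text \<open>Each row is paired with the column through which it was entered, which is the third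
  component of any tree entry created from it. The fallback \<open>r\<close> for an unmatched column
  is a filler: all columns of an unfinished tree are matched.\<close>

definition tree_rows :: "nat \<Rightarrow> nat option list \<Rightarrow> (nat \<times> nat \<times> nat option) list \<Rightarrow>
    (nat \<times> nat option) list" where
  "tree_rows r M T = (r, None) #
     map (\<lambda>e. (case nth_default None M (fst e) of None \<Rightarrow> r | Some u \<Rightarrow> u, Some (fst e))) T"

definition best :: "(int \<times> 'a) list \<Rightarrow> (int \<times> 'a) option" where
  "best l = fold (\<lambda>e b. case b of None \<Rightarrow> Some e
     | Some m \<Rightarrow> if fst e < fst m then Some e else Some m) l None"

definition candidates where
  "candidates idx c M r y z T = concat (map (\<lambda>s. map (\<lambda>v.
       (entry c (fst s) v - nth_default 0 y (fst s) - nth_default 0 z v, v, s))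
     (filter (\<lambda>v. v \<notin> set (map fst T)) idx)) (tree_rows r M T))"

text \<open>A fold cannot stop early, so the flag makes all steps after the discovery of a free
  column idle. The shift is applied to the tree before the new column joins it, which makes the new
  edge tight.\<close>

definition grow where
  "grow idx c M r s = (case s of (y, z, T, finished) \<Rightarrow>
     if finished then s else (case best (candidates idx c M r y z T) of None \<Rightarrow> s | Some e \<Rightarrow>
       (map (\<lambda>i. if i \<in> set (map fst (tree_rows r M T)) then nth_default 0 y i + fst e
          else nth_default 0 y i) idx,
        map (\<lambda>j. if j \<in> set (map fst T) then nth_default 0 z j - fst e
          else nth_default 0 z j) idx,
        snd e # T,
        case nth_default None M (fst (snd e)) of None \<Rightarrow> True | Some u \<Rightarrow> False)))"

text \<open>New entries are put in front of the tree, so the parent column of an entry stands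
  further back. Hence one pass over the list follows the augmenting path from the free column down
  to the root.\<close>

definition flip_step :: "nat list \<Rightarrow> nat \<times> nat \<times> nat option \<Rightarrow>
    nat option list \<times> nat option \<Rightarrow> nat option list \<times> nat option" where
  "flip_step idx e s = (case snd s of None \<Rightarrow> s | Some v \<Rightarrow>
     if v = fst e then (map (\<lambda>i. if i = v then Some (fst (snd e)) else nth_default None (fst s) i) idx,
       snd (snd e))
     else s)"

definition flip :: "nat list \<Rightarrow> (nat \<times> nat \<times> nat option) list \<Rightarrow> nat option list \<Rightarrow> nat option list" where
  "flip idx T M = fst (fold (flip_step idx) T (M, case T of [] \<Rightarrow> None | e # _ \<Rightarrow> Some (fst e)))"

definition phase where
  "phase idx c r s = (case s of (M, y, z) \<Rightarrow>
     (case fold (\<lambda>_. grow idx c M r) idx (y, z, [], False) of (y', z', T, finished) \<Rightarrow>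
       (flip idx T M, y', z')))"

definition hungarian where
  "hungarian idx c = fold (phase idx c) idx
     (map (\<lambda>_. None) idx, map (\<lambda>_. 0) idx, map (\<lambda>_. 0) idx)"

lemma best_Cons:
  "\<exists>m. best (b # l) = Some m \<and> m \<in> set (b # l) \<and> (\<forall>e\<in>set (b # l). fst m \<le> fst e)"
proof (induction l arbitrary: b)
  case (Cons a l)
  have "best (b # a # l) = best ((if fst a < fst b then a else b) # l)"
    by (simp add: best_def)
  moreover obtain m where "best ((if fst a < fst b then a else b) # l) = Some m"
    "m \<in> set ((if fst a < fst b then a else b) # l)"
    "\<forall>e\<in>set ((if fst a < fst b then a else b) # l). fst m \<le> fst e"
    using Cons by blast
  ultimately show ?case
    by (intro exI[of _ m]) (auto split: if_splits)
qed (simp add: best_def)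

lemma best_None: "best l = None \<Longrightarrow> l = []"
  using best_Cons[of "hd l" "tl l"] by (cases l) auto

lemma best_Some:
  assumes "best l = Some m"
  shows "m \<in> set l" "\<And>e. e \<in> set l \<Longrightarrow> fst m \<le> fst e"
proof -
  have "l \<noteq> []" using assms by (auto simp: best_def)
  then show "m \<in> set l" "\<And>e. e \<in> set l \<Longrightarrow> fst m \<le> fst e"
    using assms best_Cons[of "hd l" "tl l"] by auto
qed

lemma nth_default_map_upt [simp]:
  "nth_default d (map f [0..<N]) i = (if i < N then f i else d)"
  by (simp add: nth_default_def)

section \<open>Dual feasibility, tight matchings and alternating trees\<close>

definition feasible_potentials where
  "feasible_potentials N c y z \<longleftrightarrow>
     (\<forall>u<N. \<forall>v<N. nth_default 0 y u + nth_default 0 z v \<le> entry c u v)"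

definition tight where
  "tight c y z u v \<longleftrightarrow> nth_default 0 y u + nth_default 0 z v = entry c u v"

text \<open>\<open>f\<close> maps columns to rows and matches exactly the rows below \<open>k\<close>.\<close>

definition tight_matching where
  "tight_matching N c y z k f \<longleftrightarrow>
     (\<forall>v u. f v = Some u \<longrightarrow> v < N \<and> u < k \<and> tight c y z u v) \<and>
     (\<forall>v v' u. f v = Some u \<longrightarrow> f v' = Some u \<longrightarrow> v = v') \<and>
     (\<forall>u<k. \<exists>v. f v = Some u)"

lemma tight_matchingD:
  assumes "tight_matching N c y z k f"
  shows "f v = Some u \<Longrightarrow> v < N \<and> u < k \<and> tight c y z u v"
    and "f v = Some u \<Longrightarrow> f v' = Some u \<Longrightarrow> v = v'"
    and "u < k \<Longrightarrow> \<exists>v. f v = Some u"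
  using assms unfolding tight_matching_def by blast+

fun alternating_tree where
  "alternating_tree r f [] \<longleftrightarrow> True"
| "alternating_tree r f ((v, u, w) # T) \<longleftrightarrow> alternating_tree r f T \<and> v \<notin> set (map fst T) \<and>
     (case w of None \<Rightarrow> u = r | Some w' \<Rightarrow> w' \<in> set (map fst T) \<and> f w' = Some u)"

definition tree_inv where
  "tree_inv N c M r s \<longleftrightarrow> (case s of (y, z, T, finished) \<Rightarrow>
     feasible_potentials N c y z \<and> tight_matching N c y z r (nth_default None M) \<and>
     alternating_tree r (nth_default None M) T \<and>
     (\<forall>(v, u, w)\<in>set T. v < N \<and> tight c y z u v) \<and>
     (if finished then T \<noteq> [] \<and> nth_default None M (fst (hd T)) = None
      else (\<forall>v\<in>set (map fst T). nth_default None M v \<noteq> None)))"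

lemma tree_invI:
  assumes "feasible_potentials N c y z" "tight_matching N c y z r (nth_default None M)"
    and "alternating_tree r (nth_default None M) T"
    and "\<And>v u w. (v, u, w) \<in> set T \<Longrightarrow> v < N \<and> tight c y z u v"
    and "finished \<Longrightarrow> T \<noteq> [] \<and> nth_default None M (fst (hd T)) = None"
    and "\<And>v. \<not> finished \<Longrightarrow> v \<in> set (map fst T) \<Longrightarrow> nth_default None M v \<noteq> None"
  shows "tree_inv N c M r (y, z, T, finished)"
  using assms unfolding tree_inv_def by fastforce

lemma alternating_tree_distinct: "alternating_tree r f T \<Longrightarrow> distinct (map fst T)"
proof (induction T)
  case (Cons e T)
  then show ?case by (cases e) simp
qed simp

lemma alternating_tree_row:
  "alternating_tree r f T \<Longrightarrow> (v, u, w) \<in> set T \<Longrightarrow> u = r \<or> (\<exists>v'\<in>set (map fst T). f v' = Some u)"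
proof (induction T)
  case (Cons e T)
  then show ?case by (cases e; cases "snd (snd e)") auto
qed simp

text \<open>Only pairs of a tree row and a column outside the tree lose slack, and they lose its
  minimum \<open>d\<close>. Tree edges and matching edges inside the tree get \<open>+ d\<close> and
  \<open>- d\<close>. The free column \<open>v0\<close> lies outside the tree, whose columns are all
  matched, so a candidate edge exists.\<close>

lemma grow_inv:
  assumes inv: "tree_inv N c M r (y, z, T, False)" and r: "r < N"
    and free: "v0 < N" "nth_default None M v0 = None"
  obtains y' z' e finished where "grow [0..<N] c M r (y, z, T, False) = (y', z', e # T, finished)"
    "tree_inv N c M r (y', z', e # T, finished)"
proof -
  define f where "f = nth_default None M"
  define C where "C = candidates [0..<N] c M r y z T"
  define S where "S = set (map fst (tree_rows r M T))"
  define cols where "cols = set (map fst T)"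
  define Y where "Y = nth_default 0 y"
  define Z where "Z = nth_default 0 z"
  have feas: "Y u + Z v \<le> entry c u v" if "u < N" "v < N" for u v
    using inv that by (simp add: tree_inv_def feasible_potentials_def Y_def Z_def)
  have match: "v < N" "u < r" "Y u + Z v = entry c u v" if "f v = Some u" for u v
    using inv that by (auto simp: tree_inv_def tight_matching_def tight_def f_def Y_def Z_def)
  have inj: "v = v'" if "f v = Some u" "f v' = Some u" for u v v'
    using inv that by (auto simp: tree_inv_def tight_matching_def f_def)
  have sur: "\<exists>v. f v = Some u" if "u < r" for u
    using inv that by (auto simp: tree_inv_def tight_matching_def f_def)
  have tree: "alternating_tree r f T"
    using inv by (simp add: tree_inv_def f_def)
  have T: "v < N" "Y u + Z v = entry c u v" if "(v, u, w) \<in> set T" for u v w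
    using inv that by (auto simp: tree_inv_def tight_def Y_def Z_def)
  have matched: "f v \<noteq> None" if "v \<in> cols" for v
    using inv that by (auto simp: tree_inv_def f_def cols_def)
  have rows: "(snd p = None \<and> fst p = r) \<or> (\<exists>w\<in>cols. snd p = Some w \<and> f w = Some (fst p))"
    if "p \<in> set (tree_rows r M T)" for p
  proof -
    from that consider "p = (r, None)"
      | e where "e \<in> set T" "p = (case f (fst e) of None \<Rightarrow> r | Some u \<Rightarrow> u, Some (fst e))"
      unfolding tree_rows_def f_def by auto
    then show ?thesis
    proof cases
      case 2
      then have "fst e \<in> cols" by (simp add: cols_def)
      with matched[OF this] 2 show ?thesis by auto
    qed simp
  qed
  have rows_in: "(u, Some w) \<in> set (tree_rows r M T)" if "w \<in> cols" "f w = Some u" for u w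
    using that unfolding tree_rows_def f_def cols_def by force
  have S: "u \<in> S \<longleftrightarrow> u = r \<or> (\<exists>v\<in>cols. f v = Some u)" for u
  proof
    assume "u \<in> S"
    then obtain p where "p \<in> set (tree_rows r M T)" "u = fst p" by (auto simp: S_def)
    with rows[of p] show "u = r \<or> (\<exists>v\<in>cols. f v = Some u)" by auto
  next
    assume "u = r \<or> (\<exists>v\<in>cols. f v = Some u)"
    then show "u \<in> S"
      using rows_in by (force simp: S_def tree_rows_def)
  qed
  have S_lt: "u < N" if "u \<in> S" for u
    using that match(2) r unfolding S by fastforce
  have C: "x \<in> set C \<longleftrightarrow> (\<exists>s v. x = (entry c (fst s) v - Y (fst s) - Z v, v, s) \<and>
      s \<in> set (tree_rows r M T) \<and> v < N \<and> v \<notin> cols)" for x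
  proof -
    have "set C = (\<Union>s\<in>set (tree_rows r M T).
        (\<lambda>v. (entry c (fst s) v - Y (fst s) - Z v, v, s)) ` {v \<in> set [0..<N]. v \<notin> cols})"
      unfolding C_def candidates_def Y_def Z_def cols_def
      by (simp only: set_concat set_map set_filter image_image)
    then show ?thesis by (simp only: set_upt atLeastLessThan_iff) blast
  qed
  have "v0 \<notin> cols" using matched[of v0] free(2) unfolding f_def by blast
  moreover have "(r, None) \<in> set (tree_rows r M T)" by (simp add: tree_rows_def)
  ultimately have "C \<noteq> []"
    using C free(1) by fastforce
  then obtain m where m: "best C = Some m"
    using best_None by (cases "best C") auto
  obtain d v u w where mm: "m = (d, v, u, w)" by (metis prod_cases4)
  from best_Some(1)[OF m] have uw: "(u, w) \<in> set (tree_rows r M T)" and v: "v < N" "v \<notin> cols"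
    and d: "d = entry c u v - Y u - Z v"
    unfolding C mm by auto
  have u: "u \<in> S" using uw by (force simp: S_def)
  have d_le: "d \<le> entry c u' v' - Y u' - Z v'"
    if "u' \<in> S" "v' < N" "v' \<notin> cols" for u' v'
  proof -
    from that(1) obtain s where "s \<in> set (tree_rows r M T)" "fst s = u'" by (auto simp: S_def)
    with that have "(entry c u' v' - Y u' - Z v', v', s) \<in> set C"
      unfolding C by blast
    from best_Some(2)[OF m this] show ?thesis by (simp add: mm)
  qed
  have d0: "0 \<le> d" using feas[OF S_lt[OF u] v(1)] d by simp
  define y' where "y' = map (\<lambda>i. if i \<in> S then Y i + d else Y i) [0..<N]"
  define z' where "z' = map (\<lambda>i. if i \<in> cols then Z i - d else Z i) [0..<N]"
  have y': "nth_default 0 y' i = (if i \<in> S then Y i + d else Y i)" if "i < N" for i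
    using that by (simp add: y'_def)
  have z': "nth_default 0 z' i = (if i \<in> cols then Z i - d else Z i)" if "i < N" for i
    using that by (simp add: z'_def)
  have eq: "grow [0..<N] c M r (y, z, T, False) = (y', z', (v, u, w) # T, f v = None)"
    using m unfolding grow_def mm C_def f_def y'_def z'_def S_def cols_def Y_def Z_def
    by (simp split: option.split)
  have "nth_default 0 y' u' + nth_default 0 z' v' \<le> entry c u' v'" if "u' < N" "v' < N" for u' v'
    using feas[OF that] d_le[of u' v'] d0 that
    by (cases "u' \<in> S"; cases "v' \<in> cols") (simp_all add: y' z')
  then have feas': "feasible_potentials N c y' z'"
    unfolding feasible_potentials_def by blast
  have match': "tight_matching N c y' z' r f"
  proof -
    have "tight c y' z' u' v'" if "f v' = Some u'" for u' v'
    proof -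
      have "u' < N" "v' < N" using match(1,2)[OF that] r by simp_all
      \<comment> \<open>The root \<open>r\<close> is unmatched since \<open>u' < r\<close>. Every
        other tree row was entered through its matching edge, so a matching edge has both ends in
        the tree or none.\<close>
      moreover have "u' \<in> S \<longleftrightarrow> v' \<in> cols"
        using that match(2)[OF that] inj unfolding S by blast
      ultimately show ?thesis using match(3)[OF that] by (simp add: tight_def y' z')
    qed
    with match(1,2) inj sur show ?thesis unfolding tight_matching_def by blast
  qed
  have tree': "alternating_tree r f ((v, u, w) # T)"
    using tree v rows[OF uw] unfolding alternating_tree.simps cols_def[symmetric]
    by (auto split: option.split)
  have T': "v' < N \<and> tight c y' z' u' v'" if "(v', u', w') \<in> set ((v, u, w) # T)" for v' u' w'
  proof (cases "(v', u', w') = (v, u, w)")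
    case True
    then show ?thesis using u v S_lt[OF u] d by (simp add: tight_def y' z')
  next
    case False
    then have e: "(v', u', w') \<in> set T" using that unfolding list.set insert_iff by blast
    have "u' \<in> S" using alternating_tree_row[OF tree e] unfolding S cols_def .
    moreover have "v' \<in> cols" using e by (force simp: cols_def)
    ultimately show ?thesis using T[OF e] S_lt[of u'] by (simp add: tight_def y' z')
  qed
  have "tree_inv N c M r (y', z', (v, u, w) # T, f v = None)"
  proof (rule tree_invI, unfold f_def[symmetric])
    show "f v' \<noteq> None" if "\<not> f v = None" "v' \<in> set (map fst ((v, u, w) # T))" for v'
      using that matched[of v'] by (auto simp: cols_def)
    show "feasible_potentials N c y' z'" by (rule feas')
    show "tight_matching N c y' z' r f" by (rule match')
    show "alternating_tree r f ((v, u, w) # T)" by (rule tree')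
    show "v' < N \<and> tight c y' z' u' v'" if "(v', u', w') \<in> set ((v, u, w) # T)" for v' u' w'
      using that by (rule T')
  qed simp
  then show ?thesis by (rule that[OF eq])
qed

lemma free_column:
  assumes "tight_matching N c y z k f" "k < N"
  obtains v where "v < N" "f v = None"
proof (rule ccontr)
  assume "\<not> thesis"
  then have "\<forall>v<N. \<exists>u. f v = Some u" using that by (metis option.exhaust)
  then obtain g where g: "\<And>v. v < N \<Longrightarrow> f v = Some (g v)" by metis
  have "inj_on g {..<N}"
    by (intro inj_onI) (metis g lessThan_iff tight_matchingD(2)[OF assms(1)])
  moreover have "g ` {..<N} \<subseteq> {..<k}"
    using g tight_matchingD(1)[OF assms(1)] by blast
  ultimately have "card {..<N} \<le> card {..<k}" by (intro card_inj_on_le) auto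
  with assms(2) show False by simp
qed

text \<open>As long as the flag is not set, each step adds a new column different from the free
  column \<open>v0\<close>. Only \<open>N - 1\<close> such columns exist, so \<open>N\<close> steps
  must set the flag.\<close>

lemma grow_all:
  assumes "tree_inv N c M r (y, z, [], False)" and r: "r < N"
  obtains y' z' T where "fold (\<lambda>_. grow [0..<N] c M r) [0..<N] (y, z, [], False) = (y', z', T, True)"
    "tree_inv N c M r (y', z', T, True)"
proof -
  let ?g = "\<lambda>_. grow [0..<N] c M r"
  have "tight_matching N c y z r (nth_default None M)"
    using assms(1) by (simp add: tree_inv_def)
  then obtain v0 where v0: "v0 < N" "nth_default None M v0 = None"
    using free_column r by blast
  have *: "tree_inv N c M r (fold ?g xs s) \<and>
      (snd (snd (snd (fold ?g xs s))) \<or> length (fst (snd (snd (fold ?g xs s)))) = length xs)"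
    if "s = (y, z, [], False)" for s and xs :: "nat list"
  proof (induction xs rule: rev_induct)
    case Nil
    then show ?case using assms(1) that by simp
  next
    case (snoc x xs)
    obtain y1 z1 T1 fin where s1: "fold ?g xs s = (y1, z1, T1, fin)" by (metis prod_cases4)
    show ?case
    proof (cases fin)
      case True
      have "fold ?g (xs @ [x]) s = (y1, z1, T1, True)"
        using s1 True by (simp add: grow_def[of _ _ _ _ "(y1, z1, T1, True)"])
      then show ?thesis using snoc s1 True by simp
    next
      case False
      then have "tree_inv N c M r (y1, z1, T1, False)" using snoc s1 by simp
      from grow_inv[OF this r v0] obtain y' z' e finished where
        "grow [0..<N] c M r (y1, z1, T1, False) = (y', z', e # T1, finished)"
        "tree_inv N c M r (y', z', e # T1, finished)" by blast
      then show ?thesis using snoc s1 False by simp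
    qed
  qed
  obtain y1 z1 T1 fin where s1: "fold ?g [0..<N] (y, z, [], False) = (y1, z1, T1, fin)"
    by (metis prod_cases4)
  have inv: "tree_inv N c M r (y1, z1, T1, fin)" and len: "fin \<or> length T1 = N"
    using *[OF refl, of "[0..<N]"] s1 by auto
  have fin
  proof (rule ccontr)
    assume "\<not> fin"
    then have "length T1 = N" "alternating_tree r (nth_default None M) T1"
      "set (map fst T1) \<subseteq> {..<N} - {v0}"
      using inv len v0 by (auto simp: tree_inv_def)
    then have "N \<le> card ({..<N} - {v0})"
      using alternating_tree_distinct[THEN distinct_card, of r "nth_default None M" T1]
        card_mono[of "{..<N} - {v0}" "set (map fst T1)"] by simp
    then show False using v0 by simp
  qed
  with s1 inv that show ?thesis by simp
qed

text \<open>
  While the alternating path is being flipped, the column \<open>cur\<close> is about to be rematched and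
  is regarded as free.
\<close>

definition hole :: "nat option list \<Rightarrow> nat option \<Rightarrow> nat \<Rightarrow> nat option" where
  "hole M cur = (case cur of None \<Rightarrow> nth_default None M | Some v \<Rightarrow> (nth_default None M)(v := None))"

lemma tight_matching_insert:
  assumes "tight_matching N c y z r (f(v := None))" "v < N" "tight c y z r v"
  shows "tight_matching N c y z (Suc r) (f(v := Some r))"
  unfolding tight_matching_def
proof (intro conjI allI impI)
  have *: "w < N \<and> u < r \<and> tight c y z u w" if "f w = Some u" "w \<noteq> v" for u w
    using tight_matchingD(1)[OF assms(1), of w u] that by simp
  have inj: "x = x'" if "f x = Some u" "f x' = Some u" "x \<noteq> v" "x' \<noteq> v" for x x' u
    using tight_matchingD(2)[OF assms(1), of x u x'] that by simp
  show "w < N" "u < Suc r" "tight c y z u w" if "(f(v := Some r)) w = Some u" for w u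
    using that assms(2,3) *[of w u] by (auto split: if_splits)
  show "w = w'" if "(f(v := Some r)) w = Some u" "(f(v := Some r)) w' = Some u" for w w' u
    using that inj[of w u w'] *[of w u] *[of w' u] by (auto split: if_splits)
  show "\<exists>w. (f(v := Some r)) w = Some u" if "u < Suc r" for u
  proof (cases "u = r")
    case False
    then have "\<exists>w. (f(v := None)) w = Some u"
      using that tight_matchingD(3)[OF assms(1), of u] by simp
    then show ?thesis by (metis fun_upd_apply option.distinct(1))
  qed (metis fun_upd_same)
qed

text \<open>Row \<open>u\<close> gives up column \<open>w\<close> for \<open>v\<close>, which moves
  the hole from \<open>v\<close> to \<open>w\<close>, one step closer to the root.\<close>

lemma tight_matching_move:
  assumes "tight_matching N c y z r (f(v := None))" "f w = Some u" "w \<noteq> v" "v < N" "tight c y z u v"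
  shows "tight_matching N c y z r (f(v := Some u, w := None))"
  unfolding tight_matching_def
proof (intro conjI allI impI)
  have *: "x < N \<and> u' < r \<and> tight c y z u' x" if "f x = Some u'" "x \<noteq> v" for u' x
    using tight_matchingD(1)[OF assms(1), of x u'] that by simp
  have inj: "x = x'" if "f x = Some u'" "f x' = Some u'" "x \<noteq> v" "x' \<noteq> v" for x x' u'
    using tight_matchingD(2)[OF assms(1), of x u' x'] that by simp
  show "x < N" "u' < r" "tight c y z u' x" if "(f(v := Some u, w := None)) x = Some u'" for x u'
    using that assms *[of x u'] *[of w u] by (auto split: if_splits)
  show "x = x'" if "(f(v := Some u, w := None)) x = Some u'" "(f(v := Some u, w := None)) x' = Some u'"
    for x x' u'
    using that inj[of x u' x'] inj[of w u' x] inj[of w u' x'] assms(2,3) by (auto split: if_splits)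
  show "\<exists>x. (f(v := Some u, w := None)) x = Some u'" if u': "u' < r" for u'
  proof (cases "u' = u")
    case False
    obtain x where "(f(v := None)) x = Some u'"
      using u' tight_matchingD(3)[OF assms(1), of u'] by blast
    then show ?thesis using False assms(2) by (intro exI[of _ x]) (auto split: if_splits)
  qed (use assms(3) in \<open>auto intro: exI[of _ v]\<close>)
qed

text \<open>Invariant of the pass over the tree: up to the hole \<open>cur\<close>,
  \<open>M'\<close> matches the rows below \<open>r\<close>; once the root has been reached, it also
  matches \<open>r\<close>. Only columns already passed have been changed, so the matching edges
  used by the remaining entries are still present.\<close>

lemma flip_fold:
  assumes "alternating_tree r (nth_default None M) T"
    and "\<forall>(v, u, w)\<in>set T. v < N \<and> tight c y z u v"
    and "\<And>v. v \<in> set (map fst T) \<Longrightarrow> nth_default None M' v = nth_default None M v \<or> cur = Some v"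
    and "case cur of None \<Rightarrow> tight_matching N c y z (Suc r) (hole M' cur)
      | Some v \<Rightarrow> v \<in> set (map fst T) \<and> tight_matching N c y z r (hole M' cur)"
  shows "tight_matching N c y z (Suc r) (nth_default None (fst (fold (flip_step [0..<N]) T (M', cur))))"
  using assms
proof (induction T arbitrary: M' cur)
  case Nil
  then show ?case by (cases cur) (auto simp: hole_def)
next
  case (Cons e T)
  obtain v u w where e: "e = (v, u, w)" by (metis prod_cases3)
  have at: "alternating_tree r (nth_default None M) T" "v \<notin> set (map fst T)"
    and w: "case w of None \<Rightarrow> u = r | Some w' \<Rightarrow> w' \<in> set (map fst T) \<and> nth_default None M w' = Some u"
    using Cons.prems(1) by (auto simp: e)
  have v: "v < N" "tight c y z u v" using Cons.prems(2) by (auto simp: e)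
  show ?case
  proof (cases "cur = Some v")
    case False
    then have "flip_step [0..<N] e (M', cur) = (M', cur)"
      by (auto simp: flip_step_def e split: option.split)
    moreover have "tight_matching N c y z (Suc r) (nth_default None (fst (fold (flip_step [0..<N]) T (M', cur))))"
      by (rule Cons.IH[OF at(1)]) (use Cons.prems False in \<open>auto simp: e split: option.splits\<close>)
    ultimately show ?thesis by simp
  next
    case True
    let ?M = "map (\<lambda>i. if i = v then Some u else nth_default None M' i) [0..<N]"
    have step: "flip_step [0..<N] e (M', cur) = (?M, w)"
      by (simp add: flip_step_def e True)
    have tm: "tight_matching N c y z r ((nth_default None M')(v := None))"
      using Cons.prems(4) True by (simp add: hole_def)
    have M: "nth_default None ?M = (nth_default None M')(v := Some u)"
    proof
      fix i
      show "nth_default None ?M i = ((nth_default None M')(v := Some u)) i"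
      proof (cases "i < N \<or> i = v")
        case True
        then show ?thesis using v by auto
      next
        case False
        \<comment> \<open>The new list has length \<open>N\<close> whatever the length of
          \<open>M'\<close>. Nothing is lost, because matched columns are below
          \<open>N\<close>.\<close>
        then have "nth_default None M' i = None"
          using tm unfolding tight_matching_def by (metis fun_upd_other not_Some_eq)
        then show ?thesis using False by simp
      qed
    qed
    have "tight_matching N c y z (Suc r) (nth_default None (fst (fold (flip_step [0..<N]) T (?M, w))))"
    proof (rule Cons.IH[OF at(1)])
      show "\<forall>(v, u, w)\<in>set T. v < N \<and> tight c y z u v" using Cons.prems(2) by simp
      show "nth_default None ?M v' = nth_default None M v' \<or> w = Some v'" if "v' \<in> set (map fst T)" for v'
        using Cons.prems(3)[of v'] that at(2) True unfolding M by auto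
      show "case w of None \<Rightarrow> tight_matching N c y z (Suc r) (hole ?M w)
          | Some v \<Rightarrow> v \<in> set (map fst T) \<and> tight_matching N c y z r (hole ?M w)"
      proof (cases w)
        case None
        then have "u = r" using w by simp
        have "tight_matching N c y z (Suc r) ((nth_default None M')(v := Some u))"
          using tight_matching_insert[OF tm] v \<open>u = r\<close> by simp
        then show ?thesis using None by (simp add: hole_def M del: upt_Suc)
      next
        case (Some w')
        then have w': "w' \<in> set (map fst T)" "nth_default None M w' = Some u" using w by auto
        then have "nth_default None M' w' = Some u" "w' \<noteq> v"
          using Cons.prems(3)[of w'] at(2) True by auto
        then have "tight_matching N c y z r ((nth_default None M')(v := Some u, w' := None))"
          using tight_matching_move[OF tm] v by simp
        then show ?thesis using Some w' by (simp add: hole_def M del: upt_Suc)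
      qed
    qed
    then show ?thesis by (simp add: step)
  qed
qed

lemma phase_inv:
  assumes "feasible_potentials N c y z" "tight_matching N c y z r (nth_default None M)" "r < N"
  obtains M' y' z' where "phase [0..<N] c r (M, y, z) = (M', y', z')"
    "feasible_potentials N c y' z'" "tight_matching N c y' z' (Suc r) (nth_default None M')"
proof -
  have "tree_inv N c M r (y, z, [], False)"
    using assms by (simp add: tree_inv_def)
  from grow_all[OF this assms(3)] obtain y' z' T where
    T: "fold (\<lambda>_. grow [0..<N] c M r) [0..<N] (y, z, [], False) = (y', z', T, True)"
    and inv: "tree_inv N c M r (y', z', T, True)" by blast
  from inv obtain e T' where e: "T = e # T'" "nth_default None M (fst e) = None"
    by (auto simp: tree_inv_def neq_Nil_conv)
  have "tight_matching N c y' z' (Suc r) (nth_default None (flip [0..<N] T M))"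
    unfolding flip_def
  proof (rule flip_fold)
    have "hole M (Some (fst e)) = nth_default None M"
      using e(2) by (auto simp: hole_def)
    then show "case case T of [] \<Rightarrow> None | e # _ \<Rightarrow> Some (fst e) of
        None \<Rightarrow> tight_matching N c y' z' (Suc r) (hole M (case T of [] \<Rightarrow> None | e # _ \<Rightarrow> Some (fst e)))
      | Some v \<Rightarrow> v \<in> set (map fst T) \<and>
          tight_matching N c y' z' r (hole M (case T of [] \<Rightarrow> None | e # _ \<Rightarrow> Some (fst e)))"
      using inv e by (simp add: tree_inv_def)
  qed (use inv in \<open>auto simp: tree_inv_def\<close>)
  moreover have "phase [0..<N] c r (M, y, z) = (flip [0..<N] T M, y', z')"
    by (simp add: phase_def T)
  ultimately show ?thesis
    using that inv by (auto simp: tree_inv_def)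
qed

theorem hungarian_correct:
  assumes "\<And>u v. u < N \<Longrightarrow> v < N \<Longrightarrow> 0 \<le> entry c u v"
  obtains M y z where "hungarian [0..<N] c = (M, y, z)"
    "feasible_potentials N c y z" "tight_matching N c y z N (nth_default None M)"
proof -
  let ?s = "(map (\<lambda>_. None) [0..<N], map (\<lambda>_. 0) [0..<N], map (\<lambda>_. 0) [0..<N])"
  have "\<exists>M y z. fold (phase [0..<N] c) [0..<k] ?s = (M, y, z) \<and>
      feasible_potentials N c y z \<and> tight_matching N c y z k (nth_default None M)" if "k \<le> N" for k
    using that
  proof (induction k)
    case 0
    \<comment> \<open>Nonnegative costs make the zero potentials feasible, and the empty matching
      covers no rows.\<close>
    then show ?case using assms
      by (auto simp: feasible_potentials_def tight_matching_def)
  next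
    case (Suc k)
    then obtain M y z where s: "fold (phase [0..<N] c) [0..<k] ?s = (M, y, z)"
      and "feasible_potentials N c y z" "tight_matching N c y z k (nth_default None M)" by auto
    with phase_inv[of N c y z k M] Suc.prems obtain M' y' z' where
      "phase [0..<N] c k (M, y, z) = (M', y', z')"
      "feasible_potentials N c y' z'" "tight_matching N c y' z' (Suc k) (nth_default None M')"
      by auto
    then show ?case using s by simp
  qed
  from this[of N] show ?thesis using that by (auto simp: hungarian_def)
qed

subsection \<open>Running time of the assignment algorithm\<close>

text \<open>Composing polynomial size bounds over many steps would explode. Instead magnitude and
  shape are tracked separately: multiplying the largest atom by a constant costs a constant number
  of bits per step, and the number of nodes depends only on list lengths.\<close>

fun leaf_max :: "val \<Rightarrow> nat" where
  "leaf_max (Num z) = nat \<bar>z\<bar>"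
| "leaf_max (Pair a b) = max (leaf_max a) (leaf_max b)"

fun nodes :: "val \<Rightarrow> nat" where
  "nodes (Num z) = 1"
| "nodes (Pair a b) = Suc (nodes a + nodes b)"

lemma bit_size_le_nodes:
  assumes "leaf_max v < 2 ^ k"
  shows "bit_size v \<le> nodes v * (k + 1)"
  using assms
proof (induction v)
  case (Num z)
  then show ?case using size_of_Num_le[of z k] by simp
next
  case (Pair a b)
  then show ?case by (simp add: algebra_simps)
qed

lemma leaf_max_less: "leaf_max v < 2 ^ bit_size v"
proof (induction v)
  case (Num z)
  have "nat \<bar>z\<bar> < 2 ^ nat (bitlen \<bar>z\<bar>)" by (rule abs_lt_bitlen)
  also have "\<dots> \<le> 2 ^ bit_size (Num z)" by (rule power_increasing) auto
  finally show ?case by simp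
next
  case (Pair a b)
  have "(2::nat) ^ bit_size a \<le> 2 ^ bit_size (Pair a b)" "(2::nat) ^ bit_size b \<le> 2 ^ bit_size (Pair a b)"
    by (rule power_increasing; simp)+
  then show ?case using Pair by simp
qed

abbreviation leaves_le :: "nat \<Rightarrow> 'a :: enc \<Rightarrow> bool" where
  "leaves_le B x \<equiv> leaf_max (enc x) \<le> B"

lemma leaves_le_list [simp]: "leaves_le B (xs :: 'a :: enc list) \<longleftrightarrow> (\<forall>x\<in>set xs. leaves_le B x)"
  by (induction xs) auto

lemma leaves_le_nth_default:
  "leaves_le B d \<Longrightarrow> leaves_le B xs \<Longrightarrow> leaves_le B (nth_default d xs i)"
  by (auto simp: nth_default_def)

lemma leaves_le_root:
  "leaves_le B T \<Longrightarrow> leaves_le B (case T of [] \<Rightarrow> None | e # _ \<Rightarrow> Some (fst e))"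
  by (cases T) (auto simp: enc_prod_def)

lemma leaves_le_entry: "leaves_le B c \<Longrightarrow> leaves_le B (entry c u v)"
  unfolding entry_def by (rule leaves_le_nth_default[OF _ leaves_le_nth_default]) simp_all

lemma tree_rows_bound:
  assumes "leaves_le D r" "leaves_le D M" "leaves_le D T" "p \<in> set (tree_rows r M T)"
  shows "leaves_le D p"
proof -
  from assms(4) consider "p = (r, None)"
    | e where "e \<in> set T" "p = (case nth_default None M (fst e) of None \<Rightarrow> r | Some u \<Rightarrow> u, Some (fst e))"
    unfolding tree_rows_def by auto
  then show ?thesis
  proof cases
    case 1
    then show ?thesis using assms(1) by simp
  next
    case 2
    have "leaves_le D e" using 2 assms(3) by simp
    moreover have "leaves_le D (nth_default None M (fst e))"
      by (rule leaves_le_nth_default) (use assms(2) in simp_all)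
    ultimately show ?thesis
      using 2 assms(1) by (cases e) (auto split: option.split)
  qed
qed

lemma candidates_bound:
  assumes D: "leaves_le D idx" "leaves_le D c" "leaves_le D M" "leaves_le D r"
    "leaves_le D y" "leaves_le D z" "leaves_le D T"
    and e: "e \<in> set (candidates idx c M r y z T)"
  shows "leaves_le (3 * D) (fst e) \<and> leaves_le D (snd e)"
proof -
  from e obtain s v where s: "s \<in> set (tree_rows r M T)" and v: "v \<in> set idx"
    and e: "e = (entry c (fst s) v - nth_default 0 y (fst s) - nth_default 0 z v, v, s)"
    unfolding candidates_def by auto
  have "leaves_le D s" by (rule tree_rows_bound[OF D(4,3,7) s])
  moreover have "leaves_le D v" using v D(1) by simp
  moreover have "leaves_le D (entry c (fst s) v)" by (rule leaves_le_entry[OF D(2)])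
  moreover have "leaves_le D (nth_default 0 y (fst s))" "leaves_le D (nth_default 0 z v)"
    using D(5,6) by (intro leaves_le_nth_default; simp)+
  ultimately show ?thesis by (simp add: e del: leaves_le_list)
qed

text \<open>A slack is formed from three numbers of absolute value at most \<open>D\<close>, and
  shifting a potential by it gives at most \<open>D + 3 * D\<close>. The hypothesis
  \<open>1 \<le> D\<close> makes room for the flag, which is encoded as 0 or 1.\<close>

lemma grow_bound:
  assumes D: "1 \<le> D" "leaves_le D idx" "leaves_le D c" "leaves_le D M" "leaves_le D r" "leaves_le D s"
  shows "leaves_le (4 * D) (grow idx c M r s)"
proof -
  obtain y z T fin where s: "s = (y, z, T, fin)" by (metis prod_cases4)
  have Ds: "leaves_le D y" "leaves_le D z" "leaves_le D T"
    using D(6) unfolding s by (auto simp del: leaves_le_list)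
  have s4: "leaves_le (4 * D) s" using D(6) by simp
  show ?thesis
  proof (cases "fin \<or> best (candidates idx c M r y z T) = None")
    case True
    then show ?thesis using s4 by (auto simp: grow_def s)
  next
    case False
    then obtain e where e: "best (candidates idx c M r y z T) = Some e" and fin: "\<not> fin" by auto
    have b: "leaves_le (3 * D) (fst e)" "leaves_le D (snd e)"
      using candidates_bound[OF D(2-5) Ds best_Some(1)[OF e]] by auto
    have nd: "nat \<bar>nth_default 0 y i\<bar> \<le> D" "nat \<bar>nth_default 0 z i\<bar> \<le> D" for i
      using leaves_le_nth_default[OF _ Ds(1), of 0 i] leaves_le_nth_default[OF _ Ds(2), of 0 i]
      by (simp_all del: leaves_le_list)
    have shift: "nat \<bar>nth_default 0 y i + fst e\<bar> \<le> 4 * D" "nat \<bar>nth_default 0 z i - fst e\<bar> \<le> 4 * D"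
       "nat \<bar>nth_default 0 y i\<bar> \<le> 4 * D" "nat \<bar>nth_default 0 z i\<bar> \<le> 4 * D" for i
      using b(1) nd[of i] by simp_all
    have "leaves_le (4 * D) (snd e # T)"
      using b(2) Ds(3) by fastforce
    then show ?thesis
      using shift D(1) fin e by (auto simp: grow_def s split: option.split)
  qed
qed

lemma grow_shape:
  assumes "grow idx c M r (y, z, T, fin) = (y', z', T', fin')"
  shows "length y' \<le> max (length y) (length idx)" "length z' \<le> max (length z) (length idx)"
    "length T' \<le> Suc (length T)"
  using assms by (auto simp: grow_def split: if_splits option.splits)

lemma fold_grow_bound:
  fixes xs :: "nat list"
  assumes D: "1 \<le> D" "leaves_le D idx" "leaves_le D c" "leaves_le D M" "leaves_le D r"
    "leaves_le D y" "leaves_le D z" and L: "length idx \<le> L" "length y \<le> L" "length z \<le> L"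
    and s: "fold (\<lambda>_. grow idx c M r) xs (y, z, [], False) = (y', z', T', fin')"
  shows "leaves_le (4 ^ length xs * D) (y', z', T', fin')"
    "length y' \<le> L" "length z' \<le> L" "length T' \<le> length xs"
  using s
proof (induction xs arbitrary: y' z' T' fin' rule: rev_induct)
  case Nil
  {
    case 1
    then show ?case using D by auto
  next
    case 2
    then show ?case using L by simp
  next
    case 3
    then show ?case using L by simp
  next
    case 4
    then show ?case by simp
  }
next
  case (snoc x xs)
  obtain y1 z1 T1 f1 where s1: "fold (\<lambda>_. grow idx c M r) xs (y, z, [], False) = (y1, z1, T1, f1)"
    by (metis prod_cases4)
  note IH = snoc[OF s1]
  have g: "grow idx c M r (y1, z1, T1, f1) = (y', z', T', fin')"
    if "fold (\<lambda>_. grow idx c M r) (xs @ [x]) (y, z, [], False) = (y', z', T', fin')" for y' z' T' fin'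
    using that s1 by simp
  have D1: "D \<le> 4 ^ length xs * D" by simp
  note D' = order_trans[OF _ D1]
  have *: "leaves_le (4 * (4 ^ length xs * D)) (grow idx c M r (y1, z1, T1, f1))"
    by (rule grow_bound[OF D'[OF D(1)] D'[OF D(2)] D'[OF D(3)] D'[OF D(4)] D'[OF D(5)] IH(1)])
  {
    case 1
    show ?case using * unfolding g[OF 1] by (simp add: mult.assoc del: leaves_le_list)
  next
    case 2
    show ?case using grow_shape(1)[OF g[OF 2]] IH(2) L(1) by simp
  next
    case 3
    show ?case using grow_shape(2)[OF g[OF 3]] IH(3) L(1) by simp
  next
    case 4
    show ?case using grow_shape(3)[OF g[OF 4]] IH(4) by simp
  }
qed

text \<open>Flipping only copies indices that are already present, so unlike growing it does not
  increase the bound \<open>D\<close>.\<close>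

lemma flip_step_bound:
  assumes "leaves_le D idx" "leaves_le D e" "leaves_le D M" "leaves_le D cur" "length M \<le> L" "length idx \<le> L"
    and "flip_step idx e (M, cur) = (M', cur')"
  shows "leaves_le D M'" "leaves_le D cur'" "length M' \<le> L"
proof -
  obtain v u w where e: "e = (v, u, w)" by (metis prod_cases3)
  have nd: "leaves_le D (nth_default None M i)" for i
    by (rule leaves_le_nth_default[OF _ assms(3)]) simp
  have "leaves_le D M' \<and> leaves_le D cur' \<and> length M' \<le> L"
    using assms nd unfolding flip_step_def e by (auto split: option.splits if_splits)
  then show "leaves_le D M'" "leaves_le D cur'" "length M' \<le> L" by auto
qed

lemma fold_flip_bound:
  assumes "leaves_le D idx" "length idx \<le> L"
    and "leaves_le D T" "leaves_le D M" "leaves_le D cur" "length M \<le> L"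
  shows "leaves_le D (fold (flip_step idx) T (M, cur)) \<and> length (fst (fold (flip_step idx) T (M, cur))) \<le> L"
  using assms(3-)
proof (induction T arbitrary: M cur)
  case (Cons e T)
  obtain M' cur' where s: "flip_step idx e (M, cur) = (M', cur')" by fastforce
  have e: "leaves_le D e" and T: "leaves_le D T" using Cons.prems(1) by simp_all
  note b = flip_step_bound[OF assms(1) e Cons.prems(2,3,4) assms(2) s]
  show ?case using Cons.IH[OF T b] by (simp add: s)
qed (auto simp del: leaves_le_list)

lemma phase_bound:
  assumes D: "1 \<le> D" "leaves_le D idx" "leaves_le D c" "leaves_le D M" "leaves_le D r"
    "leaves_le D y" "leaves_le D z"
    and L: "length idx \<le> L" "length M \<le> L" "length y \<le> L" "length z \<le> L"
    and s: "phase idx c r (M, y, z) = (M', y', z')"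
  shows "leaves_le (4 ^ length idx * D) (M', y', z')" "length M' \<le> L" "length y' \<le> L" "length z' \<le> L"
proof -
  obtain T fin where f: "fold (\<lambda>_. grow idx c M r) idx (y, z, [], False) = (y', z', T, fin)"
    and M': "M' = flip idx T M"
    using s by (auto simp: phase_def split: prod.splits)
  note b = fold_grow_bound[OF D L(1,3,4) f]
  show "length y' \<le> L" "length z' \<le> L" by (rule b)+
  let ?D = "4 ^ length idx * D"
  have D1: "D \<le> ?D" by simp
  have T: "leaves_le ?D T" using b(1) by (simp del: leaves_le_list)
  have "leaves_le ?D (case T of [] \<Rightarrow> None | e # _ \<Rightarrow> Some (fst e))"
    by (rule leaves_le_root[OF T])
  from fold_flip_bound[OF order_trans[OF D(2) D1] L(1) T order_trans[OF D(4) D1] this L(2)]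
  have "leaves_le ?D M'" "length M' \<le> L"
    unfolding M' flip_def by (auto simp: enc_prod_def simp del: leaves_le_list)
  then show "leaves_le ?D (M', y', z')" "length M' \<le> L"
    using b(1) by (auto simp del: leaves_le_list)
qed

lemma fold_phase_bound:
  assumes D: "1 \<le> D" "leaves_le D idx" "leaves_le D c" "set rs \<subseteq> set idx"
    and s: "fold (phase idx c) rs (map (\<lambda>_. None) idx, map (\<lambda>_. 0) idx, map (\<lambda>_. 0) idx) = (M, y, z)"
  shows "leaves_le (4 ^ (length idx * length rs) * D) (M, y, z) \<and> length M \<le> length idx \<and>
    length y \<le> length idx \<and> length z \<le> length idx"
  using s D(4)
proof (induction rs arbitrary: M y z rule: rev_induct)
  case Nil
  then show ?case by auto
next
  case (snoc r rs)
  obtain M1 y1 z1 where s1: "fold (phase idx c) rs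
      (map (\<lambda>_. None) idx, map (\<lambda>_. 0) idx, map (\<lambda>_. 0) idx) = (M1, y1, z1)"
    by (metis prod_cases3)
  let ?D = "4 ^ (length idx * length rs) * D"
  have IH: "leaves_le ?D (M1, y1, z1)" "length M1 \<le> length idx"
    "length y1 \<le> length idx" "length z1 \<le> length idx"
    using snoc.IH[OF s1] snoc.prems by auto
  have D1: "D \<le> ?D" by simp
  note D' = order_trans[OF _ D1]
  have r: "leaves_le D r" using D(2) snoc.prems(2) by simp
  have p: "phase idx c r (M1, y1, z1) = (M, y, z)" using snoc.prems(1) s1 by simp
  have "leaves_le ?D M1" "leaves_le ?D y1" "leaves_le ?D z1" using IH(1) by (simp_all del: leaves_le_list)
  from phase_bound[OF D'[OF D(1)] D'[OF D(2)] D'[OF D(3)] this(1) D'[OF r] this(2,3) order_refl IH(2-4) p]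
  show ?case by (simp add: power_add mult.assoc del: leaves_le_list)
qed

lemma nodes_int_list: "nodes (enc (xs :: int list)) = 2 * length xs + 1"
  by (induction xs) auto

lemma nodes_option_list: "nodes (enc (xs :: nat option list)) \<le> 4 * length xs + 1"
proof (induction xs)
  case (Cons a xs)
  then show ?case by (cases a) auto
qed simp

lemma nodes_tree: "nodes (enc (T :: (nat \<times> nat \<times> nat option) list)) \<le> 8 * length T + 1"
proof (induction T)
  case (Cons a T)
  then show ?case by (cases a; cases "snd (snd a)") auto
qed simp

section \<open>Polynomial time for the steps, the phases and the whole method\<close>

lemma ptime_tree_rows':
  "ptime (\<lambda>p. tree_rows (fst p) (fst (snd p)) (snd (snd p)))"
  unfolding tree_rows_def by (intro ptime)

lemma ptime_tree_rows [ptime]: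
  assumes "ptime r" "ptime M" "ptime T" shows "ptime (\<lambda>x. tree_rows (r x) (M x) (T x))"
  using ptime_comp[OF _ ptime_tree_rows', of "\<lambda>x. (r x, M x, T x)"] assms by (simp add: ptime)

lemma ptime_entry [ptime]:
  assumes "ptime c" "ptime u" "ptime v" shows "ptime (\<lambda>x. entry (c x) (u x) (v x))"
  unfolding entry_def by (intro ptime assms)

lemma ptime_candidates':
  "ptime (\<lambda>(idx, c, M, r, y, z, T). candidates idx c M r y z T)"
  unfolding candidates_def case_prod_beta by (intro ptime)

lemma ptime_candidates [ptime]:
  assumes "ptime idx" "ptime c" "ptime M" "ptime r" "ptime y" "ptime z" "ptime T"
  shows "ptime (\<lambda>x. candidates (idx x) (c x) (M x) (r x) (y x) (z x) (T x))"
  using ptime_comp[OF _ ptime_candidates', of "\<lambda>x. (idx x, c x, M x, r x, y x, z x, T x)"] assms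
  by (simp add: ptime)

lemma ptime_best [ptime]:
  assumes "ptime l" shows "ptime (\<lambda>x. best (l x))"
  unfolding best_def
  by (rule ptime_fold_add[where r = "[:2, 1:]"], (intro ptime assms)+) (auto split: option.split)

lemma ptime_grow':
  "ptime (\<lambda>(idx, c, M, r, s). grow idx c M r s)"
  unfolding grow_def case_prod_beta by (intro ptime)

lemma ptime_grow [ptime]:
  assumes "ptime idx" "ptime c" "ptime M" "ptime r" "ptime s"
  shows "ptime (\<lambda>x. grow (idx x) (c x) (M x) (r x) (s x))"
  using ptime_comp[OF _ ptime_grow', of "\<lambda>x. (idx x, c x, M x, r x, s x)"] assms
  by (simp add: ptime)

lemma ptime_flip_step [ptime]:
  assumes "ptime idx" "ptime e" "ptime s"
  shows "ptime (\<lambda>x. flip_step (idx x) (e x) (s x))"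
proof -
  have "ptime (\<lambda>(idx, e, s). flip_step idx e s)"
    unfolding flip_step_def case_prod_beta by (intro ptime)
  from ptime_comp[OF _ this, of "\<lambda>x. (idx x, e x, s x)"] show ?thesis
    using assms by (simp add: ptime)
qed

lemma leaves_le_size: "leaves_le (2 ^ size_of x) x"
  using leaf_max_less less_imp_le by blast

lemma size_le_leaves:
  assumes "leaves_le (2 ^ k) x" "nodes (enc x) \<le> n"
  shows "size_of x \<le> n * (k + 2)"
proof -
  have "leaf_max (enc x) < 2 ^ Suc k"
    using assms(1) by (rule le_less_trans) simp
  from bit_size_le_nodes[OF this] have "size_of x \<le> nodes (enc x) * (k + 2)" by simp
  also have "\<dots> \<le> n * (k + 2)" using assms(2) by (rule mult_right_mono) simp
  finally show ?thesis .
qed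

lemma ptime_flip [ptime]:
  assumes "ptime idx" "ptime T" "ptime M"
  shows "ptime (\<lambda>x. flip (idx x) (T x) (M x))"
proof -
  have "ptime (\<lambda>x. fst (fold (flip_step (fst x)) (fst (snd x))
      (snd (snd x), case fst (snd x) of [] \<Rightarrow> None | e # _ \<Rightarrow> Some (fst e))))"
  \<comment> \<open>With \<open>S\<close> the input size, the state has at most
    \<open>4 * S + 6\<close> nodes and leaves at most \<open>2 ^ S\<close>; the second factor is the
    \<open>k + 2\<close> of \<open>size_le_leaves\<close>.\<close>
  proof (rule ptime_fst, rule ptime_fold[where r = "[:6, 4:] * [:2, 1:]"])
    fix x :: "nat list \<times> (nat \<times> nat \<times> nat option) list \<times> nat option list" and ys zs
    assume T: "fst (snd x) = ys @ zs"
    let ?s = "(snd (snd x), case fst (snd x) of [] \<Rightarrow> None | e # _ \<Rightarrow> Some (fst e))"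
    obtain i T M where x: "x = (i, T, M)" by (metis prod_cases3)
    have b: "leaves_le (2 ^ size_of x) i" "leaves_le (2 ^ size_of x) T" "leaves_le (2 ^ size_of x) M"
      using leaves_le_size[of x] unfolding x by (simp_all del: leaves_le_list)
    have ys: "leaves_le (2 ^ size_of x) ys" using b(2) T unfolding x by simp
    have cur: "leaves_le (2 ^ size_of x) (snd ?s)"
      using leaves_le_root[OF b(2)] by (simp add: x)
    have L: "length i \<le> size_of x" "length M \<le> size_of x"
      using length_le_size[of i] length_le_size[of M] by (simp_all add: x)
    from fold_flip_bound[OF b(1) L(1) ys b(3) cur L(2)]
    have 1: "leaves_le (2 ^ size_of x) (fold (flip_step i) ys ?s)"
      and 2: "length (fst (fold (flip_step i) ys ?s)) \<le> size_of x" by (simp_all add: x)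
    have "nodes (enc (fold (flip_step i) ys ?s)) \<le> 4 * size_of x + 6"
      using nodes_option_list[of "fst (fold (flip_step i) ys ?s)"] 2
      by (cases "fold (flip_step i) ys ?s"; cases "snd (fold (flip_step i) ys ?s)") auto
    from size_le_leaves[OF 1 this]
    show "size_of (fold (flip_step (fst x)) ys ?s) \<le> poly ([:6, 4:] * [:2, 1:]) (size_of x)"
      by (simp add: x algebra_simps)
  qed (intro ptime)+
  from ptime_comp[OF _ this, of "\<lambda>x. (idx x, T x, M x)"] show ?thesis
    unfolding flip_def using assms by (simp add: ptime)
qed

lemma ptime_phase [ptime]:
  assumes "ptime idx" "ptime c" "ptime r" "ptime s"
  shows "ptime (\<lambda>x. phase (idx x) (c x) (r x) (s x))"
proof -
  have "ptime (\<lambda>(idx, c, M, r, y, z). fold (\<lambda>_. grow idx c M r) idx (y, z, [], False))"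
    unfolding case_prod_beta
  \<comment> \<open>At most \<open>12 * S + 7\<close> nodes. Up to \<open>S\<close> growing steps
    turn the leaf bound \<open>2 ^ S\<close> into
    \<open>4 ^ S * 2 ^ S = 2 ^ (3 * S)\<close>.\<close>
  proof (rule ptime_fold[where r = "[:7, 12:] * [:2, 3:]"])
    fix x :: "nat list \<times> int list list \<times> nat option list \<times> nat \<times> int list \<times> int list" and ys zs
    assume ys: "fst x = ys @ zs"
    obtain i c M r y z where x: "x = (i, c, M, r, y, z)" by (metis prod_cases6)
    let ?S = "size_of x"
    obtain y' z' T fin where f: "fold (\<lambda>_. grow i c M r) ys (y, z, [], False) = (y', z', T, fin)"
      by (metis prod_cases4)
    have b: "1 \<le> (2 :: nat) ^ ?S" "leaves_le (2 ^ ?S) i" "leaves_le (2 ^ ?S) c" "leaves_le (2 ^ ?S) M"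
      "leaves_le (2 ^ ?S) r" "leaves_le (2 ^ ?S) y" "leaves_le (2 ^ ?S) z"
      using leaves_le_size[of x] unfolding x by (simp_all del: leaves_le_list)
    have L: "length i \<le> ?S" "length y \<le> ?S" "length z \<le> ?S"
      using length_le_size[of i] length_le_size[of y] length_le_size[of z] by (simp_all add: x)
    note b = fold_grow_bound[OF b L f]
    have ys_le: "length ys \<le> ?S" using L(1) ys by (simp add: x)
    have "(4 :: nat) ^ length ys * 2 ^ ?S = 2 ^ (2 * length ys + ?S)"
      by (simp add: power_add power_mult)
    also have "\<dots> \<le> 2 ^ (3 * ?S)" using ys_le by (intro power_increasing) auto
    finally have 1: "leaves_le (2 ^ (3 * ?S)) (y', z', T, fin)"
      using b(1) by (rule order_trans[rotated])
    have "nodes (enc (y', z', T, fin)) \<le> 12 * ?S + 7"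
      using b(2-4) ys_le nodes_tree[of T] by (simp add: nodes_int_list)
    from size_le_leaves[OF 1 this] f
    show "size_of (fold (\<lambda>_. grow (fst x) (fst (snd x)) (fst (snd (snd x))) (fst (snd (snd (snd x))))) ys
      (fst (snd (snd (snd (snd x)))), snd (snd (snd (snd (snd x)))), [], False))
      \<le> poly ([:7, 12:] * [:2, 3:]) ?S"
      by (simp add: x algebra_simps)
  qed (intro ptime)+
  note grow = ptime_comp[OF _ this]
  have "ptime (\<lambda>p. case fold (\<lambda>_. grow (fst p) (fst (snd p)) (fst (snd (snd (snd p)))) (fst (snd (snd p)))) (fst p)
      (fst (snd (snd (snd (snd p)))), snd (snd (snd (snd (snd p)))), [], False) of
      (y', z', T, finished) \<Rightarrow> (flip (fst p) T (fst (snd (snd (snd p)))), y', z'))"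
    using grow[of "\<lambda>p. (fst p, fst (snd p), fst (snd (snd (snd p))), fst (snd (snd p)),
      fst (snd (snd (snd (snd p)))), snd (snd (snd (snd (snd p)))))"]
    unfolding case_prod_beta by (intro ptime) (simp_all add: ptime)
  from ptime_comp[OF _ this, of "\<lambda>x. (idx x, c x, r x, s x)"] show ?thesis
    using assms unfolding phase_def case_prod_beta by (simp add: ptime)
qed

lemma ptime_hungarian [ptime]:
  assumes "ptime idx" "ptime c"
  shows "ptime (\<lambda>x. hungarian (idx x) (c x))"
proof -
  have "ptime (\<lambda>x. hungarian (fst x) (snd x))"
    unfolding hungarian_def
  \<comment> \<open>At most \<open>8 * S + 5\<close> nodes. Up to \<open>S * S\<close> growing steps
    in all phases together give the leaf bound \<open>2 ^ (2 * S * S + S)\<close>.\<close>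
  proof (rule ptime_fold[where r = "[:5, 8:] * [:2, 1, 2:]"])
    fix x :: "nat list \<times> int list list" and ys zs
    assume ys: "fst x = ys @ zs"
    obtain i c where x: "x = (i, c)" by fastforce
    let ?S = "size_of x"
    let ?s = "(map (\<lambda>_. None) i, map (\<lambda>_. 0) i, map (\<lambda>_. 0) i) :: nat option list \<times> int list \<times> int list"
    obtain M y z where f: "fold (phase i c) ys ?s = (M, y, z)" by (metis prod_cases3)
    have b: "1 \<le> (2 :: nat) ^ ?S" "leaves_le (2 ^ ?S) i" "leaves_le (2 ^ ?S) c"
      using leaves_le_size[of x] unfolding x by (simp_all del: leaves_le_list)
    have i: "length i \<le> ?S" using length_le_size[of i] by (simp add: x)
    have "set ys \<subseteq> set i" "length ys \<le> length i" using ys by (auto simp: x)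
    note b = fold_phase_bound[OF b this(1) f]
    have "length i * length ys \<le> ?S * ?S"
      using i \<open>length ys \<le> length i\<close> by (intro mult_mono) auto
    then have "(2 :: nat) ^ (2 * (length i * length ys) + ?S) \<le> 2 ^ (2 * (?S * ?S) + ?S)"
      by (intro power_increasing) auto
    moreover have "(4 :: nat) ^ (length i * length ys) * 2 ^ ?S = 2 ^ (2 * (length i * length ys) + ?S)"
      by (simp add: power_add power_mult)
    ultimately have "(4 :: nat) ^ (length i * length ys) * 2 ^ ?S \<le> 2 ^ (2 * (?S * ?S) + ?S)"
      by simp
    then have 1: "leaves_le (2 ^ (2 * (?S * ?S) + ?S)) (M, y, z)"
      by (rule order_trans[OF conjunct1[OF b]])
    have "nodes (enc (M, y, z)) \<le> 8 * ?S + 5"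
      using b i nodes_option_list[of M] by (simp add: nodes_int_list)
    from size_le_leaves[OF 1 this] f
    show "size_of (fold (phase (fst x) (snd x)) ys
      (map (\<lambda>_. None) (fst x), map (\<lambda>_. 0) (fst x), map (\<lambda>_. 0) (fst x)))
      \<le> poly ([:5, 8:] * [:2, 1, 2:]) ?S"
      by (simp add: x algebra_simps)
  qed (intro ptime)+
  from ptime_comp[OF _ this, of "\<lambda>x. (idx x, c x)"] show ?thesis
    using assms by (simp add: ptime)
qed

section \<open>From an assignment to tours\<close>

fun walk :: "(nat \<Rightarrow> nat \<Rightarrow> 'a :: comm_monoid_add) \<Rightarrow> nat list \<Rightarrow> 'a" where
  "walk w (a # b # xs) = w a b + walk w (b # xs)"
| "walk w _ = 0"

lemma walk_append: "walk w (xs @ x # ys) = walk w (xs @ [x]) + walk w (x # ys)"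
proof (induction xs)
  case (Cons a xs)
  then show ?case by (cases xs) (auto simp: add.assoc)
qed simp

fun pairs :: "'a list \<Rightarrow> 'a list list" where
  "pairs (a # b # xs) = [a, b] # pairs xs"
| "pairs _ = []"

definition chunk :: "'a list \<Rightarrow> 'a list list" where
  "chunk us = (if even (length us) then pairs us else (case us of [] \<Rightarrow> []
     | a # l \<Rightarrow> (case l of [] \<Rightarrow> [[a]] | b # l' \<Rightarrow> (case l' of [] \<Rightarrow> [[a, b]]
     | c # xs \<Rightarrow> [a, b, c] # pairs xs))))"

lemma concat_pairs: "even (length us) \<Longrightarrow> concat (pairs us) = us"
  by (induction us rule: pairs.induct) auto

lemma concat_chunk: "concat (chunk us) = us"
  by (auto simp: chunk_def concat_pairs split: list.split)

lemma pairs_length: "g \<in> set (pairs us) \<Longrightarrow> length g = 2"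
  by (induction us rule: pairs.induct) auto

lemma chunk_length: "g \<in> set (chunk us) \<Longrightarrow> g \<noteq> [] \<and> length g \<le> 3"
proof (cases "even (length us)")
  case True
  then show "g \<in> set (chunk us) \<Longrightarrow> ?thesis" using pairs_length[of g us] by (auto simp: chunk_def)
next
  case False
  then show "g \<in> set (chunk us) \<Longrightarrow> ?thesis"
    using pairs_length[of g] by (cases us; cases "tl us"; cases "tl (tl us)") (force simp: chunk_def)+
qed

text \<open>
  A group of customers, given with the amounts they receive, stands for the tour that visits
  them in this order; the additional number is a multiplicity.
\<close>

type_synonym group = "(nat \<times> nat) list"

text \<open>Two entries suffice for any demand: the full loads and the remainder. An empty remainder
  gets multiplicity 0.\<close>

definition solo :: "nat \<Rightarrow> nat \<Rightarrow> (nat \<times> group) list" where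
  "solo i e = [(e div 3, [(i, 3)]), (if e mod 3 = 0 then 0 else 1, [(i, e mod 3)])]"

text \<open>
  Customers of demand at least 2 are served alone, except that one of them may accompany
  the single unit demand of its cycle. The flag \<open>rot\<close> selects one of two ways of cutting the
  cycle of unit demands into pairs (and one triple, if its length is odd).
\<close>

definition emit_plain :: "bool \<Rightarrow> (nat \<Rightarrow> nat) \<Rightarrow> nat list \<Rightarrow> nat list \<Rightarrow> (nat \<times> group) list" where
  "emit_plain rot d us bs = map (\<lambda>g. (1, map (\<lambda>v. (v, 1)) g)) (chunk (if rot then rotate1 us else us))
     @ concat (map (\<lambda>b. solo b (d b)) bs)"

definition emit_paired :: "(nat \<Rightarrow> nat) \<Rightarrow> nat \<Rightarrow> nat \<Rightarrow> nat list \<Rightarrow> (nat \<times> group) list" where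
  "emit_paired d v i bs = (1, [(v, 1), (i, 2)]) # solo i (d i - 2) @ concat (map (\<lambda>b. solo b (d b)) bs)"

text \<open>The depot may lie on a cycle as well; having demand 0, it drops out of both
  lists.\<close>

definition emit :: "bool \<Rightarrow> (nat \<Rightarrow> nat) \<Rightarrow> nat list \<Rightarrow> (nat \<times> group) list" where
  "emit rot d cyc = (let us = filter (\<lambda>v. d v = 1) cyc; bs = filter (\<lambda>v. 1 < d v) cyc in
     case us of [] \<Rightarrow> emit_plain rot d us bs
     | v # us' \<Rightarrow> (case us' of [] \<Rightarrow> (case bs of [] \<Rightarrow> emit_plain rot d us bs
         | i # bs' \<Rightarrow> emit_paired d v i bs')
       | u # us'' \<Rightarrow> emit_plain rot d us bs))"

definition amount :: "group \<Rightarrow> nat \<Rightarrow> nat" where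
  "amount g v = sum_list (map (\<lambda>e. if fst e = v then snd e else 0) g)"

definition delivered :: "(nat \<times> group) list \<Rightarrow> nat \<Rightarrow> nat" where
  "delivered ms v = sum_list (map (\<lambda>p. fst p * amount (snd p) v) ms)"

definition group_cost :: "(nat \<Rightarrow> nat \<Rightarrow> int) \<Rightarrow> group \<Rightarrow> int" where
  "group_cost W g = walk W (0 # map fst g @ [0])"

definition total_cost :: "(nat \<Rightarrow> nat \<Rightarrow> int) \<Rightarrow> (nat \<times> group) list \<Rightarrow> int" where
  "total_cost W ms = sum_list (map (\<lambda>p. int (fst p) * group_cost W (snd p)) ms)"

definition valid_group :: "nat set \<Rightarrow> group \<Rightarrow> bool" where
  "valid_group A g \<longleftrightarrow> g \<noteq> [] \<and> distinct (map fst g) \<and> set (map fst g) \<subseteq> A \<and> sum_list (map snd g) \<le> 3"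

lemma delivered_append: "delivered (ms @ ms') v = delivered ms v + delivered ms' v"
  by (simp add: delivered_def)

lemma delivered_Cons: "delivered (p # ms) v = fst p * amount (snd p) v + delivered ms v"
  by (simp add: delivered_def)

lemma delivered_concat: "delivered (concat mss) v = sum_list (map (\<lambda>ms. delivered ms v) mss)"
  by (induction mss) (simp_all add: delivered_append, simp add: delivered_def)

lemma total_cost_append: "total_cost W (ms @ ms') = total_cost W ms + total_cost W ms'"
  by (simp add: total_cost_def)

lemma total_cost_concat: "total_cost W (concat mss) = sum_list (map (total_cost W) mss)"
  by (induction mss) (simp_all add: total_cost_append, simp add: total_cost_def)

lemma delivered_solo: "delivered (solo i e) v = (if v = i then e else 0)"
  by (auto simp: delivered_def solo_def amount_def)

lemma sum_list_single:
  "distinct xs \<Longrightarrow> sum_list (map (\<lambda>x. if v = x then f x else 0) xs) = (if v \<in> set xs then f v else (0 :: nat))"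
  by (induction xs) auto

lemma delivered_units:
  "delivered (map (\<lambda>g. (1, map (\<lambda>v. (v, 1)) g)) gs) v = count_list (concat gs) v"
proof -
  have "amount (map (\<lambda>v. (v, 1)) g) v = count_list g v" for g
    by (induction g) (auto simp: amount_def)
  then show ?thesis
    by (induction gs) (auto simp: delivered_def)
qed

lemma count_list_distinct: "distinct xs \<Longrightarrow> count_list xs v = (if v \<in> set xs then 1 else 0)"
  by (induction xs) auto

lemma delivered_emit_plain:
  assumes "distinct us" "distinct bs"
  shows "delivered (emit_plain rot d us bs) v = (if v \<in> set us then 1 else 0) + (if v \<in> set bs then d v else 0)"
proof -
  have "sum_list (map (\<lambda>b. delivered (solo b (d b)) v) bs) = (if v \<in> set bs then d v else 0)"
    unfolding delivered_solo by (rule sum_list_single) fact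
  then show ?thesis
    using assms unfolding emit_plain_def
    by (simp add: delivered_append delivered_units[simplified] delivered_concat concat_chunk
      count_list_distinct comp_def)
qed

lemma emit_cases:
  fixes d :: "nat \<Rightarrow> nat" and cyc :: "nat list"
  defines "us \<equiv> filter (\<lambda>v. d v = 1) cyc" and "bs \<equiv> filter (\<lambda>v. 1 < d v) cyc"
  obtains "emit rot d cyc = emit_plain rot d us bs"
    | u i bs' where "us = [u]" "bs = i # bs'" "emit rot d cyc = emit_paired d u i bs'"
proof -
  have e: "emit rot d cyc = (case us of [] \<Rightarrow> emit_plain rot d us bs
     | v # us' \<Rightarrow> (case us' of [] \<Rightarrow> (case bs of [] \<Rightarrow> emit_plain rot d us bs
         | i # bs' \<Rightarrow> emit_paired d v i bs')
       | u # us'' \<Rightarrow> emit_plain rot d us bs))"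
    unfolding emit_def us_def bs_def Let_def ..
  show ?thesis
  proof (cases "\<exists>u i bs'. us = [u] \<and> bs = i # bs'")
    case True
    then show ?thesis using that(2) e by auto
  next
    case False
    then have "emit rot d cyc = emit_plain rot d us bs"
      unfolding e by (auto split: list.split)
    then show ?thesis by (rule that(1))
  qed
qed

lemma delivered_emit:
  assumes "distinct cyc"
  shows "delivered (emit rot d cyc) v = (if v \<in> set cyc then d v else 0)"
proof -
  define us where "us = filter (\<lambda>v. d v = 1) cyc"
  define bs where "bs = filter (\<lambda>v. 1 < d v) cyc"
  have dist: "distinct us" "distinct bs" using assms by (simp_all add: us_def bs_def)
  have plain: "delivered (emit_plain rot d us bs) v = (if v \<in> set cyc then d v else 0)"
    unfolding delivered_emit_plain[OF dist] by (auto simp: us_def bs_def)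
  consider "emit rot d cyc = emit_plain rot d us bs"
    | u i bs' where "us = [u]" "bs = i # bs'" "emit rot d cyc = emit_paired d u i bs'"
    using emit_cases[of rot d cyc] unfolding us_def bs_def by blast
  then show ?thesis
  proof cases
    case 1
    then show ?thesis using plain by simp
  next
    case (2 u i bs')
    have mem: "x \<in> set us \<longleftrightarrow> x \<in> set cyc \<and> d x = 1" "x \<in> set bs \<longleftrightarrow> x \<in> set cyc \<and> 1 < d x" for x
      by (auto simp: us_def bs_def)
    have u: "u \<in> set cyc" "d u = 1" and i: "i \<in> set cyc" "1 < d i" using mem[of u] mem[of i] 2 by auto
    have bs': "x \<in> set bs' \<longleftrightarrow> x \<in> set cyc \<and> 1 < d x \<and> x \<noteq> i" for x using mem(2)[of x] 2 dist(2) by auto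
    have us: "x = u \<longleftrightarrow> x \<in> set cyc \<and> d x = 1" for x using mem(1)[of x] 2 by auto
    have "sum_list (map (\<lambda>b. delivered (solo b (d b)) v) bs') = (if v \<in> set bs' then d v else 0)"
      unfolding delivered_solo by (rule sum_list_single) (use dist(2) 2 in simp)
    then have *: "delivered (emit rot d cyc) v = (if v = u then 1 else 0) + (if v = i then 2 else 0) +
       (if v = i then d i - 2 else 0) + (if v \<in> set bs' then d v else 0)"
      unfolding 2(3) emit_paired_def
      by (auto simp: delivered_Cons delivered_append delivered_solo delivered_concat amount_def comp_def)
    show ?thesis
      unfolding * bs' using u i us[of v] by auto
  qed
qed

lemma valid_group_mono: "valid_group A g \<Longrightarrow> A \<subseteq> B \<Longrightarrow> valid_group B g"
  by (auto simp: valid_group_def)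

lemma valid_solo: "p \<in> set (solo i e) \<Longrightarrow> valid_group {i} (snd p)"
  using mod_less_divisor[of 3 e] by (auto simp: solo_def valid_group_def)

lemma valid_emit_plain:
  assumes "distinct us" "p \<in> set (emit_plain rot d us bs)"
  shows "valid_group (set us \<union> set bs) (snd p)"
proof -
  consider g where "g \<in> set (chunk (if rot then rotate1 us else us))" "snd p = map (\<lambda>v. (v, 1)) g"
    | b where "b \<in> set bs" "p \<in> set (solo b (d b))"
    using assms(2) unfolding emit_plain_def by auto
  then show ?thesis
  proof cases
    case 1
    let ?us = "if rot then rotate1 us else us"
    have "distinct (concat (chunk ?us))" "set (concat (chunk ?us)) = set us"
      using assms(1) by (simp_all add: concat_chunk)
    then have "distinct g" "set g \<subseteq> set us" using 1 by (auto dest: distinct_concat_iff[THEN iffD1])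
    moreover have "map fst (map (\<lambda>v. (v, 1 :: nat)) g) = g" "sum_list (map snd (map (\<lambda>v. (v, 1 :: nat)) g)) = length g"
      by (induction g) auto
    ultimately show ?thesis using chunk_length[OF 1(1)] 1(2) by (auto simp: valid_group_def)
  next
    case 2
    then show ?thesis by (intro valid_group_mono[OF valid_solo]) auto
  qed
qed

lemma valid_emit:
  assumes "distinct cyc" "p \<in> set (emit rot d cyc)"
  shows "valid_group {v \<in> set cyc. 0 < d v} (snd p)"
proof -
  define us where "us = filter (\<lambda>v. d v = 1) cyc"
  define bs where "bs = filter (\<lambda>v. 1 < d v) cyc"
  have dist: "distinct us" "distinct bs" using assms by (simp_all add: us_def bs_def)
  have sub: "set us \<union> set bs \<subseteq> {v \<in> set cyc. 0 < d v}" by (auto simp: us_def bs_def)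
  consider "emit rot d cyc = emit_plain rot d us bs"
    | u i bs' where "us = [u]" "bs = i # bs'" "emit rot d cyc = emit_paired d u i bs'"
    using emit_cases[of rot d cyc] unfolding us_def bs_def by blast
  then show ?thesis
  proof cases
    case 1
    then show ?thesis
      using valid_emit_plain[OF dist(1)] assms(2) sub by (intro valid_group_mono[OF _ sub]) auto
  next
    case (2 u i bs')
    have "u \<in> set us" "i \<in> set bs" using 2 by auto
    then have "u \<noteq> i" by (auto simp: us_def bs_def)
    from assms(2) consider "snd p = [(u, 1), (i, 2)]" | b e where "b \<in> set bs" "p \<in> set (solo b e)"
      unfolding 2(3) emit_paired_def using 2(2) by auto
    then have "valid_group (set us \<union> set bs) (snd p)"
    proof cases
      case 1
      then show ?thesis using \<open>u \<noteq> i\<close> 2 by (simp add: valid_group_def)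
    next
      case (2 b e)
      then show ?thesis by (intro valid_group_mono[OF valid_solo]) auto
    qed
    then show ?thesis by (rule valid_group_mono[OF _ sub])
  qed
qed

section \<open>Integer metrics and shortcutting\<close>

locale metric_demands =
  fixes n :: nat and W :: "nat \<Rightarrow> nat \<Rightarrow> int" and d :: "nat \<Rightarrow> nat"
  assumes W_diag: "u \<le> n \<Longrightarrow> W u u = 0"
    and W_nonneg: "u \<le> n \<Longrightarrow> v \<le> n \<Longrightarrow> 0 \<le> W u v"
    and W_sym: "u \<le> n \<Longrightarrow> v \<le> n \<Longrightarrow> W u v = W v u"
    and W_tri: "u \<le> n \<Longrightarrow> v \<le> n \<Longrightarrow> x \<le> n \<Longrightarrow> W u x \<le> W u v + W v x"
    and d_0: "d 0 = 0"
    and d_pos: "1 \<le> v \<Longrightarrow> v \<le> n \<Longrightarrow> 1 \<le> d v"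
begin

definition assign_cost :: "nat \<Rightarrow> nat \<Rightarrow> int" where
  "assign_cost u v = (if u = v then (if d u = 1 then 2 * W 0 u else 0) else W u v)"

definition closed :: "nat list \<Rightarrow> int" where
  "closed xs = walk W (xs @ [hd xs])"

definition radial :: "nat list \<Rightarrow> int" where
  "radial xs = sum_list (map (W 0) xs)"

lemma radial_simps [simp]: "radial [] = 0" "radial (x # xs) = W 0 x + radial xs"
  "radial (xs @ ys) = radial xs + radial ys"
  by (simp_all add: radial_def)

lemma walk_nonneg: "set xs \<subseteq> {..n} \<Longrightarrow> 0 \<le> walk W xs"
  by (induction xs rule: induct_list012) (auto simp: W_nonneg)

lemma walk_ge_ends: "xs \<noteq> [] \<Longrightarrow> set xs \<subseteq> {..n} \<Longrightarrow> W (hd xs) (last xs) \<le> walk W xs"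
proof (induction xs rule: induct_list012)
  case (3 x y zs)
  have "last (y # zs) \<in> set (y # zs)" by (rule last_in_set) simp
  then have "last (y # zs) \<le> n" using 3 by auto
  then have "W x (last (y # zs)) \<le> W x y + W y (last (y # zs))" using 3 by (intro W_tri) auto
  also have "\<dots> \<le> W x y + walk W (y # zs)" using 3 by simp
  finally show ?case by simp
qed (auto simp: W_diag)

lemma walk_filter:
  assumes "set xs \<subseteq> {..n}" "a \<le> n" "b \<le> n"
  shows "walk W (a # filter P xs @ [b]) \<le> walk W (a # xs @ [b])"
  using assms
proof (induction xs arbitrary: a)
  case (Cons x xs)
  then have IH: "walk W (a # filter P xs @ [b]) \<le> walk W (a # xs @ [b])"
    "walk W (x # filter P xs @ [b]) \<le> walk W (x # xs @ [b])" by auto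
  have "walk W (a # xs @ [b]) \<le> W a x + walk W (x # xs @ [b])"
    using Cons.prems W_tri[of a x "hd (xs @ [b])"] by (cases xs) auto
  then show ?case using IH by auto
qed simp

text \<open>Besides the usual shortcuts, the base point \<open>hd xs\<close> may be deleted. The
  cycle is then reread from the first kept vertex \<open>y\<close>, and the closing edge into
  \<open>y\<close> is bounded by the detour through the deleted prefix \<open>us\<close>.\<close>

lemma closed_filter:
  assumes "set xs \<subseteq> {..n}" "filter P xs \<noteq> []"
  shows "closed (filter P xs) \<le> closed xs"
proof -
  obtain y ys where y: "filter P xs = y # ys" using assms(2) by (cases "filter P xs") auto
  then obtain us vs where xs: "xs = us @ y # vs" and us: "\<forall>u\<in>set us. \<not> P u" and ys: "ys = filter P vs"
    by (auto simp: filter_eq_Cons_iff)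
  show ?thesis
  proof (cases us)
    case Nil
    then show ?thesis
      using walk_filter[of vs y y P] assms(1) xs y ys by (simp add: closed_def)
  next
    case (Cons u us')
    have "walk W (y # ys @ [y]) \<le> walk W (y # vs @ [y])"
      using walk_filter[of vs y y P] assms(1) xs ys by simp
    also have "\<dots> \<le> walk W ((y # vs) @ [u, y])"
    proof -
      obtain ws x where x: "y # vs = ws @ [x]" by (metis append_butlast_last_id list.distinct(1))
      have "y # vs @ [y] = ws @ x # [y]"
        using arg_cong[OF x, of "\<lambda>l. l @ [y]"] by simp
      then have "walk W (y # vs @ [y]) = walk W (ws @ [x]) + W x y"
        using walk_append[of W ws x "[y]"] by (simp only: walk.simps add_0_right)
      moreover have "walk W ((y # vs) @ [u, y]) = walk W (ws @ [x]) + (W x u + W u y)"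
        using walk_append[of W ws x "[u, y]"] unfolding x by simp
      moreover have "x \<in> set (y # vs)" unfolding x by simp
      then have "x \<le> n" "u \<le> n" "y \<le> n"
        using assms(1) Cons xs by auto
      ultimately show ?thesis using W_tri[of x u y] by simp
    qed
    also have "\<dots> = walk W (y # vs @ [u]) + W u y"
      using walk_append[of W "y # vs" u "[y]"] by simp
    also have "\<dots> \<le> walk W (y # vs @ [u]) + walk W (us @ [y])"
      using walk_ge_ends[of "us @ [y]"] assms(1) xs Cons by auto
    also have "\<dots> = closed xs"
      using walk_append[of W us y "vs @ [u]"] by (simp add: closed_def xs Cons)
    finally show ?thesis by (simp add: closed_def y)
  qed
qed

lemma closed_nonneg: "set xs \<subseteq> {..n} \<Longrightarrow> xs \<noteq> [] \<Longrightarrow> 0 \<le> closed xs"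
  unfolding closed_def by (rule walk_nonneg) (cases xs, auto)

lemma closed_ge_pair:
  assumes "distinct xs" "set xs \<subseteq> {..n}" "u \<in> set xs" "v \<in> set xs" "u \<noteq> v"
  shows "2 * W u v \<le> closed xs"
proof -
  let ?f = "filter (\<lambda>x. x = u \<or> x = v) xs"
  have "set ?f = {u, v}" "distinct ?f" using assms by auto
  then have "length ?f = 2" using distinct_card[of ?f] assms(5) by simp
  then obtain a b where f: "?f = [a, b]" by (auto simp: length_Suc_conv numeral_2_eq_2)
  with \<open>set ?f = {u, v}\<close> have "(a = u \<and> b = v) \<or> (a = v \<and> b = u)"
    by (auto simp: doubleton_eq_iff)
  then have "closed ?f = 2 * W u v"
    using W_sym[of u v] assms(2-5) by (auto simp: closed_def f subset_iff)
  with closed_filter[OF assms(2), of "\<lambda>x. x = u \<or> x = v"] f show ?thesis by simp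
qed

section \<open>Cost of cutting a cycle into tours\<close>

definition pair_edges :: "nat list \<Rightarrow> int" where
  "pair_edges us = sum_list (map (\<lambda>g. W (hd g) (last g)) (pairs us))"

lemma pair_edges_simps [simp]: "pair_edges [] = 0" "pair_edges [a] = 0"
  "pair_edges (a # b # us) = W a b + pair_edges us"
  by (simp_all add: pair_edges_def)

definition chunk_cost :: "nat list list \<Rightarrow> int" where
  "chunk_cost gs = sum_list (map (\<lambda>g. walk W (0 # g @ [0])) gs)"

lemma chunk_cost_simps [simp]: "chunk_cost [] = 0"
  "chunk_cost (g # gs) = walk W (0 # g @ [0]) + chunk_cost gs"
  by (simp_all add: chunk_cost_def)

lemma chunk_cost_pairs:
  "even (length us) \<Longrightarrow> set us \<subseteq> {..n} \<Longrightarrow> chunk_cost (pairs us) = radial us + pair_edges us"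
  by (induction us rule: pairs.induct) (auto simp: W_sym[of _ 0])

text \<open>The two pairings, shifted by one vertex, take alternate edges of the path.\<close>

lemma pair_edges_odd:
  "odd (length ys) \<Longrightarrow> pair_edges (x # ys) + pair_edges (ys @ [z]) = walk W (x # ys @ [z])"
proof (induction ys arbitrary: x rule: pairs.induct)
  case (1 a b ys)
  then show ?case by (cases ys) auto
qed auto

lemma pair_edges_even:
  "even (length xs) \<Longrightarrow> pair_edges (x # xs @ [z]) + pair_edges xs = walk W (x # xs @ [z])"
  using pair_edges_odd[of "tl xs" "hd xs" z] by (cases xs) auto

text \<open>
  Both ways of cutting together use every edge of the cycle once. In the odd case the edge in
  the middle is used once more, but its ends are middle vertices of a triple.
\<close>

lemma chunk_rotate:
  assumes "2 \<le> length us" "set us \<subseteq> {..n}"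
  shows "chunk_cost (chunk us) + chunk_cost (chunk (rotate1 us)) \<le> 2 * radial us + closed us"
proof (cases "even (length us)")
  case True
  obtain x ys where us: "us = x # ys" using assms(1) by (cases us) auto
  then have "odd (length ys)" using True by simp
  have "chunk_cost (chunk us) = radial us + pair_edges us"
    using chunk_cost_pairs[OF True assms(2)] True by (simp add: chunk_def)
  moreover have "chunk_cost (chunk (rotate1 us)) = radial us + pair_edges (ys @ [x])"
    using chunk_cost_pairs[of "rotate1 us"] True assms(2) by (simp add: chunk_def us)
  ultimately show ?thesis
    using pair_edges_odd[OF \<open>odd (length ys)\<close>, of x x] us by (simp add: closed_def)
next
  case False
  then obtain a b c xs where us: "us = a # b # c # xs"
    using assms(1) by (cases us; cases "tl us"; cases "tl (tl us)") auto
  have xs: "even (length xs)" using False us by simp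
  have le: "a \<le> n" "b \<le> n" "c \<le> n" "set xs \<subseteq> {..n}" using assms(2) us by auto
  \<comment> \<open>\<open>e\<close> is the successor of \<open>c\<close> on the cycle and completes
    the triple of the rotated list. For a cycle of length 3 it is \<open>a\<close> itself.\<close>
  obtain e ys where e: "xs @ [a] = e # ys" by (cases "xs @ [a]") auto
  have "length (xs @ [a]) = Suc (length ys)" unfolding e by simp
  then have len: "length ys = length xs" by simp
  have "set (xs @ [a]) \<subseteq> {..n}" using le by simp
  then have le': "e \<le> n" "set ys \<subseteq> {..n}" unfolding e by auto
  have rad: "radial (xs @ [a]) = W 0 e + radial ys" unfolding e by simp
  have "chunk_cost (chunk us) = W 0 a + W a b + W b c + W 0 c + radial xs + pair_edges xs"
    using chunk_cost_pairs[OF xs le(4)] xs le by (simp add: chunk_def us W_sym[of _ 0])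
  moreover have "chunk (rotate1 us) = [b, c, e] # pairs ys"
    using len xs e by (simp add: chunk_def us)
  moreover have "chunk_cost (pairs ys) = radial ys + pair_edges ys"
    using len xs le' by (intro chunk_cost_pairs) auto
  moreover have "W c e + pair_edges ys + pair_edges xs = walk W (c # xs @ [a])"
    using pair_edges_even[OF xs, of c a] by (simp add: e)
  moreover have "closed us = W a b + (W b c + walk W (c # xs @ [a]))"
    by (simp add: closed_def us)
  moreover have "W b c \<le> W 0 b + W 0 c"
    using W_tri[of b 0 c] W_sym[of b 0] le by simp
  ultimately show ?thesis
    using rad le le' by (simp add: us W_sym[of _ 0])
qed

text \<open>Serving \<open>k\<close> units alone takes \<open>ceil (k / 3)\<close> round trips, and
  \<open>2 * ceil (k / 3) \<le> k\<close> except for \<open>k = 1\<close>. In the second inequality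
  two units ride with a unit customer and use one leg \<open>W 0 i\<close>; if a single unit
  remains, the exception is covered by the radial share of these two.\<close>

lemma cost_solo:
  assumes "i \<le> n" "2 \<le> e"
  shows "total_cost W (solo i e) \<le> int e * W 0 i"
    and "W 0 i + total_cost W (solo i (e - 2)) \<le> int e * W 0 i"
proof -
  have c: "total_cost W (solo i k) = int (2 * (k div 3 + (if k mod 3 = 0 then 0 else 1))) * W 0 i" for k
    using W_sym[of i 0] assms(1)
    by (auto simp: total_cost_def solo_def group_cost_def algebra_simps)
  have step: "2 * (k div 3 + (if k mod 3 = 0 then 0 else 1)) \<le> k + (if k = 1 then 1 else 0)" for k :: nat
  proof -
    define q r where "q = k div 3" and "r = k mod 3"
    have "k = 3 * q + r" "r < 3" by (simp_all add: q_def r_def)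
    then show ?thesis unfolding q_def[symmetric] r_def[symmetric]
      by (cases "r = 0"; cases "r = 1") auto
  qed
  have 1: "2 * (e div 3 + (if e mod 3 = 0 then 0 else 1)) \<le> e"
    using step[of e] assms(2) by simp
  have 2: "1 + 2 * ((e - 2) div 3 + (if (e - 2) mod 3 = 0 then 0 else 1)) \<le> e"
    using step[of "e - 2"] assms(2) by (simp split: if_splits)
  have W: "0 \<le> W 0 i" using W_nonneg assms(1) by simp
  show "total_cost W (solo i e) \<le> int e * W 0 i"
    unfolding c using 1 W by (intro mult_right_mono) linarith+
  have "W 0 i + total_cost W (solo i (e - 2)) = int (1 + 2 * ((e - 2) div 3 + (if (e - 2) mod 3 = 0 then 0 else 1))) * W 0 i"
    unfolding c by (simp add: algebra_simps)
  also have "\<dots> \<le> int e * W 0 i"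
    using 2 W by (intro mult_right_mono) linarith+
  finally show "W 0 i + total_cost W (solo i (e - 2)) \<le> int e * W 0 i" .
qed

definition demand_radial :: "nat list \<Rightarrow> int" where
  "demand_radial xs = sum_list (map (\<lambda>v. int (d v) * W 0 v) xs)"

lemma cost_solos:
  assumes "\<And>b. b \<in> set bs \<Longrightarrow> b \<le> n \<and> 1 < d b"
  shows "total_cost W (concat (map (\<lambda>b. solo b (d b)) bs)) \<le> demand_radial bs"
  unfolding total_cost_concat map_map comp_def demand_radial_def
  by (intro sum_list_mono cost_solo(1)) (use assms in fastforce)+

lemma demand_radial_split:
  "demand_radial xs = radial (filter (\<lambda>v. d v = 1) xs) + demand_radial (filter (\<lambda>v. 1 < d v) xs)"
  by (induction xs) (auto simp: demand_radial_def)

lemma walk_assign_cost_aux: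
  "distinct (x # xs) \<Longrightarrow> last (x # xs) \<noteq> z \<Longrightarrow> walk assign_cost (x # xs @ [z]) = walk W (x # xs @ [z])"
proof (induction xs arbitrary: x)
  case (Cons y xs)
  then have "walk assign_cost (y # xs @ [z]) = walk W (y # xs @ [z])" by simp
  moreover have "assign_cost x y = W x y" using Cons.prems by (simp add: assign_cost_def)
  ultimately show ?case by simp
qed (simp add: assign_cost_def)

text \<open>Consecutive vertices of a longer cycle differ, so the diagonal of
  \<open>assign_cost\<close> is felt at fixed points only.\<close>

lemma walk_assign_cost:
  assumes "distinct cyc" "2 \<le> length cyc"
  shows "walk assign_cost (cyc @ [hd cyc]) = closed cyc"
proof -
  obtain x y xs where cyc: "cyc = x # y # xs"
    using assms(2) by (cases cyc; cases "tl cyc") auto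
  have "last (y # xs) \<in> set (y # xs)" by (rule last_in_set) simp
  then have "last cyc \<noteq> x" using assms(1) unfolding cyc by auto
  then show ?thesis
    using walk_assign_cost_aux[of x "y # xs" x] assms(1) by (simp add: closed_def cyc)
qed

text \<open>This is \<open>2 * R + C\<close> restricted to one cycle. With at least two unit
  customers, the cycle is shortcut to them and \<open>chunk_rotate\<close> applies. With at most
  one, both flags yield the same groups, and the cycle must pay twice for whatever exceeds the
  radial share.\<close>

lemma emit_cost:
  assumes cyc: "distinct cyc" "set cyc \<subseteq> {..n}" "cyc \<noteq> []"
  shows "total_cost W (emit False d cyc) + total_cost W (emit True d cyc) \<le>
    2 * demand_radial cyc + walk assign_cost (cyc @ [hd cyc])"
proof -
  define us where "us = filter (\<lambda>v. d v = 1) cyc"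
  define bs where "bs = filter (\<lambda>v. 1 < d v) cyc"
  define A where "A = walk assign_cost (cyc @ [hd cyc])"
  have A: "A = closed cyc" if "2 \<le> length cyc"
    using walk_assign_cost[OF cyc(1) that] by (simp add: A_def)
  have A0: "0 \<le> A"
  proof (cases "2 \<le> length cyc")
    case True
    then show ?thesis using A closed_nonneg cyc by simp
  next
    case False
    then obtain x where "cyc = [x]" using cyc(3) by (cases cyc; cases "tl cyc") auto
    then show ?thesis using W_nonneg[of 0 x] cyc(2) by (simp add: A_def assign_cost_def)
  qed
  have split: "demand_radial cyc = radial us + demand_radial bs"
    unfolding us_def bs_def by (rule demand_radial_split)
  have bs: "\<And>b. b \<in> set bs \<Longrightarrow> b \<le> n \<and> 1 < d b" using cyc by (auto simp: bs_def)
  have us: "set us \<subseteq> {..n}" using cyc by (auto simp: us_def)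
  have plain: "total_cost W (emit_plain rot d us bs) \<le>
      chunk_cost (chunk (if rot then rotate1 us else us)) + demand_radial bs" for rot
    using cost_solos[OF bs] unfolding emit_plain_def total_cost_append
    by (simp add: chunk_cost_def total_cost_def group_cost_def comp_def)
  consider "us = []" | v where "us = [v]" "bs = []" | v i bs' where "us = [v]" "bs = i # bs'"
    | v u us' where "us = v # u # us'"
    by (cases us; cases "tl us"; cases bs) auto
  then have "total_cost W (emit False d cyc) + total_cost W (emit True d cyc) \<le> 2 * demand_radial cyc + A"
  proof cases
    case 1
    then have "emit rot d cyc = emit_plain rot d us bs" for rot
      unfolding emit_def us_def[symmetric] bs_def[symmetric] by (simp add: Let_def)
    then show ?thesis using plain[of False] plain[of True] split A0 1
      by (simp add: chunk_def)
  next
    case (2 v)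
    then have e: "emit rot d cyc = emit_plain rot d us bs" for rot
      unfolding emit_def us_def[symmetric] bs_def[symmetric] by (simp add: Let_def)
    have v: "v \<in> set cyc" "d v = 1" "v \<le> n" using 2 us by (auto simp: us_def filter_eq_Cons_iff)
    \<comment> \<open>Both solutions send a round trip to \<open>v\<close>, together
      \<open>4 * W 0 v\<close>, half of which is radial. The other half comes from the diagonal if
      \<open>v\<close> is a fixed point; otherwise the only possible companion on the cycle is the
      depot.\<close>
    have "2 * W 0 v \<le> A"
    proof (cases "2 \<le> length cyc")
      case True
      have "x = 0 \<or> x = v" if "x \<in> set cyc" for x
      proof -
        have "x \<notin> set us \<Longrightarrow> d x \<noteq> 1" "x \<notin> set bs \<Longrightarrow> d x \<le> 1"
          using that by (auto simp: us_def bs_def)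
        then show ?thesis using d_pos[of x] that cyc(2) 2 by fastforce
      qed
      moreover have "\<exists>x\<in>set cyc. x \<noteq> v"
      proof (rule ccontr)
        assume "\<not> ?thesis"
        then have "set cyc \<subseteq> {v}" by auto
        then show False using True distinct_card[OF cyc(1)] card_mono[of "{v}" "set cyc"] by simp
      qed
      ultimately have "0 \<in> set cyc" by auto
      moreover have "v \<noteq> 0" using v(2) d_0 by (metis zero_neq_one)
      ultimately show ?thesis using closed_ge_pair[OF cyc(1,2), of 0 v] v A[OF True] by simp
    next
      case False
      then have "cyc = [v]" using v(1) by (cases cyc; cases "tl cyc") auto
      then show ?thesis using v by (simp add: A_def assign_cost_def)
    qed
    then show ?thesis using plain[of False] plain[of True] split 2 e v
      by (simp add: chunk_def W_sym[of v 0])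
  next
    case (3 v i bs')
    then have e: "emit rot d cyc = emit_paired d v i bs'" for rot
      unfolding emit_def us_def[symmetric] bs_def[symmetric] by (simp add: Let_def)
    have v: "v \<in> set cyc" "d v = 1" "v \<le> n" using 3 us by (auto simp: us_def filter_eq_Cons_iff)
    have "i \<in> set bs" using 3 by simp
    then have i: "i \<in> set cyc" "1 < d i" "i \<le> n" using bs by (auto simp: bs_def)
    have "v \<noteq> i" using v i by auto
    then have "\<not> length cyc < 2" using v i by (cases cyc; cases "tl cyc") auto
    \<comment> \<open>The shared tour uses the edge from \<open>v\<close> to \<open>i\<close> in
      both solutions.\<close>
    then have "2 * W v i \<le> A" using closed_ge_pair[OF cyc(1,2) v(1) i(1) \<open>v \<noteq> i\<close>] A by simp
    moreover have "total_cost W (emit_paired d v i bs') = W 0 v + W v i + W 0 i +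
        total_cost W (solo i (d i - 2)) + total_cost W (concat (map (\<lambda>b. solo b (d b)) bs'))"
      unfolding emit_paired_def using i W_sym[of i 0]
      by (simp add: total_cost_def group_cost_def)
    moreover have "total_cost W (concat (map (\<lambda>b. solo b (d b)) bs')) \<le> demand_radial bs'"
      by (rule cost_solos) (use bs 3 in auto)
    moreover have "W 0 i + total_cost W (solo i (d i - 2)) \<le> int (d i) * W 0 i"
      by (rule cost_solo(2)) (use i in auto)
    moreover have "demand_radial cyc = W 0 v + (int (d i) * W 0 i + demand_radial bs')"
      using split 3 by (simp add: demand_radial_def)
    ultimately show ?thesis unfolding e by linarith
  next
    case (4 v u us')
    then have e: "emit rot d cyc = emit_plain rot d us bs" for rot
      unfolding emit_def us_def[symmetric] bs_def[symmetric] by (simp add: Let_def)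
    have len: "2 \<le> length us" using 4 by simp
    have "length us \<le> length cyc" by (simp add: us_def)
    then have "A = closed cyc" using A len by simp
    moreover have "closed us \<le> closed cyc"
      using closed_filter[OF cyc(2), of "\<lambda>v. d v = 1"] 4 by (simp add: us_def)
    ultimately show ?thesis
      using chunk_rotate[OF len us] plain[of False] plain[of True] split unfolding e by simp
  qed
  then show ?thesis by (simp add: A_def)
qed

subsection \<open>Lower bound\<close>

lemma closed_walk_ge:
  assumes r: "r \<noteq> []" "hd r = 0" "last r = 0" "set r \<subseteq> {..n}" and x: "x \<in> set r" and y: "y \<in> set r"
  shows "W 0 x + W x y + W 0 y \<le> walk W r"
proof -
  have *: "W 0 x + W x y + W 0 y \<le> walk W r" if px: "r = p @ x # q" and yq: "y \<in> set (x # q)" for p q x y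
  proof -
    obtain p' q' where q: "x # q = p' @ y # q'" using split_list[OF yq] by blast
    have "set r = set p \<union> set (x # q)" "set r = set p \<union> (set p' \<union> insert y (set q'))"
      using px unfolding q by auto
    then have sub: "set p \<subseteq> {..n}" "set p' \<subseteq> {..n}" "set q' \<subseteq> {..n}" "x \<le> n" "y \<le> n"
      using r(4) by auto
    have "walk W r = walk W (p @ [x]) + walk W (x # q)"
      unfolding px by (rule walk_append)
    moreover have "walk W (x # q) = walk W (p' @ [y]) + walk W (y # q')"
      unfolding q by (rule walk_append)
    moreover have "W 0 x \<le> walk W (p @ [x])"
    proof -
      have "hd (p @ [x]) = 0" using r(2) unfolding px by (cases p) auto
      then show ?thesis using walk_ge_ends[of "p @ [x]"] sub by simp
    qed
    moreover have "W x y \<le> walk W (p' @ [y])"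
    proof -
      have "hd (p' @ [y]) = x" using arg_cong[OF q, of hd] by (cases p') auto
      then show ?thesis using walk_ge_ends[of "p' @ [y]"] sub by simp
    qed
    moreover have "last (y # q') = 0"
    proof -
      have "last r = last (x # q)" unfolding px by simp
      also have "\<dots> = last (y # q')" unfolding q by simp
      finally show ?thesis using r(3) by simp
    qed
    then have "W 0 y \<le> walk W (y # q')"
      using walk_ge_ends[of "y # q'"] sub W_sym[of y 0] by auto
    ultimately show ?thesis by simp
  qed
  obtain p q where p: "r = p @ x # q" using split_list[OF x] by blast
  show ?thesis
  proof (cases "y \<in> set (x # q)")
    case True
    then show ?thesis using * p by blast
  next
    case False
    then have "y \<in> set p" using y p by auto
    then obtain p1 p2 where p': "p = p1 @ y # p2" by (meson split_list)
    have "W 0 y + W y x + W 0 x \<le> walk W r"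
      by (intro *[of p1 y "p2 @ x # q" x]) (simp_all add: p p')
    moreover have "W x y = W y x"
      by (rule W_sym) (use x y r(4) in auto)
    ultimately show ?thesis by simp
  qed
qed

text \<open>The delivered units listed one by one and padded with the depot to exactly three. Every
  tour can thus be treated as a triangle, and functions vanishing at the depot ignore the
  padding.\<close>

lemma slots:
  assumes "finite A" "(\<Sum>v\<in>A. a v) \<le> (3 :: nat)"
  obtains x y z where "{x, y, z} \<subseteq> insert 0 {v \<in> A. 0 < a v}"
    "\<And>f :: nat \<Rightarrow> int. f 0 = 0 \<Longrightarrow> (\<Sum>v\<in>A. int (a v) * f v) = f x + f y + f z"
proof -
  have "\<exists>xs. length xs = (\<Sum>v\<in>A. a v) \<and> set xs \<subseteq> {v \<in> A. 0 < a v} \<and>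
      (\<forall>f :: nat \<Rightarrow> int. (\<Sum>v\<in>A. int (a v) * f v) = sum_list (map f xs))"
    using assms(1)
  proof (induction A)
    case (insert u A)
    then obtain xs where xs: "length xs = (\<Sum>v\<in>A. a v)" "set xs \<subseteq> {v \<in> A. 0 < a v}"
      "\<And>f :: nat \<Rightarrow> int. (\<Sum>v\<in>A. int (a v) * f v) = sum_list (map f xs)" by blast
    show ?case
      using insert.hyps xs
      by (intro exI[of _ "replicate (a u) u @ xs"]) (auto simp: sum_list_replicate)
  qed simp
  then obtain xs where len: "length xs = (\<Sum>v\<in>A. a v)" and xs: "set xs \<subseteq> {v \<in> A. 0 < a v}"
    "\<And>f :: nat \<Rightarrow> int. (\<Sum>v\<in>A. int (a v) * f v) = sum_list (map f xs)"
    by blast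
  consider "xs = []" | x where "xs = [x]" | x y where "xs = [x, y]" | x y z where "xs = [x, y, z]"
    using len assms(2) by (cases xs; cases "tl xs"; cases "tl (tl xs)"; cases "tl (tl (tl xs))") auto
  then show ?thesis
  proof cases
    case 1
    then show ?thesis using xs by (intro that[of 0 0 0]) auto
  next
    case (2 x)
    then show ?thesis using xs by (intro that[of x 0 0]) auto
  next
    case (3 x y)
    then show ?thesis using xs by (intro that[of x y 0]) auto
  next
    case (4 x y z)
    then show ?thesis using xs by (intro that[of x y z]) auto
  qed
qed

text \<open>\<open>b\<close> is the perimeter of the triangle, to be compared with the potentials of
  the unit customers on the tour. For three of them, the three edge inequalities add up to twice the
  claim; for two, twice their distance is at most the perimeter. A single one, \<open>v\<close>, can
  only be bounded jointly with another slot \<open>i\<close>, so this case is passed on as an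
  alternative; \<open>i\<close> may be the depot.\<close>

lemma tour_lower_bound:
  assumes r: "r \<noteq> []" "hd r = 0" "last r = 0" "set r \<subseteq> {..n}"
    and a: "\<And>v. 0 < a v \<Longrightarrow> v \<in> set r - {0}" "(\<Sum>v\<in>{1..n}. a v) \<le> 3"
    and p: "\<And>u v. u \<le> n \<Longrightarrow> v \<le> n \<Longrightarrow> u \<noteq> v \<Longrightarrow> p u + p v \<le> 2 * W u v"
    and unit: "\<And>v. 1 \<le> v \<Longrightarrow> v \<le> n \<Longrightarrow> d v = 1 \<Longrightarrow> a v \<le> 1"
  obtains b where "b + 2 * (\<Sum>v\<in>{1..n}. int (a v) * W 0 v) \<le> 3 * walk W r"
    "(\<Sum>v\<in>{1..n}. int (a v) * (if d v = 1 then p v else 0)) \<le> b \<or>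
     (\<exists>v i. 1 \<le> v \<and> v \<le> n \<and> d v = 1 \<and> a v = 1 \<and> i \<le> n \<and> d i \<noteq> 1 \<and> 2 * W i v \<le> b \<and>
       (\<Sum>v\<in>{1..n}. int (a v) * (if d v = 1 then p v else 0)) = p v)"
proof -
  obtain x y z where xyz: "{x, y, z} \<subseteq> insert 0 {v \<in> {1..n}. 0 < a v}"
    and sum: "\<And>f :: nat \<Rightarrow> int. f 0 = 0 \<Longrightarrow> (\<Sum>v\<in>{1..n}. int (a v) * f v) = f x + f y + f z"
    using slots[OF _ a(2)] by blast
  have "0 \<in> set r" using r by (metis hd_in_set)
  then have mem: "x \<in> set r" "y \<in> set r" "z \<in> set r" using xyz a(1) by auto
  then have le: "x \<le> n" "y \<le> n" "z \<le> n" using r(4) by auto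
  define b where "b = W x y + W y z + W z x"
  have "b + 2 * (W 0 x + W 0 y + W 0 z) \<le> 3 * walk W r"
    using closed_walk_ge[OF r mem(1,2)] closed_walk_ge[OF r mem(2,3)] closed_walk_ge[OF r mem(3,1)]
    by (simp add: b_def)
  then have 1: "b + 2 * (\<Sum>v\<in>{1..n}. int (a v) * W 0 v) \<le> 3 * walk W r"
    using sum[of "W 0"] W_diag by simp
  define P where "P = (\<Sum>v\<in>{1..n}. int (a v) * (if d v = 1 then p v else 0))"
  have P: "P = (if d x = 1 then p x else 0) + (if d y = 1 then p y else 0) + (if d z = 1 then p z else 0)"
    unfolding P_def by (rule sum[of "\<lambda>v. if d v = 1 then p v else 0"]) (simp add: d_0)
  have tri: "2 * W u v \<le> b" if "{u, v} \<subseteq> {x, y, z}" "u \<noteq> v" for u v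
  proof -
    have "W x y \<le> W x z + W z y" "W y z \<le> W y x + W x z" "W z x \<le> W z y + W y x"
      by (rule W_tri; simp add: le)+
    moreover have "W x z = W z x" "W z y = W y z" "W y x = W x y"
      by (rule W_sym; simp add: le)+
    ultimately have "2 * W x y \<le> b" "2 * W y z \<le> b" "2 * W z x \<le> b"
      "2 * W y x \<le> b" "2 * W z y \<le> b" "2 * W x z \<le> b" by (simp_all add: b_def)
    then show ?thesis using that by auto
  qed
  have b0: "0 \<le> b" using W_nonneg le by (simp add: b_def)
  have U: "1 \<le> v \<and> v \<le> n \<and> a v = 1" if "v \<in> {x, y, z}" "d v = 1" for v
  proof -
    have "v \<noteq> 0" using that(2) d_0 by (metis zero_neq_one)
    then have "1 \<le> v" "v \<le> n" "0 < a v" using that(1) xyz by auto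
    then show ?thesis using unit[of v] that(2) by simp
  qed
  \<comment> \<open>Applied to the indicator of \<open>v\<close>, the slot identity says that a
    customer of demand 1 occupies exactly one slot.\<close>
  have distinct: False if "d v = 1" "(x = v \<and> y = v) \<or> (y = v \<and> z = v) \<or> (z = v \<and> x = v)" for v
  proof -
    have v: "v \<in> {1..n}" "a v = 1" "v \<noteq> 0" using U[of v] that by auto
    have "(\<Sum>u\<in>{1..n}. int (a u) * (if u = v then 1 else 0)) = (\<Sum>u\<in>{1..n}. if u = v then 1 else 0)"
      by (rule sum.cong) (auto simp: v)
    also have "\<dots> = 1" using v by simp
    finally show False using sum[of "\<lambda>u. if u = v then 1 else 0"] that(2) v by (auto split: if_splits)
  qed
  have two: "p u + p v \<le> b" if "{u, v} \<subseteq> {x, y, z}" "u \<noteq> v" for u v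
    using tri[OF that] p[of u v] that le by auto
  have host: "\<exists>v i. 1 \<le> v \<and> v \<le> n \<and> d v = 1 \<and> a v = 1 \<and> i \<le> n \<and> d i \<noteq> 1 \<and> 2 * W i v \<le> b \<and> P = p v"
    if "{v, i} \<subseteq> {x, y, z}" "d v = 1" "d i \<noteq> 1" "P = p v" for v i
    using U[of v] tri[of i v] that le by (intro exI[of _ v] exI[of _ i]) auto
  have "P \<le> b \<or> (\<exists>v i. 1 \<le> v \<and> v \<le> n \<and> d v = 1 \<and> a v = 1 \<and> i \<le> n \<and> d i \<noteq> 1 \<and> 2 * W i v \<le> b \<and> P = p v)"
  proof (cases "d x = 1"; cases "d y = 1"; cases "d z = 1")
    assume d: "d x = 1" "d y = 1" "d z = 1"
    then have "x \<noteq> y" "y \<noteq> z" "z \<noteq> x" using distinct by blast+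
    then have "p x + p y \<le> 2 * W x y" "p y + p z \<le> 2 * W y z" "p z + p x \<le> 2 * W z x"
      using p le by simp_all
    then show ?thesis using P d by (simp add: b_def)
  next
    assume d: "d x = 1" "d y = 1" "d z \<noteq> 1"
    then have "x \<noteq> y" using distinct by blast
    then show ?thesis using two[of x y] P d by simp
  next
    assume d: "d x = 1" "d y \<noteq> 1" "d z = 1"
    then have "x \<noteq> z" using distinct by blast
    then show ?thesis using two[of x z] P d by simp
  next
    assume d: "d x \<noteq> 1" "d y = 1" "d z = 1"
    then have "y \<noteq> z" using distinct by blast
    then show ?thesis using two[of y z] P d by simp
  next
    assume d: "d x = 1" "d y \<noteq> 1" "d z \<noteq> 1"
    then show ?thesis using host[of x y] P by simp
  next
    assume d: "d x \<noteq> 1" "d y = 1" "d z \<noteq> 1"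
    then show ?thesis using host[of y x] P by simp
  next
    assume d: "d x \<noteq> 1" "d y \<noteq> 1" "d z = 1"
    then show ?thesis using host[of z x] P by simp
  next
    assume d: "d x \<noteq> 1" "d y \<noteq> 1" "d z \<noteq> 1"
    then show ?thesis using P b0 by simp
  qed
  with 1 show ?thesis using that unfolding P_def by blast
qed

text \<open>
  \<open>p\<close> is the sum of the row and column potentials. A tour whose only unit demand \<open>v\<close> shares it
  with a vertex \<open>i\<close> of other demand may violate its bound only if \<open>p v\<close> exceeds \<open>2 * W i v\<close>;
  different such tours have different \<open>i\<close>, and \<open>p i \<le> 0\<close> pays for the violation.
\<close>

lemma lower_bound:
  assumes tours: "\<And>r a. (r, a) \<in> set Ts \<Longrightarrow> r \<noteq> [] \<and> hd r = 0 \<and> last r = 0 \<and> set r \<subseteq> {..n} \<and>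
      (\<forall>v. 0 < a v \<longrightarrow> v \<in> set r - {0}) \<and> (\<Sum>v\<in>{1..n}. a v) \<le> 3"
    and sat: "\<And>v. 1 \<le> v \<Longrightarrow> v \<le> n \<Longrightarrow> (\<Sum>T\<leftarrow>Ts. snd T v) = d v"
    and p: "\<And>u v. u \<le> n \<Longrightarrow> v \<le> n \<Longrightarrow> p u + p v \<le> 2 * assign_cost u v"
  shows "(\<Sum>v\<le>n. p v) + 2 * (\<Sum>v\<in>{1..n}. int (d v) * W 0 v) \<le> 3 * (\<Sum>T\<leftarrow>Ts. walk W (fst T))"
proof -
  define K where "K = {..<length Ts}"
  define a where "a k = snd (Ts ! k)" for k
  define P where "P k = (\<Sum>v\<in>{1..n}. int (a k v) * (if d v = 1 then p v else 0))" for k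
  define D where "D k = (\<Sum>v\<in>{1..n}. int (a k v) * W 0 v)" for k
  have pW: "p u + p v \<le> 2 * W u v" if "u \<le> n" "v \<le> n" "u \<noteq> v" for u v
    using p[OF that(1,2)] that(3) by (simp add: assign_cost_def)
  have sat': "(\<Sum>k\<in>K. a k v) = d v" if "1 \<le> v" "v \<le> n" for v
    using sat[OF that] by (simp add: K_def a_def sum_list_sum_nth atLeast0LessThan)
  have a_le: "a k v \<le> 1" if "k \<in> K" "1 \<le> v" "v \<le> n" "d v = 1" for k v
    using sat'[OF that(2,3)] that(1,4) member_le_sum[of k K "\<lambda>k. a k v"] by (simp add: K_def)
  have "\<exists>b. b + 2 * D k \<le> 3 * walk W (fst (Ts ! k)) \<and> (P k \<le> b \<or>
     (\<exists>v i. 1 \<le> v \<and> v \<le> n \<and> d v = 1 \<and> a k v = 1 \<and> i \<le> n \<and> d i \<noteq> 1 \<and> 2 * W i v \<le> b \<and> P k = p v))"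
    if k: "k \<in> K" for k
  proof -
    have T: "(fst (Ts ! k), a k) \<in> set Ts" using k by (simp add: K_def a_def)
    note t = tours[OF T]
    show ?thesis
      by (rule tour_lower_bound[of "fst (Ts ! k)" "a k" p])
        (use t pW a_le[OF k] in \<open>auto simp: P_def D_def\<close>)
  qed
  then obtain b where b: "\<And>k. k \<in> K \<Longrightarrow> b k + 2 * D k \<le> 3 * walk W (fst (Ts ! k))"
    and "\<And>k. k \<in> K \<Longrightarrow> P k \<le> b k \<or>
     (\<exists>v i. 1 \<le> v \<and> v \<le> n \<and> d v = 1 \<and> a k v = 1 \<and> i \<le> n \<and> d i \<noteq> 1 \<and> 2 * W i v \<le> b k \<and> P k = p v)"
    by metis
  then obtain v i where vi: "\<And>k. k \<in> K \<Longrightarrow> \<not> P k \<le> b k \<Longrightarrow> 1 \<le> v k \<and> v k \<le> n \<and> d (v k) = 1 \<and>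
      a k (v k) = 1 \<and> i k \<le> n \<and> d (i k) \<noteq> 1 \<and> 2 * W (i k) (v k) \<le> b k \<and> P k = p (v k)"
    by metis
  define B where "B = {k \<in> K. \<not> P k \<le> b k}"
  have fin: "finite K" "finite B" by (auto simp: K_def B_def)
  have B: "k \<in> K" "1 \<le> v k" "v k \<le> n" "d (v k) = 1" "a k (v k) = 1" "i k \<le> n" "d (i k) \<noteq> 1"
    "2 * W (i k) (v k) \<le> b k" "P k = p (v k)" "b k < p (v k)" if "k \<in> B" for k
    using vi[of k] that by (auto simp: B_def)
  \<comment> \<open>If two exceptional tours shared their host, going through it would bound the
    distance of their unit customers, and the inequality for this pair would contradict the two
    excesses.\<close>
  have inj: "inj_on i B"
  proof (rule inj_onI, rule ccontr)
    fix k l assume kl: "k \<in> B" "l \<in> B" "i k = i l" "k \<noteq> l"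
    have "v k \<noteq> v l"
    proof
      assume eq: "v k = v l"
      have "a k (v k) + a l (v k) = (\<Sum>j\<in>{k, l}. a j (v k))" using kl by simp
      also have "\<dots> \<le> (\<Sum>j\<in>K. a j (v k))" using kl B(1) by (intro sum_mono2 fin) auto
      finally show False using sat'[of "v k"] B[OF kl(1)] B[OF kl(2)] eq by simp
    qed
    then have "p (v k) + p (v l) \<le> 2 * W (v k) (v l)" using pW B kl by simp
    also have "\<dots> \<le> 2 * (W (v k) (i k) + W (i k) (v l))"
      using W_tri[of "v k" "i k" "v l"] B kl by simp
    also have "\<dots> = 2 * W (i k) (v k) + 2 * W (i l) (v l)"
      using W_sym[of "v k" "i k"] B kl by simp
    finally show False using B(8,10)[OF kl(1)] B(8,10)[OF kl(2)] by simp
  qed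
  \<comment> \<open>The depot and the customers of larger demand. Their free diagonal forces
    \<open>p j \<le> 0\<close>, so those that host no exceptional tour may be dropped from an upper
    bound.\<close>
  let ?Q = "{j. j \<le> n \<and> d j \<noteq> 1}"
  have p_le: "p j \<le> 0" if "j \<in> ?Q" for j
    using p[of j j] that by (simp add: assign_cost_def)
  have "i ` B \<subseteq> ?Q" using B(6,7) by auto
  then have "(\<Sum>j\<in>?Q. p j) = (\<Sum>j\<in>?Q - i ` B. p j) + (\<Sum>j\<in>i ` B. p j)"
    by (intro sum.subset_diff) auto
  also have "\<dots> \<le> (\<Sum>j\<in>i ` B. p j)"
    using sum_nonpos[of "?Q - i ` B" p] p_le by simp
  also have "\<dots> = (\<Sum>k\<in>B. p (i k))"
    using sum.reindex[OF inj] by simp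
  also have "\<dots> = (\<Sum>k\<in>K. if k \<in> B then p (i k) else 0)"
    by (simp add: sum.If_cases fin B_def Int_def)
  finally have Q: "(\<Sum>j\<in>?Q. p j) \<le> (\<Sum>k\<in>K. if k \<in> B then p (i k) else 0)" .
  have "P k + (if k \<in> B then p (i k) else 0) \<le> b k" if "k \<in> K" for k
  proof (cases "k \<in> B")
    case True
    then have "i k \<noteq> v k" using B(4,7) by metis
    then show ?thesis using pW[of "i k" "v k"] B[OF True] True by simp
  qed (use that in \<open>simp add: B_def\<close>)
  then have "(\<Sum>k\<in>K. P k + (if k \<in> B then p (i k) else 0)) \<le> (\<Sum>k\<in>K. b k)"
    by (rule sum_mono)
  then have PQ: "(\<Sum>k\<in>K. P k) + (\<Sum>j\<in>?Q. p j) \<le> (\<Sum>k\<in>K. b k)"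
    using Q by (simp add: sum.distrib)
  have swap: "(\<Sum>k\<in>K. \<Sum>v\<in>{1..n}. int (a k v) * f v) = (\<Sum>v\<in>{1..n}. int (d v) * f v)" for f :: "nat \<Rightarrow> int"
  proof -
    have "(\<Sum>k\<in>K. \<Sum>v\<in>{1..n}. int (a k v) * f v) = (\<Sum>v\<in>{1..n}. (\<Sum>k\<in>K. int (a k v)) * f v)"
      by (subst sum.swap) (simp add: sum_distrib_right)
    also have "\<dots> = (\<Sum>v\<in>{1..n}. int (d v) * f v)"
      using sat' by (intro sum.cong) (simp_all flip: of_nat_sum)
    finally show ?thesis .
  qed
  have "(\<Sum>k\<in>K. P k) = (\<Sum>v\<in>{1..n}. int (d v) * (if d v = 1 then p v else 0))"
    unfolding P_def by (rule swap)
  also have "\<dots> = (\<Sum>v\<in>{1..n}. if d v = 1 then p v else 0)"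
    by (intro sum.cong) auto
  also have "\<dots> = (\<Sum>v\<in>{v \<in> {1..n}. d v = 1}. p v)"
    by (simp add: sum.If_cases Int_def)
  finally have Psum: "(\<Sum>k\<in>K. P k) = (\<Sum>v\<in>{v \<in> {1..n}. d v = 1}. p v)" .
  have "{..n} = {v \<in> {1..n}. d v = 1} \<union> ?Q"
  proof -
    have "1 \<le> v" if "d v = 1" for v using that d_0 by (cases "v = 0") auto
    then show ?thesis by auto
  qed
  then have "(\<Sum>v\<le>n. p v) = (\<Sum>v\<in>{v \<in> {1..n}. d v = 1}. p v) + (\<Sum>j\<in>?Q. p j)"
    by (simp only:) (rule sum.union_disjoint; auto)
  then have "(\<Sum>v\<le>n. p v) \<le> (\<Sum>k\<in>K. b k)" using Psum PQ by simp
  moreover have "(\<Sum>k\<in>K. b k + 2 * D k) \<le> (\<Sum>k\<in>K. 3 * walk W (fst (Ts ! k)))"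
    using b by (rule sum_mono)
  moreover have "(\<Sum>k\<in>K. D k) = (\<Sum>v\<in>{1..n}. int (d v) * W 0 v)"
    unfolding D_def by (rule swap)
  moreover have "(\<Sum>k\<in>K. walk W (fst (Ts ! k))) = (\<Sum>T\<leftarrow>Ts. walk W (fst T))"
    by (simp add: K_def sum_list_sum_nth atLeast0LessThan)
  ultimately show ?thesis by (simp add: sum.distrib sum_distrib_left[symmetric])
qed

end

subsection \<open>Cycles of a permutation\<close>

text \<open>The elements of \<open>idx\<close> only limit the number of iterations. Each entry of
  the result is the image of the next one, so with \<open>f\<close> sending columns to rows the list
  runs along the edges from \<open>f v\<close> to \<open>v\<close> that the assignment pays
  for.\<close>

definition orbit :: "nat list \<Rightarrow> nat list \<Rightarrow> nat \<Rightarrow> nat list" where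
  "orbit idx S v = fold (\<lambda>_ acc. case acc of [] \<Rightarrow> acc
     | a # l \<Rightarrow> if nth_default 0 S a = v then acc else nth_default 0 S a # acc) idx [v]"

definition cycles :: "nat list \<Rightarrow> nat list \<Rightarrow> nat list list" where
  "cycles idx S = fold (\<lambda>v cs. if v \<in> set (concat cs) then cs else orbit idx S v # cs) idx []"

abbreviation chain :: "(nat \<Rightarrow> nat) \<Rightarrow> nat list \<Rightarrow> bool" where
  "chain f \<equiv> successively (\<lambda>x y. f y = x)"

definition is_cycle :: "(nat \<Rightarrow> nat) \<Rightarrow> nat list \<Rightarrow> bool" where
  "is_cycle f c \<longleftrightarrow> c \<noteq> [] \<and> distinct c \<and> chain f c \<and> f (hd c) = last c"

lemma chain_next: "chain f xs \<Longrightarrow> x \<in> set xs \<Longrightarrow> x \<noteq> last xs \<Longrightarrow> \<exists>y\<in>set (tl xs). f y = x"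
  by (induction xs rule: induct_list012) auto

text \<open>An injective map cannot enter a set \<open>V\<close> that it maps onto itself: if
  \<open>f y\<close> lies in \<open>V\<close>, it is also the image of a point of \<open>V\<close>,
  which must be \<open>y\<close>. Hence a new orbit is disjoint from the cycles found
  before.\<close>

lemma chain_avoids:
  assumes "inj_on f A" "f ` V = V" "V \<subseteq> A"
  shows "chain f xs \<Longrightarrow> set xs \<subseteq> A \<Longrightarrow> xs \<noteq> [] \<Longrightarrow> last xs \<notin> V \<Longrightarrow> set xs \<inter> V = {}"
proof (induction xs rule: induct_list012)
  case (3 x y zs)
  have "x \<notin> V"
  proof
    assume "x \<in> V"
    then obtain y' where "y' \<in> V" "x = f y'" using assms(2) by blast
    moreover have "f y = x" "y \<in> A" using 3 by auto
    ultimately have "y \<in> V" using assms(1,3) by (metis inj_onD subsetD)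
    then show False using 3 by auto
  qed
  then show ?case using 3 by auto
qed auto

lemma cycle_image:
  assumes "is_cycle f c"
  shows "f ` set c = set c"
proof
  have "f x \<in> set c" if "x \<in> set (tl c)" "chain f c" for x c
    using that by (induction c rule: induct_list012) auto
  moreover have "set c = insert (hd c) (set (tl c))" "last c \<in> set c"
    using assms by (cases c; simp add: is_cycle_def)+
  ultimately show "f ` set c \<subseteq> set c"
    using assms by (auto simp: is_cycle_def)
  show "set c \<subseteq> f ` set c"
  proof
    fix x assume x: "x \<in> set c"
    show "x \<in> f ` set c"
    proof (cases "x = last c")
      case True
      then show ?thesis using assms by (metis hd_in_set imageI is_cycle_def)
    next
      case False
      then obtain y where "y \<in> set (tl c)" "f y = x"
        using chain_next[of f c x] x assms by (auto simp: is_cycle_def)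
      then show ?thesis using assms by (metis image_eqI is_cycle_def list.set_sel(2))
    qed
  qed
qed

lemma walk_chain:
  "chain f (x # xs @ [z]) \<Longrightarrow> walk w (x # xs @ [z]) = sum_list (map (\<lambda>v. w (f v) v) (xs @ [z]))"
  by (induction xs arbitrary: x) auto

lemma walk_cycle:
  assumes "is_cycle f c"
  shows "walk w (c @ [hd c]) = sum_list (map (\<lambda>v. w (f v) v) c)"
proof -
  obtain x xs where c: "c = x # xs" using assms by (cases c) (auto simp: is_cycle_def)
  have "chain f (c @ [hd c])"
    using assms by (auto simp: is_cycle_def successively_append_iff)
  then show ?thesis
    using walk_chain[of f x xs x w] by (simp add: c add.commute)
qed

context
  fixes N :: nat and S :: "nat list" and f :: "nat \<Rightarrow> nat"
  defines "f \<equiv> nth_default 0 S"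
  assumes f_lt: "\<And>v. v < N \<Longrightarrow> f v < N" and f_inj: "inj_on f {..<N}"
begin

text \<open>By injectivity the first repeated vertex of the iteration is the start \<open>v\<close>.
  If it were not met within \<open>N\<close> steps, the list would contain \<open>N + 1\<close>
  distinct vertices below \<open>N\<close>.\<close>

lemma orbit_cycle:
  assumes v: "v < N"
  shows "is_cycle f (orbit [0..<N] S v) \<and> set (orbit [0..<N] S v) \<subseteq> {..<N} \<and> last (orbit [0..<N] S v) = v"
proof -
  let ?step = "\<lambda>_ acc. case acc of [] \<Rightarrow> acc | a # l \<Rightarrow> if f a = v then acc else f a # acc"
  have "fold ?step ys [v] \<noteq> [] \<and> distinct (fold ?step ys [v]) \<and> chain f (fold ?step ys [v]) \<and>
      last (fold ?step ys [v]) = v \<and> set (fold ?step ys [v]) \<subseteq> {..<N} \<and>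
      (f (hd (fold ?step ys [v])) = v \<or> length (fold ?step ys [v]) = Suc (length ys))" for ys :: "nat list"
  proof (induction ys rule: rev_induct)
    case (snoc y ys)
    then obtain a l where al: "fold ?step ys [v] = a # l" by (cases "fold ?step ys [v]") auto
    have IH: "distinct (a # l)" "chain f (a # l)" "last (a # l) = v" "set (a # l) \<subseteq> {..<N}"
      "f a = v \<or> length (a # l) = Suc (length ys)" using snoc unfolding al by auto
    show ?case
    proof (cases "f a = v")
      case True
      then show ?thesis using snoc al by simp
    next
      case False
      have "f a \<notin> set (a # l)"
      proof
        assume "f a \<in> set (a # l)"
        then obtain y where "y \<in> set l" "f y = f a"
          using chain_next[OF IH(2), of "f a"] False IH(3) by auto
        moreover have "a < N" "y < N" using IH(4) \<open>y \<in> set l\<close> by auto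
        ultimately have "y = a" using f_inj by (auto dest: inj_onD)
        then show False using \<open>y \<in> set l\<close> IH(1) by simp
      qed
      then show ?thesis using IH False f_lt al by simp
    qed
  qed (use v in auto)
  from this[of "[0..<N]"] have *: "orbit [0..<N] S v \<noteq> []" "distinct (orbit [0..<N] S v)"
    "chain f (orbit [0..<N] S v)" "last (orbit [0..<N] S v) = v" "set (orbit [0..<N] S v) \<subseteq> {..<N}"
    "f (hd (orbit [0..<N] S v)) = v \<or> length (orbit [0..<N] S v) = Suc N"
    unfolding orbit_def f_def by auto
  moreover have "length (orbit [0..<N] S v) \<le> N"
    using card_mono[OF _ *(5)] distinct_card[OF *(2)] by simp
  ultimately show ?thesis by (auto simp: is_cycle_def)
qed

lemma cycles_partition:
  "distinct (concat (cycles [0..<N] S)) \<and> set (concat (cycles [0..<N] S)) = {..<N} \<and>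
   (\<forall>c\<in>set (cycles [0..<N] S). is_cycle f c)"
proof -
  let ?step = "\<lambda>v cs. if v \<in> set (concat cs) then cs else orbit [0..<N] S v # cs"
  have "distinct (concat (fold ?step ys [])) \<and> set ys \<subseteq> set (concat (fold ?step ys [])) \<and>
     set (concat (fold ?step ys [])) \<subseteq> {..<N} \<and> (\<forall>c\<in>set (fold ?step ys []). is_cycle f c)"
    if "set ys \<subseteq> {..<N}" for ys
    using that
  proof (induction ys rule: rev_induct)
    case (snoc v ys)
    define cs where "cs = fold ?step ys []"
    have IH: "distinct (concat cs)" "set ys \<subseteq> set (concat cs)" "set (concat cs) \<subseteq> {..<N}"
      "\<forall>c\<in>set cs. is_cycle f c"
      using snoc unfolding cs_def by auto
    have step: "fold ?step (ys @ [v]) [] = ?step v cs" by (simp add: cs_def)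
    show ?case
    proof (cases "v \<in> set (concat cs)")
      case True
      then show ?thesis using IH unfolding step by auto
    next
      case False
      have v: "v < N" using snoc.prems by simp
      note o = orbit_cycle[OF v]
      have "f ` set (concat cs) = set (concat cs)"
        using IH(4) cycle_image by (simp add: image_Union image_image)
      then have "set (orbit [0..<N] S v) \<inter> set (concat cs) = {}"
        using chain_avoids[OF f_inj _ IH(3), of "orbit [0..<N] S v"] o False
        by (auto simp: is_cycle_def)
      moreover have "v \<in> set (orbit [0..<N] S v)" using o last_in_set by (metis is_cycle_def)
      ultimately show ?thesis using IH False o unfolding step by (auto simp: is_cycle_def)
    qed
  qed auto
  from this[of "[0..<N]"] show ?thesis unfolding cycles_def by (auto simp: atLeast0LessThan)
qed

end

subsection \<open>The algorithm\<close>

lemma ptime_diff_nat [ptime]: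
  assumes "ptime f" "ptime g"
  shows "ptime (\<lambda>x. f x - g x :: nat)"
proof (rule ptime_of_int)
  have "ptime (\<lambda>x. if f x < g x then 0 else int (f x) - int (g x))"
    by (intro ptime assms)
  then show "ptime (\<lambda>x. int (f x - g x))"
    by (rule back_subst[of ptime]) auto
qed

lemma ptime_sum_list_int [ptime]:
  assumes "ptime f"
  shows "ptime (\<lambda>x. sum_list (f x) :: int)"
proof -
  have *: "fold (\<lambda>e s. s + e) xs s = s + sum_list xs" for xs and s :: int
    by (induction xs arbitrary: s) auto
  have "ptime (\<lambda>x. fold (\<lambda>e s. s + e) (f x) 0)"
  proof (rule ptime_fold_add[where r = "[:0, 1:]"])
    fix x :: 'a and e s :: int
    show "size_of (s + e) \<le> size_of s + poly [:0, 1:] (size_of x + size_of e)"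
      using size_Num_arith(1)[of s e] by simp
  qed (intro ptime assms)+
  then show ?thesis by (simp add: *)
qed

lemma ptime_sum_list_nat [ptime]:
  assumes "ptime f"
  shows "ptime (\<lambda>x. sum_list (f x) :: nat)"
proof (rule ptime_of_int)
  have *: "int (sum_list xs) = sum_list (map int xs)" for xs
    by (induction xs) auto
  show "ptime (\<lambda>x. int (sum_list (f x)))"
    unfolding * by (intro ptime assms)
qed

lemma size_nth_default_le: "size_of (nth_default d xs i) \<le> size_of d + size_of xs"
  using size_mem_le[of "xs ! i" xs] by (auto simp: nth_default_def intro: le_trans)

lemma ptime_walk [ptime]:
  assumes "ptime W" "ptime xs"
  shows "ptime (\<lambda>x. walk (entry (W x)) (xs x))"
proof -
  have *: "snd (fold (\<lambda>e s. (e, snd s + entry c (fst s) e)) l (a, k)) = k + walk (entry c) (a # l)" for c a k l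
    by (induction l arbitrary: a k) auto
  have "ptime (\<lambda>y. snd (fold (\<lambda>e s. (e, snd s + entry (fst y) (fst s) e)) (snd (snd y)) (fst (snd y), 0)))"
  proof (rule ptime_snd, rule ptime_fold_add[where r = "[:2, 2:]"])
    fix y :: "int list list \<times> nat \<times> nat list" and e :: nat and s :: "nat \<times> int"
    have "size_of (entry (fst y) (fst s) e) \<le> 2 + size_of (fst y)"
      using size_nth_default_le[of "0 :: int" "nth_default [] (fst y) (fst s)" e]
        size_nth_default_le[of "[]" "fst y" "fst s"] unfolding entry_def
      by (cases "fst s < length (fst y)")
        (auto simp: nth_default_def dest!: nth_mem size_mem_le)
    then show "size_of (e, snd s + entry (fst y) (fst s) e) \<le> size_of s + poly [:2, 2:] (size_of y + size_of e)"
      using size_Num_arith(1)[of "snd s" "entry (fst y) (fst s) e"] bit_size_pos[of "enc (fst s)"]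
      by (cases y; cases s) auto
  qed (intro ptime)+
  note w = ptime_comp[OF _ this, unfolded *]
  have "ptime (\<lambda>x. case xs x of [] \<Rightarrow> 0 | a # l \<Rightarrow> 0 + walk (entry (W x)) (a # l))"
    by (intro ptime assms w[of "\<lambda>p. (W (fst p), fst (snd p), snd (snd p))", simplified] ptime_comp[OF _ assms(1)])
  then show ?thesis
    by (rule back_subst[of ptime]) (auto split: list.split)
qed

lemma ptime_pairs [ptime]:
  assumes "ptime xs"
  shows "ptime (\<lambda>x. pairs (xs x))"
proof -
  \<comment> \<open>The option holds an element that is waiting for its partner; a last one without
    partner is dropped, as in \<open>pairs\<close>.\<close>
  let ?h = "\<lambda>e s. case fst s of None \<Rightarrow> (Some e, snd s) | Some a \<Rightarrow> (None, [a, e] # snd s)"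
  have *: "rev (snd (fold ?h l (None, acc))) = rev acc @ pairs l" for l and acc :: "'b list list"
    by (induction l arbitrary: acc rule: pairs.induct) auto
  have "ptime (\<lambda>x. rev (snd (fold ?h (xs x) (None, []))))"
  proof (rule ptime_rev, rule ptime_snd, rule ptime_fold_add[where r = "[:6, 1:]"])
    fix x :: 'a and e :: 'b and s :: "'b option \<times> 'b list list"
    show "size_of (?h e s) \<le> size_of s + poly [:6, 1:] (size_of x + size_of e)"
      by (cases s; cases "fst s") auto
  qed (intro ptime assms)+
  then show ?thesis by (simp add: *)
qed

lemma ptime_even [ptime]: "ptime f \<Longrightarrow> ptime (\<lambda>x. even (f x :: nat))"
  unfolding even_iff_mod_2_eq_zero by (intro ptime)

lemma ptime_chunk [ptime]: "ptime us \<Longrightarrow> ptime (\<lambda>x. chunk (us x))"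
  by (rule ptime_comp[of us "\<lambda>us. chunk us"], assumption, unfold chunk_def) (intro ptime)

lemma ptime_rotate1 [ptime]:
  assumes "ptime us" shows "ptime (\<lambda>x. rotate1 (us x))"
proof -
  have "ptime (\<lambda>x. case us x of [] \<Rightarrow> [] | a # l \<Rightarrow> l @ [a])"
    by (intro ptime assms)
  then show ?thesis by (rule back_subst[of ptime]) (auto split: list.split)
qed

lemma ptime_solo [ptime]: "ptime i \<Longrightarrow> ptime e \<Longrightarrow> ptime (\<lambda>x. solo (i x) (e x))"
  unfolding solo_def by (intro ptime)

lemma ptime_emit_plain [ptime]:
  assumes "ptime rot" "ptime dl" "ptime us" "ptime bs"
  shows "ptime (\<lambda>x. emit_plain (rot x) (nth_default 0 (dl x)) (us x) (bs x))"
proof -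
  have "ptime (\<lambda>(rot, dl, us, bs). emit_plain rot (nth_default 0 dl) us bs)"
    unfolding emit_plain_def case_prod_beta by (intro ptime)
  from ptime_comp[OF _ this, of "\<lambda>x. (rot x, dl x, us x, bs x)"] show ?thesis
    using assms by (simp add: ptime)
qed

lemma ptime_emit_paired [ptime]:
  assumes "ptime dl" "ptime v" "ptime i" "ptime bs"
  shows "ptime (\<lambda>x. emit_paired (nth_default 0 (dl x)) (v x) (i x) (bs x))"
proof -
  have "ptime (\<lambda>(dl, v, i, bs). emit_paired (nth_default 0 dl) v i bs)"
    unfolding emit_paired_def case_prod_beta by (intro ptime)
  from ptime_comp[OF _ this, of "\<lambda>x. (dl x, v x, i x, bs x)"] show ?thesis
    using assms by (simp add: ptime)
qed

lemma ptime_emit [ptime]: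
  assumes "ptime rot" "ptime dl" "ptime cyc"
  shows "ptime (\<lambda>x. emit (rot x) (nth_default 0 (dl x)) (cyc x))"
proof -
  have "ptime (\<lambda>(rot, dl, cyc). emit rot (nth_default 0 dl) cyc)"
    unfolding emit_def case_prod_beta by (intro ptime)
  from ptime_comp[OF _ this, of "\<lambda>x. (rot x, dl x, cyc x)"] show ?thesis
    using assms by (simp add: ptime)
qed

lemma ptime_orbit [ptime]:
  assumes "ptime idx" "ptime S" "ptime v"
  shows "ptime (\<lambda>x. orbit (idx x) (S x) (v x))"
proof -
  have "ptime (\<lambda>(idx, S, v). orbit idx S v)"
    unfolding orbit_def case_prod_beta
  proof (rule ptime_fold_add[where r = "[:4, 1:]"])
    fix x :: "nat list \<times> nat list \<times> nat" and e :: nat and s :: "nat list"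
    show "size_of (case s of [] \<Rightarrow> s | a # l \<Rightarrow> if nth_default 0 (fst (snd x)) a = snd (snd x) then s
        else nth_default 0 (fst (snd x)) a # s) \<le> size_of s + poly [:4, 1:] (size_of x + size_of e)"
      using size_nth_default_le[of "0 :: nat" "fst (snd x)" "hd s"]
      by (cases x; cases s) auto
  qed (intro ptime)+
  from ptime_comp[OF _ this, of "\<lambda>x. (idx x, S x, v x)"] show ?thesis
    using assms by (simp add: ptime)
qed

lemma ptime_cycles [ptime]:
  assumes "ptime idx" "ptime S"
  shows "ptime (\<lambda>x. cycles (idx x) (S x))"
proof -
  have "ptime (\<lambda>(idx, S, v). orbit idx S v)"
    unfolding case_prod_beta by (intro ptime)
  then obtain q where q: "\<And>x. size_of (case x of (idx, S, v) \<Rightarrow> orbit idx S v) \<le> poly q (size_of x)"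
    using ptime_size by blast
  have "ptime (\<lambda>(idx, S). cycles idx S)"
    unfolding cycles_def case_prod_beta
  proof (rule ptime_fold_add[where r = "[:1:] + pcompose q [:1, 1:]"])
    fix x :: "nat list \<times> nat list" and e :: nat and s :: "nat list list"
    show "size_of (if e \<in> set (concat s) then s else orbit (fst x) (snd x) e # s)
        \<le> size_of s + poly ([:1:] + pcompose q [:1, 1:]) (size_of x + size_of e)"
    proof -
      have "size_of (orbit (fst x) (snd x) e) \<le> poly q (1 + (size_of x + size_of e))"
        using le_poly_trans[OF q[of "(fst x, snd x, e)"], of "1 + (size_of x + size_of e)"]
        by (cases x) simp
      then show ?thesis by (simp add: poly_pcompose)
    qed
  qed (intro ptime)+
  from ptime_comp[OF _ this, of "\<lambda>x. (idx x, S x)"] show ?thesis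
    using assms by (simp add: ptime)
qed

lemma ptime_amount [ptime]:
  assumes "ptime g" "ptime v"
  shows "ptime (\<lambda>x. amount (g x) (v x))"
proof -
  have "ptime (\<lambda>p. amount (fst p) (snd p))"
    unfolding amount_def by (intro ptime)
  then show ?thesis by (rule ptime_comp2[OF _ assms])
qed

lemma ptime_total_cost [ptime]:
  assumes "ptime W" "ptime ms"
  shows "ptime (\<lambda>x. total_cost (entry (W x)) (ms x))"
proof -
  have "ptime (\<lambda>p. total_cost (entry (fst p)) (snd p))"
    unfolding total_cost_def group_cost_def by (intro ptime)
  then show ?thesis by (rule ptime_comp2[OF _ assms])
qed

text \<open>Any common multiple serves to make the weights integral. The product is small enough,
  because bit sizes add up under multiplication.\<close>

definition denominator :: "(int \<times> int) list list \<Rightarrow> int" where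
  "denominator ws = fold (\<lambda>e s. s * snd e) (concat ws) 1"

definition scale :: "(int \<times> int) list list \<Rightarrow> int list list" where
  "scale ws = map (\<lambda>row. map (\<lambda>e. fst e * (denominator ws div snd e)) row) ws"

definition cost_matrix :: "nat list \<Rightarrow> nat list \<Rightarrow> int list list \<Rightarrow> int list list" where
  "cost_matrix idx dl W = map (\<lambda>u. map (\<lambda>v.
     if u = v then (if nth_default 0 dl u = 1 then 2 * entry W 0 u else 0) else entry W u v) idx) idx"

definition assignment :: "nat list \<Rightarrow> int list list \<Rightarrow> nat list" where
  "assignment idx c = map (\<lambda>m. case m of None \<Rightarrow> 0 | Some u \<Rightarrow> u) (fst (hungarian idx c))"

definition solution :: "bool \<Rightarrow> nat list \<Rightarrow> nat list list \<Rightarrow> (nat \<times> group) list" where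
  "solution rot dl cs = concat (map (\<lambda>c. emit rot (nth_default 0 dl) c) cs)"

definition cheaper :: "int list list \<Rightarrow> (nat \<times> group) list \<Rightarrow> (nat \<times> group) list \<Rightarrow> (nat \<times> group) list" where
  "cheaper W A B = (if total_cost (entry W) A < total_cost (entry W) B then A else B)"

definition groups :: "nat list \<Rightarrow> int list list \<Rightarrow> (nat \<times> group) list" where
  "groups dl W = (let idx = [0..<length dl];
       cs = cycles idx (assignment idx (cost_matrix idx dl W))
     in cheaper W (solution False dl cs) (solution True dl cs))"

text \<open>The depot enters the demand list with demand 0, so that list positions agree with vertex
  numbers; \<open>Suc v\<close> skips it again in the output.\<close>

definition solve :: "nat \<times> nat \<times> nat list \<times> (int \<times> int) list list \<times> bool \<Rightarrow>
    (nat \<times> nat list \<times> nat list) list" where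
  "solve inp = (case inp of (n, k, ds, ws, _) \<Rightarrow>
     map (\<lambda>p. (fst p, 0 # map fst (snd p) @ [0], map (\<lambda>v. amount (snd p) (Suc v)) [0..<length ds]))
       (groups (0 # ds) (scale ws)))"

lemma ptime_denominator [ptime]:
  assumes "ptime ws" shows "ptime (\<lambda>x. denominator (ws x))"
  unfolding denominator_def
proof (rule ptime_fold_add[where r = "[:0, 1:]"])
  fix x :: 'a and e :: "int \<times> int" and s :: int
  show "size_of (s * snd e) \<le> size_of s + poly [:0, 1:] (size_of x + size_of e)"
    using size_Num_arith(3)[of s "snd e"] by (cases e) simp
qed (intro ptime assms)+

lemma ptime_scale [ptime]: "ptime ws \<Longrightarrow> ptime (\<lambda>x. scale (ws x))"
  by (rule ptime_comp[of ws "\<lambda>ws. scale ws"], assumption, unfold scale_def) (intro ptime)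

lemma ptime_cost_matrix [ptime]:
  assumes "ptime idx" "ptime dl" "ptime W"
  shows "ptime (\<lambda>x. cost_matrix (idx x) (dl x) (W x))"
proof -
  have "ptime (\<lambda>(idx, dl, W). cost_matrix idx dl W)"
    unfolding cost_matrix_def case_prod_beta by (intro ptime)
  from ptime_comp[OF _ this, of "\<lambda>x. (idx x, dl x, W x)"] show ?thesis
    using assms by (simp add: ptime)
qed

lemma ptime_assignment [ptime]:
  "ptime idx \<Longrightarrow> ptime c \<Longrightarrow> ptime (\<lambda>x. assignment (idx x) (c x))"
  unfolding assignment_def by (intro ptime)

lemma ptime_solution [ptime]:
  assumes "ptime rot" "ptime dl" "ptime cs"
  shows "ptime (\<lambda>x. solution (rot x) (dl x) (cs x))"
proof -
  have "ptime (\<lambda>(rot, dl, cs). solution rot dl cs)"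
    unfolding solution_def case_prod_beta by (intro ptime)
  from ptime_comp[OF _ this, of "\<lambda>x. (rot x, dl x, cs x)"] show ?thesis
    using assms by (simp add: ptime)
qed

lemma ptime_cheaper [ptime]:
  assumes "ptime W" "ptime A" "ptime B"
  shows "ptime (\<lambda>x. cheaper (W x) (A x) (B x))"
  unfolding cheaper_def by (intro ptime assms)

lemma ptime_groups [ptime]:
  assumes "ptime dl" "ptime W"
  shows "ptime (\<lambda>x. groups (dl x) (W x))"
proof -
  have "ptime (\<lambda>p. groups (fst p) (snd p))"
    unfolding groups_def by (intro ptime)
  then show ?thesis by (rule ptime_comp2[OF _ assms])
qed

lemma ptime_solve: "ptime solve"
  unfolding solve_def case_prod_beta by (intro ptime)

subsection \<open>Correctness\<close>

lemma sum_list_concat_distinct: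
  fixes f :: "nat \<Rightarrow> 'b :: comm_monoid_add"
  assumes "distinct (concat cs)"
  shows "(\<Sum>c\<leftarrow>cs. \<Sum>v\<leftarrow>c. f v) = (\<Sum>v\<in>set (concat cs). f v)"
proof -
  have "(\<Sum>c\<leftarrow>cs. \<Sum>v\<leftarrow>c. f v) = (\<Sum>v\<leftarrow>concat cs. f v)"
    by (induction cs) auto
  also have "\<dots> = (\<Sum>v\<in>set (concat cs). f v)"
    by (rule sum_list_distinct_conv_sum_set[OF assms])
  finally show ?thesis .
qed

lemma sum_list_mem_concat:
  assumes "distinct (concat cs)"
  shows "(\<Sum>c\<leftarrow>cs. if v \<in> set c then k else 0) = (if v \<in> set (concat cs) then k else (0 :: nat))"
  using assms
proof (induction cs)
  case (Cons c cs)
  then show ?case by auto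
qed simp

text \<open>\<open>tight_matching\<close> only asks for all rows to be matched. As there are equally
  many columns, none can be left over.\<close>

lemma tight_matching_total:
  assumes "tight_matching N c y z N g" "v < N"
  shows "\<exists>u. g v = Some u"
proof (rule ccontr)
  assume none: "\<not> ?thesis"
  obtain h where h: "\<And>u. u < N \<Longrightarrow> g (h u) = Some u"
    using tight_matchingD(3)[OF assms(1)] by metis
  have "inj_on h {..<N}" using h by (intro inj_onI) (metis lessThan_iff option.inject)
  moreover have "h ` {..<N} \<subseteq> {..<N} - {v}"
    using h tight_matchingD(1)[OF assms(1)] none by fastforce
  ultimately have "card {..<N} \<le> card ({..<N} - {v})" by (intro card_inj_on_le) auto
  with assms(2) show False by simp
qed

context metric_demands
begin

lemma assign_cost_sym: "u \<le> n \<Longrightarrow> v \<le> n \<Longrightarrow> assign_cost u v = assign_cost v u"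
  using W_sym by (auto simp: assign_cost_def)

text \<open>The assignment leaves the third claim through its dual certificate \<open>p v\<close>,
  the row plus the column potential of \<open>v\<close>. Symmetry of the cost allows adding the
  constraints for both orders of a pair. All chosen edges are tight and \<open>f\<close> permutes
  the vertices, so the potentials sum up to the cost of the assignment.\<close>

theorem groups_correct:
  fixes dl :: "nat list" and w :: "int list list"
  assumes dl: "length dl = Suc n" "nth_default 0 dl = d"
    and w: "\<And>u v. u \<le> n \<Longrightarrow> v \<le> n \<Longrightarrow> entry w u v = W u v"
  shows "v \<le> n \<Longrightarrow> delivered (groups dl w) v = d v"
    and "p \<in> set (groups dl w) \<Longrightarrow> valid_group {v. v \<le> n \<and> 0 < d v} (snd p)"
    and "\<exists>p. (\<forall>u\<le>n. \<forall>v\<le>n. p u + p v \<le> 2 * assign_cost u v) \<and>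
      2 * total_cost W (groups dl w) \<le> 2 * (\<Sum>v\<le>n. int (d v) * W 0 v) + (\<Sum>v\<le>n. p v)"
proof -
  define idx where "idx = [0..<Suc n]"
  define c where "c = cost_matrix idx dl w"
  have c: "entry c u v = assign_cost u v" if "u \<le> n" "v \<le> n" for u v
    using that w by (simp add: c_def cost_matrix_def entry_def[of "map _ _"] idx_def assign_cost_def dl del: upt_Suc)
  have "0 \<le> entry c u v" if "u < Suc n" "v < Suc n" for u v
    using that W_nonneg by (simp add: c assign_cost_def)
  then obtain M y z where h: "hungarian idx c = (M, y, z)"
    and feas: "feasible_potentials (Suc n) c y z"
    and tm: "tight_matching (Suc n) c y z (Suc n) (nth_default None M)"
    unfolding idx_def by (rule hungarian_correct)
  define S where "S = assignment idx c"
  define f where "f = nth_default 0 S"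
  have f: "nth_default None M v = Some (f v)" if v: "v < Suc n" for v
  proof -
    obtain u where u: "nth_default None M v = Some u" using tight_matching_total[OF tm v] by blast
    then have "v < length M" "M ! v = Some u" by (auto simp: nth_default_def split: if_splits)
    then show ?thesis using u by (simp add: f_def S_def assignment_def h nth_default_def)
  qed
  have f_lt: "f v < Suc n" and f_tight: "nth_default 0 y (f v) + nth_default 0 z v = entry c (f v) v"
    if "v < Suc n" for v
    using tight_matchingD(1)[OF tm f[OF that]] by (auto simp: tight_def)
  have f_inj: "inj_on f {..<Suc n}"
    using tight_matchingD(2)[OF tm] f by (intro inj_onI) (metis lessThan_iff)
  have f_img: "f ` {..<Suc n} = {..<Suc n}"
    using f_lt by (intro endo_inj_surj f_inj) auto
  define cs where "cs = cycles idx S"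
  have cs: "distinct (concat cs)" "set (concat cs) = {..n}" "\<And>c. c \<in> set cs \<Longrightarrow> is_cycle f c"
    using cycles_partition[of "Suc n" S] f_lt f_inj
    unfolding cs_def idx_def f_def by (auto simp: lessThan_Suc_atMost)
  define A where "A rot = solution rot dl cs" for rot
  have groups: "groups dl w = A False \<or> groups dl w = A True"
    and total: "2 * total_cost W (groups dl w) \<le> total_cost W (A False) + total_cost W (A True)"
    if total_eq: "\<And>rot. total_cost (entry w) (A rot) = total_cost W (A rot)"
    using total_eq[of True] total_eq[of False]
    unfolding groups_def Let_def dl(1) idx_def[symmetric] c_def[symmetric] S_def[symmetric] cs_def[symmetric]
    by (auto simp: A_def cheaper_def)
  have cyc: "distinct x" "set x \<subseteq> {..n}" "x \<noteq> []" if "x \<in> set cs" for x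
    using cs that by (auto simp: is_cycle_def distinct_concat_iff)
  have A: "A rot = concat (map (emit rot d) cs)" for rot
    by (simp add: A_def solution_def dl)
  have valid: "valid_group {v. v \<le> n \<and> 0 < d v} (snd p)" if p: "p \<in> set (A rot)" for p rot
  proof -
    from p obtain x where x: "x \<in> set cs" "p \<in> set (emit rot d x)" by (auto simp: A)
    show ?thesis
      by (rule valid_group_mono[OF valid_emit[OF cyc(1)[OF x(1)] x(2)]]) (use cyc(2)[OF x(1)] in auto)
  qed
  have walk_eq: "walk (entry w) xs = walk W xs" if "set xs \<subseteq> {..n}" for xs
    using that by (induction xs rule: induct_list012) (auto simp: w)
  have total_eq: "total_cost (entry w) (A rot) = total_cost W (A rot)" for rot
    unfolding total_cost_def group_cost_def
  proof (intro arg_cong[of _ _ sum_list] map_cong refl arg_cong2[of _ _ _ _ "(*)"])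
    fix p assume "p \<in> set (A rot)"
    from valid[OF this] show "walk (entry w) (0 # map fst (snd p) @ [0]) = walk W (0 # map fst (snd p) @ [0])"
      by (intro walk_eq) (auto simp: valid_group_def)
  qed
  note groups = groups[OF total_eq] and total = total[OF total_eq]
  show "p \<in> set (groups dl w) \<Longrightarrow> valid_group {v. v \<le> n \<and> 0 < d v} (snd p)"
    using groups valid by metis
  show "delivered (groups dl w) v = d v" if "v \<le> n"
  proof -
    have "delivered (A rot) v = d v" for rot
    proof -
      have "delivered (A rot) v = (\<Sum>x\<leftarrow>cs. if v \<in> set x then d v else 0)"
        unfolding A delivered_concat map_map comp_def
        by (intro arg_cong[of _ _ sum_list] map_cong refl delivered_emit cyc)
      then show ?thesis using sum_list_mem_concat[OF cs(1), of v "d v"] that unfolding cs(2) by simp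
    qed
    then show ?thesis using groups by auto
  qed
  define p where "p v = nth_default 0 y v + nth_default 0 z v" for v
  have "p u + p v \<le> 2 * assign_cost u v" if "u \<le> n" "v \<le> n" for u v
  proof -
    have "nth_default 0 y u + nth_default 0 z v \<le> entry c u v" "nth_default 0 y v + nth_default 0 z u \<le> entry c v u"
      using feas that unfolding feasible_potentials_def by auto
    then show ?thesis using assign_cost_sym[OF that] by (simp add: p_def c that)
  qed
  moreover have "total_cost W (A False) + total_cost W (A True) \<le>
      2 * (\<Sum>v\<le>n. int (d v) * W 0 v) + (\<Sum>v\<le>n. p v)"
  proof -
    have "total_cost W (A False) + total_cost W (A True) =
        (\<Sum>x\<leftarrow>cs. total_cost W (emit False d x) + total_cost W (emit True d x))"
      by (simp add: A total_cost_concat comp_def sum_list_addf)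
    also have "\<dots> \<le> (\<Sum>x\<leftarrow>cs. 2 * demand_radial x + walk assign_cost (x @ [hd x]))"
      by (intro sum_list_mono emit_cost cyc)
    also have "\<dots> = (\<Sum>x\<leftarrow>cs. \<Sum>v\<leftarrow>x. 2 * (int (d v) * W 0 v) + assign_cost (f v) v)"
    proof (intro arg_cong[of _ _ sum_list] map_cong refl)
      fix x assume "x \<in> set cs"
      then have "walk assign_cost (x @ [hd x]) = (\<Sum>v\<leftarrow>x. assign_cost (f v) v)"
        by (intro walk_cycle cs(3))
      then show "2 * demand_radial x + walk assign_cost (x @ [hd x]) =
          (\<Sum>v\<leftarrow>x. 2 * (int (d v) * W 0 v) + assign_cost (f v) v)"
        by (simp add: demand_radial_def sum_list_addf sum_list_const_mult)
    qed
    also have "\<dots> = (\<Sum>v\<le>n. 2 * (int (d v) * W 0 v) + assign_cost (f v) v)"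
      using sum_list_concat_distinct[OF cs(1)] cs(2) by simp
    also have "\<dots> = 2 * (\<Sum>v\<le>n. int (d v) * W 0 v) + (\<Sum>v\<le>n. assign_cost (f v) v)"
      by (simp add: sum.distrib sum_distrib_left)
    also have "(\<Sum>v\<le>n. assign_cost (f v) v) = (\<Sum>v\<le>n. nth_default 0 y (f v) + nth_default 0 z v)"
    proof (intro sum.cong refl)
      fix v assume "v \<in> {..n}"
      then have "v < Suc n" by simp
      then show "assign_cost (f v) v = nth_default 0 y (f v) + nth_default 0 z v"
        using f_tight[of v] f_lt[of v] c[of "f v" v] by simp
    qed
    also have "\<dots> = (\<Sum>v\<le>n. nth_default 0 y (f v)) + (\<Sum>v\<le>n. nth_default 0 z v)"
      by (simp add: sum.distrib)
    also have "(\<Sum>v\<le>n. nth_default 0 y (f v)) = (\<Sum>v\<le>n. nth_default 0 y v)"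
      using sum.reindex[OF f_inj, of "nth_default 0 y"] f_img by (simp add: lessThan_Suc_atMost)
    finally show ?thesis by (simp add: p_def sum.distrib)
  qed
  ultimately show "\<exists>p. (\<forall>u\<le>n. \<forall>v\<le>n. p u + p v \<le> 2 * assign_cost u v) \<and>
      2 * total_cost W (groups dl w) \<le> 2 * (\<Sum>v\<le>n. int (d v) * W 0 v) + (\<Sum>v\<le>n. p v)"
    using total by (intro exI[of _ p]) auto
qed

end

section \<open>Back to rational instances and their encodings\<close>

lemma walk_zip: "(\<Sum>(u, v)\<leftarrow>zip r (tl r). w u v) = walk w r"
  by (induction r rule: induct_list012) auto

text \<open>The final \<open>False\<close> is encoded as the \<open>Num 0\<close> that ends an
  \<open>enc_list\<close>; it turns the nested tuple into the encoding of a list with four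
  entries.\<close>

definition input :: "cvrp \<Rightarrow> nat \<times> nat \<times> nat list \<times> (int \<times> int) list list \<times> bool" where
  "input I = (customers I, capacity I, map (demand I) [1..<Suc (customers I)],
     map (\<lambda>u. map (\<lambda>v. quotient_of (weight I u v)) [0..<Suc (customers I)]) [0..<Suc (customers I)], False)"

lemma enc_input: "enc (input I) = enc_cvrp I"
proof -
  have "enc (quotient_of q) = enc_rat q" for q
    by (cases "quotient_of q") (simp add: enc_rat_def)
  moreover have "enc (m :: nat) = enc_nat m" for m by (simp add: Defs.enc_nat_def)
  ultimately show ?thesis
    by (simp add: input_def enc_cvrp_def enc_list_def comp_def del: upt_Suc)
qed

definition itinerary :: "(nat \<times> group) list \<Rightarrow> (nat \<times> tour) list" where
  "itinerary ms = map (\<lambda>p. (fst p, 0 # map fst (snd p) @ [0], amount (snd p))) ms"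

lemma enc_solve:
  "enc (solve (input I)) = enc_itinerary I (itinerary (groups (0 # map (demand I) [1..<Suc (customers I)])
     (scale (fst (snd (snd (snd (input I))))))))"
proof -
  have "[1..<Suc (customers I)] = map Suc [0..<customers I]" by (simp add: map_Suc_upt)
  moreover have "enc (m :: nat) = enc_nat m" "Num 0 = enc_nat 0" for m
    by (simp_all add: Defs.enc_nat_def)
  ultimately show ?thesis
    by (simp add: solve_def input_def enc_itinerary_def itinerary_def enc_tour_def enc_list_def comp_def
      del: upt_Suc)
qed

lemma denominator_pos_dvd:
  assumes "\<And>e. e \<in> set (concat ws) \<Longrightarrow> 0 < snd e"
  shows "0 < denominator ws" "\<And>e. e \<in> set (concat ws) \<Longrightarrow> snd e dvd denominator ws"
proof -
  have *: "fold (\<lambda>e s. s * snd e) es s = s * (\<Prod>e\<leftarrow>es. snd e)" for es :: "(int \<times> int) list" and s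
    by (induction es arbitrary: s) (auto simp: mult.assoc)
  have D: "denominator ws = (\<Prod>e\<leftarrow>concat ws. snd e)"
    by (simp add: denominator_def *)
  have "0 < (\<Prod>e\<leftarrow>es. snd e)" if "\<And>e. e \<in> set es \<Longrightarrow> 0 < snd e" for es :: "(int \<times> int) list"
    using that by (induction es) auto
  then show "0 < denominator ws" unfolding D using assms by blast
  have "snd e dvd (\<Prod>e\<leftarrow>es. snd e)" if "e \<in> set es" for e and es :: "(int \<times> int) list"
    using that by (induction es) auto
  then show "snd e dvd denominator ws" if "e \<in> set (concat ws)" for e
    unfolding D using that by blast
qed

lemma sum_amount_le: "finite A \<Longrightarrow> (\<Sum>v\<in>A. amount g v) \<le> sum_list (map snd g)"
proof (induction g)
  case (Cons e g)
  have "(\<Sum>v\<in>A. if fst e = v then snd e else 0) \<le> snd e"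
    using Cons.prems by simp
  then show ?case using Cons by (simp add: amount_def sum.distrib)
qed (simp add: amount_def)

lemma amount_pos: "0 < amount g v \<Longrightarrow> v \<in> set (map fst g)"
  by (induction g) (auto simp: amount_def split: if_splits)

lemma successively_neq_closed:
  "xs \<noteq> [] \<Longrightarrow> distinct xs \<Longrightarrow> 0 \<notin> set xs \<Longrightarrow> successively (\<noteq>) (0 # xs @ [0 :: nat])"
proof -
  have "distinct (x # xs) \<Longrightarrow> 0 \<notin> set (x # xs) \<Longrightarrow> successively (\<noteq>) (x # xs @ [0])" for x and xs :: "nat list"
    by (induction xs arbitrary: x) auto
  then show "xs \<noteq> [] \<Longrightarrow> distinct xs \<Longrightarrow> 0 \<notin> set xs \<Longrightarrow> ?thesis"
    by (cases xs) auto
qed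

lemma valid_group_is_tour:
  assumes "valid_group {v. v \<le> customers I \<and> 0 < d v} g" "d 0 = (0 :: nat)" "capacity I = 3"
  shows "is_tour I (0 # map fst g @ [0], amount g)"
proof -
  have *: "map fst g \<noteq> []" "distinct (map fst g)" "0 \<notin> set (map fst g)" "set (map fst g) \<subseteq> {0..customers I}"
    using assms by (auto simp: valid_group_def)
  have "(\<Sum>v\<in>{1..customers I}. amount g v) \<le> 3"
    using sum_amount_le[of "{1..customers I}" g] assms(1) by (simp add: valid_group_def)
  then show ?thesis
    using successively_neq_closed[OF *(1-3)] * amount_pos[of g] assms(3) by fastforce
qed

lemma sum_expand: "(\<Sum>T\<leftarrow>expand ms. f T) = (\<Sum>p\<leftarrow>ms. of_nat (fst p) * (f (snd p) :: 'a :: comm_semiring_1))"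
  by (induction ms) (auto simp: expand_def sum_list_replicate)

text \<open>Upper and lower bound are compared for the integral weights \<open>W\<close>, the given
  ones multiplied by the common denominator \<open>D\<close>. The positive factor \<open>D\<close>
  cancels at the end.\<close>

lemma solve_approx:
  assumes I: "I \<in> splittable_cvrp 3"
  defines "ms \<equiv> itinerary (groups (0 # map (demand I) [1..<Suc (customers I)])
     (scale (fst (snd (snd (snd (input I)))))))"
  shows "feasible I (expand ms)" "of_rat (cost I (expand ms)) \<le> 3 / 2 * opt I"
proof -
  define n where "n = customers I"
  define dl where "dl = 0 # map (demand I) [1..<Suc n]"
  define d where "d = nth_default 0 dl"
  define ws where "ws = map (\<lambda>u. map (\<lambda>v. quotient_of (weight I u v)) [0..<Suc n]) [0..<Suc n]"
  define D where "D = denominator ws"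
  define W where "W = entry (scale ws)"
  define gs where "gs = groups dl (scale ws)"
  have ms: "ms = itinerary gs"
    by (simp add: ms_def gs_def dl_def ws_def n_def input_def del: upt_Suc)
  have d: "d v = (if 1 \<le> v \<and> v \<le> n then demand I v else 0)" for v
    by (cases v) (auto simp: d_def dl_def nth_default_def simp del: upt_Suc)
  have dens: "0 < snd e" if "e \<in> set (concat ws)" for e
    using that quotient_of_denom_pos' by (auto simp: ws_def simp del: upt_Suc)
  have D: "0 < D" "\<And>u v. u \<le> n \<Longrightarrow> v \<le> n \<Longrightarrow> snd (quotient_of (weight I u v)) dvd D"
  proof -
    show "0 < D" unfolding D_def using dens by (rule denominator_pos_dvd)
    fix u v assume "u \<le> n" "v \<le> n"
    then have "quotient_of (weight I u v) \<in> set (concat ws)"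
      by (simp add: ws_def del: upt_Suc) (rule bexI[of _ u], rule imageI, auto)
    then show "snd (quotient_of (weight I u v)) dvd D"
      unfolding D_def using denominator_pos_dvd(2)[of ws] dens by blast
  qed
  have W: "of_int (W u v) = of_int D * weight I u v" if "u \<le> n" "v \<le> n" for u v
  proof -
    obtain a b where ab: "quotient_of (weight I u v) = (a, b)" by fastforce
    then have "b dvd D" "weight I u v = of_int a / of_int b" "0 < b"
      using D(2)[OF that] quotient_of_div quotient_of_denom_pos by auto
    moreover have "W u v = a * (D div b)"
      using that ab by (simp add: W_def entry_def scale_def D_def[symmetric])
        (simp add: ws_def D_def[symmetric] comp_def del: upt_Suc)
    ultimately show ?thesis by (auto simp: dvd_def)
  qed
  have inst: "cvrp_instance I" and cap: "capacity I = 3" using I by (auto simp: splittable_cvrp_def)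
  interpret metric_demands n W d
  proof
    fix u v x assume u: "u \<le> n"
    show "W u u = 0" using W[OF u u] inst u by (simp add: cvrp_instance_def n_def)
    assume v: "v \<le> n"
    have nn: "0 \<le> weight I u v" "weight I u v = weight I v u"
      using inst u v by (auto simp: cvrp_instance_def n_def)
    have "(of_int 0 :: rat) \<le> of_int (W u v)" using nn(1) D(1) by (simp add: W u v)
    then show "0 \<le> W u v" by simp
    have "(of_int (W u v) :: rat) = of_int (W v u)" using nn(2) by (simp add: W u v)
    then show "W u v = W v u" by (simp only: of_int_eq_iff)
    assume x: "x \<le> n"
    have "weight I u x \<le> weight I u v + weight I v x"
      using inst u v x by (auto simp: cvrp_instance_def n_def)
    then have "of_int D * weight I u x \<le> of_int D * (weight I u v + weight I v x)"
      using D(1) by (intro mult_left_mono) auto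
    then have "(of_int (W u x) :: rat) \<le> of_int (W u v + W v x)"
      by (simp add: W u v x distrib_left)
    then show "W u x \<le> W u v + W v x" by (simp only: of_int_le_iff)
  next
    show "d 0 = 0" by (simp add: d)
    show "1 \<le> d v" if "1 \<le> v" "v \<le> n" for v
      using inst that by (auto simp: d cvrp_instance_def n_def)
  qed
  have len: "length dl = Suc n" by (simp add: dl_def)
  note g = groups_correct[OF len d_def[symmetric], of "scale ws", folded W_def gs_def, OF refl]
  have walk_scale: "of_int (walk W r) = of_int D * walk (weight I) r" if "set r \<subseteq> {..n}" for r
    using that by (induction r rule: induct_list012) (auto simp: W distrib_left)
  have cost: "of_int D * cost I Ts = of_int (\<Sum>T\<leftarrow>Ts. walk W (fst T))"
    if "\<And>T. T \<in> set Ts \<Longrightarrow> set (fst T) \<subseteq> {..n}" for Ts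
    using that unfolding cost_def walk_zip
    by (induction Ts) (auto simp: distrib_left walk_scale)
  have tours: "T \<in> set (expand ms) \<Longrightarrow> is_tour I T" for T
    using valid_group_is_tour[OF g(2)[unfolded n_def] d_0 cap]
    by (auto simp: ms itinerary_def expand_def split: if_splits)
  show feas: "feasible I (expand ms)"
    unfolding feasible_def
  proof (intro conjI ballI tours)
    fix v assume v: "v \<in> {1..customers I}"
    have "(\<Sum>T\<leftarrow>expand ms. snd T v) = delivered gs v"
      unfolding sum_expand by (simp add: ms itinerary_def delivered_def comp_def)
    also have "\<dots> = demand I v" using g(1)[of v] v by (simp add: n_def[symmetric] d)
    finally show "(\<Sum>T\<leftarrow>expand ms. snd T v) = demand I v" .
  qed
  have sub: "set (fst T) \<subseteq> {..n}" if "is_tour I T" for T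
    using that by (cases T) (auto simp: n_def)
  have total: "(\<Sum>T\<leftarrow>expand ms. walk W (fst T)) = total_cost W gs"
    unfolding sum_expand by (simp add: ms itinerary_def total_cost_def group_cost_def comp_def)
  have bound: "2 * cost I (expand ms) \<le> 3 * cost I Ts" if Ts: "feasible I Ts" for Ts
  proof -
    obtain p where p: "\<And>u v. u \<le> n \<Longrightarrow> v \<le> n \<Longrightarrow> p u + p v \<le> 2 * assign_cost u v"
      "2 * total_cost W gs \<le> 2 * (\<Sum>v\<le>n. int (d v) * W 0 v) + (\<Sum>v\<le>n. p v)"
      using g(3) by blast
    have Ts_tour: "is_tour I T" if "T \<in> set Ts" for T using Ts that by (simp add: feasible_def)
    have "(\<Sum>v\<le>n. p v) + 2 * (\<Sum>v\<in>{1..n}. int (d v) * W 0 v) \<le> 3 * (\<Sum>T\<leftarrow>Ts. walk W (fst T))"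
    proof (rule lower_bound)
      show "r \<noteq> [] \<and> hd r = 0 \<and> last r = 0 \<and> set r \<subseteq> {..n} \<and>
          (\<forall>v. 0 < a v \<longrightarrow> v \<in> set r - {0}) \<and> (\<Sum>v\<in>{1..n}. a v) \<le> 3" if "(r, a) \<in> set Ts" for r a
        using Ts_tour[OF that] cap by (auto simp: n_def)
      show "(\<Sum>T\<leftarrow>Ts. snd T v) = d v" if "1 \<le> v" "v \<le> n" for v
        using Ts that by (simp add: feasible_def d n_def)
    qed (rule p(1))
    moreover have "(\<Sum>v\<le>n. int (d v) * W 0 v) = (\<Sum>v\<in>{1..n}. int (d v) * W 0 v)"
      by (rule sum.mono_neutral_right) (auto simp: d)
    ultimately have "2 * total_cost W gs \<le> 3 * (\<Sum>T\<leftarrow>Ts. walk W (fst T))"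
      using p(2) by simp
    then have "(of_int (2 * total_cost W gs) :: rat) \<le> of_int (3 * (\<Sum>T\<leftarrow>Ts. walk W (fst T)))"
      by (simp only: of_int_le_iff)
    then have "of_int D * (2 * cost I (expand ms)) \<le> of_int D * (3 * cost I Ts)"
      using cost[of "expand ms"] cost[of Ts] sub tours Ts_tour total by simp
    then show ?thesis using D(1) by (simp only: mult_le_cancel_left_pos of_int_0_less_iff)
  qed
  have "2 / 3 * of_rat (cost I (expand ms)) \<le> opt I"
    unfolding opt_def
  proof (rule cINF_greatest)
    \<comment> \<open>The computed itinerary itself shows that the infimum is taken over a nonempty
      set.\<close>
    show "{Ts. feasible I Ts} \<noteq> {}" using feas by blast
    fix Ts assume "Ts \<in> {Ts. feasible I Ts}"
    then have "(of_rat (2 * cost I (expand ms)) :: real) \<le> of_rat (3 * cost I Ts)"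
      using bound by (simp only: of_rat_less_eq mem_Collect_eq)
    then show "2 / 3 * real_of_rat (cost I (expand ms)) \<le> of_rat (cost I Ts)"
      by (simp add: of_rat_mult)
  qed
  then show "of_rat (cost I (expand ms)) \<le> 3 / 2 * opt I" by simp
qed

lemma poly_time_approx_splittable: "\<exists>p. poly_time_approx (3 / 2) (splittable_cvrp 3) p"
proof -
  obtain p q where p: "\<And>x. \<exists>t. run p (enc x) (enc (solve x)) t \<and> t \<le> poly q (size_of x)"
    using ptimeE[OF ptime_solve] by blast
  have "poly_time_approx (3 / 2) (splittable_cvrp 3) p"
    unfolding poly_time_approx_def
  proof (intro exI[of _ q] ballI)
    fix I assume "I \<in> splittable_cvrp 3"
    from solve_approx[OF this] p[of "input I"] show "\<exists>ms t. run p (enc_cvrp I) (enc_itinerary I ms) t \<and>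
        t \<le> poly q (bit_size (enc_cvrp I)) \<and> feasible I (expand ms) \<and>
        of_rat (cost I (expand ms)) \<le> 3 / 2 * opt I"
      unfolding enc_solve enc_input by blast
  qed
  then show ?thesis ..
qed

theorem theorem1:
  "(\<exists>p. poly_time_approx (3 / 2) (splittable_cvrp 3) p) \<and>
   (\<exists>p. poly_time_approx (3 / 2) (unit_demand_cvrp 3) p)"
proof -
  have "unit_demand_cvrp 3 \<subseteq> splittable_cvrp 3"
    by (auto simp: unit_demand_cvrp_def splittable_cvrp_def)
  then show ?thesis
    using poly_time_approx_splittable unfolding poly_time_approx_def by (meson subsetD)
qed

end
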